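(* Let $k$ be a field and let $A$ be a standard graded $k$-algebra of Krull dimension $d$ with Hilbert series $$\mathrm{Hilb}(A,t) = \frac{h_0 + \cdots + h_s t^s}{(1-t)^{d}}$$ such that $h_i \geq 0$ for $i=0,\ldots,s$. Then for every integer $r \geq 1$ the Hilbert series $$\mathrm{Hilb}(A^{\langle r \rangle},t) = \frac{h_0^{\langle r \rangle} + \cdots + h_m^{\langle r \rangle} t^m}{(1-t)^d}, \qquad m:=\max(s,d),$$ of the $r$th Veronese algebra of $A$ satisfies $h_i^{\langle r \rangle} \geq h_i$ for $0 \leq i \leq d$. Moreover, if $r \geq d$ then $h_i^{\langle r \rangle} > h_i$ for $1 \leq i \leq d-1$. In particular, all these conclusions hold if $A$ is Cohen–Macaulay.
   Context: A standard graded $k$-algebra is a graded $k$-algebra $A = \bigoplus_{n\ge 0} A_n$ (commutative) with $A_0 = k$ that is finitely generated as a $k$-algebra by elements of degree $1$. Its Hilbert series is $\mathrm{Hilb}(A,t) = \sum_{n\ge 0} \dim_k A_n\, t^n$; by the Hilbert–Serre theorem it has the form $h(t)/(1-t)^d$ with $h(t)$ a polynomial, $h(1)\geq 1$, and $d$ the Krull dimension of $A$. The $r$th Veronese algebra is $A^{\langle r\rangle} = \bigoplus_{n\ge 0} A_{nr}$, where $A_{nr}$ is the component of degree $n$, so $\mathrm{Hilb}(A^{\langle r\rangle},t) = \sum_{n\ge 0} \dim_k A_{rn}\, t^n$; it can be written as a polynomial of degree at most $\max(s,d)$ divided by $(1-t)^d$. Coefficients $h_i$ with $i>s$ are taken to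 be $0$. *)

theory Defs
  imports
    "HOL-Algebra.Algebra"
    "HOL-Computational_Algebra.Computational_Algebra"
    "HOL-Library.Extended_Nat"
begin

text \<open>
  The ground field is a subfield \<open>K\<close> of the algebra, so that \<open>A\<^sub>0 = k\<close> becomes the literal
  equation \<open>gr 0 = K\<close>.  Despite its name, the library predicate \<^const>\<open>subalgebra\<close> \<open>K V A\<close>
  only says that \<open>V\<close> is a \<open>K\<close>-linear subspace of \<open>A\<close>.
\<close>

locale graded_algebra = cring A + K?: subfield K A
  for K :: "'a set" and A :: "('a, 'b) ring_scheme" (structure) +
  fixes gr :: "nat \<Rightarrow> 'a set"
  assumes gr_subspace: "subalgebra K (gr n) A"
    and gr_decomp: "x \<in> carrier A \<Longrightarrow>
      \<exists>!f. (\<forall>n. f n \<in> gr n) \<and> finite {n. f n \<noteq> \<zero>} \<and> x = (\<Oplus>n\<in>{n. f n \<noteq> \<zero>}. f n)"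
    and gr_mult: "\<lbrakk> x \<in> gr m; y \<in> gr n \<rbrakk> \<Longrightarrow> x \<otimes> y \<in> gr (m + n)"

locale standard_graded_algebra = graded_algebra +
  assumes gr_0: "gr 0 = K"
    and gr_1_generates: "\<exists>S. finite S \<and> S \<subseteq> gr 1 \<and> generate_ring A (K \<union> S) = carrier A"

definition hilbert_series :: "'a set \<Rightarrow> ('a, 'b) ring_scheme \<Rightarrow> (nat \<Rightarrow> 'a set) \<Rightarrow> rat fps" where
  "hilbert_series K A gr = Abs_fps (\<lambda>n. of_nat (ring.dim A K (gr n)))"

definition veronese_grading :: "nat \<Rightarrow> (nat \<Rightarrow> 'a set) \<Rightarrow> nat \<Rightarrow> 'a set" where
  "veronese_grading r gr n = gr (n * r)"

definition veronese :: "nat \<Rightarrow> (nat \<Rightarrow> 'a set) \<Rightarrow> ('a, 'b) ring_scheme \<Rightarrow> ('a, 'b) ring_scheme" where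
  "veronese r gr A = A \<lparr> carrier :=
     {finsum A f N | f N. finite N \<and> (\<forall>n\<in>N. f n \<in> veronese_grading r gr n)} \<rparr>"

text \<open>
  A chain of \<open>n + 1\<close> distinct primes has length \<open>n\<close>.
\<close>

definition krull_dim :: "('a, 'b) ring_scheme \<Rightarrow> enat" where
  "krull_dim A = (SUP C\<in>{C. subset.chain {P. primeideal P A} C \<and> finite C \<and> C \<noteq> {}}.
     enat (card C - 1))"

definition height :: "('a, 'b) ring_scheme \<Rightarrow> 'a set \<Rightarrow> enat" where
  "height A P = (SUP C\<in>{C. subset.chain {Q. primeideal Q A \<and> Q \<subseteq> P} C \<and> finite C \<and> C \<noteq> {}}.
     enat (card C - 1))"

definition regular_sequence :: "('a, 'b) ring_scheme \<Rightarrow> 'a list \<Rightarrow> bool" where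
  "regular_sequence A xs \<longleftrightarrow> set xs \<subseteq> carrier A \<and> Idl\<^bsub>A\<^esub> (set xs) \<noteq> carrier A \<and>
     (\<forall>i<length xs. \<forall>y\<in>carrier A.
        xs ! i \<otimes>\<^bsub>A\<^esub> y \<in> Idl\<^bsub>A\<^esub> (set (take i xs)) \<longrightarrow> y \<in> Idl\<^bsub>A\<^esub> (set (take i xs)))"

definition depth :: "('a, 'b) ring_scheme \<Rightarrow> 'a set \<Rightarrow> enat" where
  "depth A I = (SUP xs\<in>{xs. regular_sequence A xs \<and> set xs \<subseteq> I}. enat (length xs))"

text \<open>
  Eisenbud's form of the definition (Commutative Algebra, Section 18.2), which avoids
  localization: for a maximal ideal \<open>M\<close> of a Noetherian ring, \<open>depth A M\<close> and \<open>height A M\<close> are the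
  depth and the dimension of the local ring at \<open>M\<close>.
\<close>

definition cohen_macaulay :: "('a, 'b) ring_scheme \<Rightarrow> bool" where
  "cohen_macaulay A \<longleftrightarrow> cring A \<and> noetherian_ring A \<and>
     (\<forall>M. maximalideal M A \<longrightarrow> depth A M = height A M)"

end

theory Submission
  imports Defs
begin

text \<open>
  Multiplying numerator and denominator of \<open>h / (1 - t)\<^sup>d\<close> by \<open>(1 + \<dots> + t\<^sup>r\<^sup>-\<^sup>1)\<^sup>d\<close> gives
  \<open>h\<^sub>i\<^sup>\<langle>\<^sup>r\<^sup>\<rangle> = (\<Sum>j. c\<^sub>r\<^sub>i\<^sub>-\<^sub>j h\<^sub>j)\<close>, where the coefficients \<open>c\<^sub>k\<close> of that power are at least \<open>1\<close> for
  \<open>k \<le> d (r - 1)\<close>.  The summand \<open>j = i\<close> yields the weak inequality, and \<open>j = 0\<close>, where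
  \<open>h\<^sub>0 = 1\<close>, the strict one.

  It remains to see that \<open>h\<close> is nonnegative if \<open>A\<close> is Cohen--Macaulay.  The irrelevant ideal \<open>M\<close>
  contains a regular sequence \<open>x\<close> of length \<open>e = depth M = height M\<close>.  Then \<open>M\<close> is minimal over \<open>(x)\<close>,
  so \<open>dim A\<^sub><\<^sub>n = O(n\<^sup>e)\<close>, and growth drops by a factor \<open>n\<close> along every proper inclusion of primes;
  hence \<open>d \<le> e\<close>.  Over an infinite field one would now divide out \<open>d\<close> general linear forms.  To
  treat all fields alike, replace a module \<open>V\<close> by the cokernel of the \<open>(m + n) \<times> m\<close> Toeplitz matrix
  of the generators \<open>y\<^sub>1, \<dots>, y\<^sub>n\<close> of degree \<open>1\<close>, which is multiplication by
  \<open>y\<^sub>1 + y\<^sub>2 z + \<dots> + y\<^sub>n z\<^sup>n\<^sup>-\<^sup>1\<close> on polynomials in \<open>z\<close> of bounded degree.  It is injective by McCoy's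
  argument, the cokernel has the regular sequence \<open>x\<^sub>1, \<dots>, x\<^sub>d\<^sub>-\<^sub>1\<close>, and its Hilbert series is that
  of \<open>V\<close> times \<open>(m + n) - m t\<close>.  After \<open>d\<close> steps, \<open>Hilb(A, t) ((m + n) - m t)\<^sup>d\<close> has nonnegative
  coefficients; dividing by \<open>m\<^sup>d\<close> and letting \<open>m\<close> tend to infinity gives the claim.
\<close>

section \<open>Dimensions of subspaces\<close>

text \<open>The Cohen--Macaulay condition compares depth and height at the irrelevant ideal M,
  whereas the numerator is formed with the Krull dimension of the whole ring; the growth estimate is
  there to identify the two. No localization is formed: elements outside M are inverted modulo each
  step of the degree filtration, and primes inside M arise from ideals maximal among those avoiding
  a multiplicative set.

  The regular sequence obtained from the depth may be inhomogeneous, and dividing by it would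
  destroy the grading. It is therefore kept as a mere witness: the modules whose dimensions are
  counted are cokernels of matrices with entries of degree 1 and stay graded. McCoy's argument needs
  that no nonzero element is annihilated by all of M, and one regular element in M ensures this. For
  x_i to remain regular on the cokernel, injectivity is required modulo x_1, ..., x_i, where x_(i+1)
  is the witness; hence each step spends one element of the sequence. The m columns sit one degree
  higher than the m + n rows, whence the factor of the Hilbert series.\<close>

lemma (in ring) subalgebraD:
  assumes "subalgebra K V R"
  shows "V \<subseteq> carrier R" "\<zero> \<in> V" "\<And>x y. x \<in> V \<Longrightarrow> y \<in> V \<Longrightarrow> x \<oplus> y \<in> V"
    "\<And>x. x \<in> V \<Longrightarrow> \<ominus> x \<in> V" "\<And>k x. k \<in> K \<Longrightarrow> x \<in> V \<Longrightarrow> k \<otimes> x \<in> V"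
    "\<And>x y. x \<in> V \<Longrightarrow> y \<in> V \<Longrightarrow> x \<ominus> y \<in> V"
proof -
  interpret V: subalgebra K V R by fact
  show "V \<subseteq> carrier R" "\<zero> \<in> V" "\<And>x y. x \<in> V \<Longrightarrow> y \<in> V \<Longrightarrow> x \<oplus> y \<in> V"
    "\<And>x. x \<in> V \<Longrightarrow> \<ominus> x \<in> V" "\<And>k x. k \<in> K \<Longrightarrow> x \<in> V \<Longrightarrow> k \<otimes> x \<in> V"
    using V.subset V.one_closed V.m_closed V.m_inv_closed V.smult_closed
    by (auto simp: a_inv_def)
  then show "\<And>x y. x \<in> V \<Longrightarrow> y \<in> V \<Longrightarrow> x \<ominus> y \<in> V"
    by (simp add: a_minus_def)
qed

lemma (in ring) subalgebraI:
  assumes "V \<subseteq> carrier R" "\<zero> \<in> V" "\<And>x y. x \<in> V \<Longrightarrow> y \<in> V \<Longrightarrow> x \<oplus> y \<in> V"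
    "\<And>x. x \<in> V \<Longrightarrow> \<ominus> x \<in> V" "\<And>k x. k \<in> K \<Longrightarrow> x \<in> V \<Longrightarrow> k \<otimes> x \<in> V"
  shows "subalgebra K V R"
  unfolding subalgebra_def subalgebra_axioms_def
  using assms by (auto intro!: add.subgroupI simp: a_inv_def)

lemma (in ring) dimension_subalgebra:
  assumes "subfield K R" "dimension n K E"
  shows "subalgebra K E R"
  using assms finite_dimension_imp_subalgebra finite_dimensionI by blast

lemma (in ring) set_add_iff: "x \<in> U <+>\<^bsub>R\<^esub> V \<longleftrightarrow> (\<exists>u\<in>U. \<exists>v\<in>V. x = u \<oplus> v)"
  by (auto simp: set_add_def set_mult_def)

lemma (in ring) subalgebra_set_add:
  assumes "subalgebra K U R" "subalgebra K V R" "K \<subseteq> carrier R"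
  shows "subalgebra K (U <+>\<^bsub>R\<^esub> V) R"
proof (rule subalgebraI)
  note U = subalgebraD[OF assms(1)] and V = subalgebraD[OF assms(2)]
  show "U <+>\<^bsub>R\<^esub> V \<subseteq> carrier R"
    using U(1) V(1) by (auto simp: set_add_iff subset_iff)
  show "\<zero> \<in> U <+>\<^bsub>R\<^esub> V"
    using U(2) V(2) by (force simp: set_add_iff)
  fix x assume "x \<in> U <+>\<^bsub>R\<^esub> V"
  then obtain u v where x: "u \<in> U" "v \<in> V" "x = u \<oplus> v"
    by (auto simp: set_add_iff)
  have c: "u \<in> carrier R" "v \<in> carrier R" using x U(1) V(1) by auto
  show "\<ominus> x \<in> U <+>\<^bsub>R\<^esub> V"
    using x c U(4) V(4) minus_add by (auto simp: set_add_iff)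
  show "k \<otimes> x \<in> U <+>\<^bsub>R\<^esub> V" if "k \<in> K" for k
    using that x c U(5) V(5) assms(3) r_distr[of u v k] unfolding set_add_iff by blast
  fix y assume "y \<in> U <+>\<^bsub>R\<^esub> V"
  then obtain u' v' where y: "u' \<in> U" "v' \<in> V" "y = u' \<oplus> v'"
    by (auto simp: set_add_iff)
  have c': "u' \<in> carrier R" "v' \<in> carrier R" using y U(1) V(1) by auto
  have "x \<oplus> y = (u \<oplus> u') \<oplus> (v \<oplus> v')"
    using x y c c' by (simp add: a_ac)
  then show "x \<oplus> y \<in> U <+>\<^bsub>R\<^esub> V"
    using x y U(3) V(3) unfolding set_add_iff by blast
qed

lemma (in ring) dimension_mono:
  assumes "subfield K R" "dimension n K E" "dimension m K F" "E \<subseteq> F"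
  shows "n \<le> m"
proof -
  obtain Vs where "set Vs \<subseteq> carrier R" "independent K Vs" "length Vs = n" "Span K Vs = E"
    using exists_base[OF assms(1,2)] by blast
  then show ?thesis
    using independent_length_le_dimension[OF assms(1,3), of Vs] Span_base_incl[OF assms(1)] assms(4) by blast
qed

lemma (in ring) dimension_subspace:
  assumes "subfield K R" "dimension n K F" "subalgebra K E R" "E \<subseteq> F"
  shows "dimension (dim K E) K E"
  using subalbegra_incl_imp_finite_dimension[OF assms(1) finite_dimensionI[OF assms(2)] assms(3,4)]
    finite_dimensionE[OF assms(1)] by (simp add: over_def)

lemma (in ring) dim_eq:
  assumes "subfield K R" "dimension n K E" shows "dim K E = n"
  using dimI[OF assms] by (simp add: over_def)

lemma (in ring) Span_dimension:
  assumes "subfield K R" "set Us \<subseteq> carrier R"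
  obtains n where "n \<le> length Us" "dimension n K (Span K Us)"
proof -
  have "\<exists>n\<le>length Us. dimension n K (Span K Us)"
    using assms(2)
  proof (induction Us)
    case Nil
    then show ?case by auto
  next
    case (Cons u Us)
    then obtain n where n: "n \<le> length Us" "dimension n K (Span K Us)" by auto
    show ?case
    proof (cases "u \<in> Span K Us")
      case True
      have "Span K (u # Us) = Span K Us"
        using mono_Span_subset[OF assms(1), of "u # Us" Us] mono_Span[OF assms(1), of Us u] True Cons.prems
          Span_base_incl[OF assms(1), of Us] by auto
      then show ?thesis using n by (auto simp del: Span.simps intro!: exI[of _ n])
    next
      case False
      then have "dimension (Suc n) K (Span K (u # Us))"
        using Suc_dim[OF _ False n(2)] Cons.prems by simp
      then show ?thesis using n by (intro exI[of _ "Suc n"]) simp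
    qed
  qed
  then show ?thesis using that by blast
qed

text \<open>A basis is carried over one vector at a time; injectivity keeps each new image outside
  the span of the earlier ones. The scalars may change as well: \<open>\<sigma>\<close> is
  \<open>const_fun\<close> when a graded component is embedded into a ring of functions, and the
  identity inside that ring.\<close>

lemma dimension_inj_image:
  assumes R: "ring R" "subfield K R" and S: "ring S" "subfield L S"
    and n: "ring.dimension R n K E"
    and phi: "\<And>x. x \<in> E \<Longrightarrow> \<phi> x \<in> carrier S" "inj_on \<phi> E"
      "\<And>x y. x \<in> E \<Longrightarrow> y \<in> E \<Longrightarrow> \<phi> (x \<oplus>\<^bsub>R\<^esub> y) = \<phi> x \<oplus>\<^bsub>S\<^esub> \<phi> y"
      "\<And>k x. k \<in> K \<Longrightarrow> x \<in> E \<Longrightarrow> \<phi> (k \<otimes>\<^bsub>R\<^esub> x) = \<sigma> k \<otimes>\<^bsub>S\<^esub> \<phi> x"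
    and sigma: "\<sigma> ` K = L"
  shows "ring.dimension S n L (\<phi> ` E)"
proof -
  interpret R: ring R by fact
  interpret S: ring S by fact
  show ?thesis
    using n phi sigma R(2) S(2)
  proof (induction n K E arbitrary: rule: R.dimension.induct)
    case (zero_dim K)
    have "\<phi> \<zero>\<^bsub>R\<^esub> \<oplus>\<^bsub>S\<^esub> \<phi> \<zero>\<^bsub>R\<^esub> = \<phi> \<zero>\<^bsub>R\<^esub>"
      by (metis R.l_zero R.zero_closed singletonI zero_dim.prems(3))
    then have "\<phi> \<zero>\<^bsub>R\<^esub> = \<zero>\<^bsub>S\<^esub>"
      using zero_dim.prems(1) by (metis S.add.r_cancel_one' singletonI)
    then show ?case by (simp add: S.dimension.zero_dim)
  next
    case (Suc_dim v E n K)
    have sE: "subalgebra K E R"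
      using R.dimension_subalgebra[OF Suc_dim.prems(6) Suc_dim.hyps(3)] .
    note E = R.subalgebraD[OF sE]
    let ?L = "R.line_extension K v E"
    have Kc: "K \<subseteq> carrier R" using Suc_dim.prems(6) by (simp add: subfieldE(3))
    have K01: "\<zero>\<^bsub>R\<^esub> \<in> K" "\<one>\<^bsub>R\<^esub> \<in> K"
      using Suc_dim.prems(6) subringE(2,3) subfieldE(1) by metis+
    have EL: "E \<subseteq> ?L"
    proof
      fix x assume "x \<in> E"
      then have "x = \<zero>\<^bsub>R\<^esub> \<otimes>\<^bsub>R\<^esub> v \<oplus>\<^bsub>R\<^esub> x" using E(1) Suc_dim.hyps(1) by auto
      then show "x \<in> ?L" using K01 \<open>x \<in> E\<close> unfolding R.line_extension_mem_iff by blast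
    qed
    have kL: "k \<otimes>\<^bsub>R\<^esub> v \<in> ?L" if "k \<in> K" for k
    proof -
      have "k \<otimes>\<^bsub>R\<^esub> v = k \<otimes>\<^bsub>R\<^esub> v \<oplus>\<^bsub>R\<^esub> \<zero>\<^bsub>R\<^esub>" using that Kc Suc_dim.hyps(1) by auto
      then show ?thesis using that E(2) unfolding R.line_extension_mem_iff by blast
    qed
    have vL: "v \<in> ?L" using kL[OF K01(2)] Suc_dim.hyps(1) by simp
    have "S.dimension n L (\<phi> ` E)"
      using Suc_dim.IH[OF Suc_dim.prems(1)[OF subsetD[OF EL]] inj_on_subset[OF Suc_dim.prems(2) EL]
          Suc_dim.prems(3)[OF subsetD[OF EL] subsetD[OF EL]] Suc_dim.prems(4)[OF _ subsetD[OF EL]]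
          Suc_dim.prems(5-7)] .
    moreover have "\<phi> v \<notin> \<phi> ` E"
      using Suc_dim.prems(2) vL EL Suc_dim.hyps(2) by (meson inj_on_image_mem_iff)
    moreover have "\<phi> v \<in> carrier S" using Suc_dim.prems(1) vL .
    ultimately have "S.dimension (Suc n) L (S.line_extension L (\<phi> v) (\<phi> ` E))"
      by (intro S.Suc_dim)
    moreover have "S.line_extension L (\<phi> v) (\<phi> ` E) = \<phi> ` ?L"
    proof -
      have *: "\<phi> (k \<otimes>\<^bsub>R\<^esub> v \<oplus>\<^bsub>R\<^esub> x) = \<sigma> k \<otimes>\<^bsub>S\<^esub> \<phi> v \<oplus>\<^bsub>S\<^esub> \<phi> x" if "k \<in> K" "x \<in> E" for k x
        using Suc_dim.prems(3)[of "k \<otimes>\<^bsub>R\<^esub> v" x] Suc_dim.prems(4)[of k v] that kL vL EL by auto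
      show ?thesis
      proof (intro equalityI subsetI)
        fix y assume "y \<in> S.line_extension L (\<phi> v) (\<phi> ` E)"
        then obtain k x where "k \<in> K" "x \<in> E" "y = \<sigma> k \<otimes>\<^bsub>S\<^esub> \<phi> v \<oplus>\<^bsub>S\<^esub> \<phi> x"
          unfolding S.line_extension_mem_iff using Suc_dim.prems(5) by auto
        then have "k \<otimes>\<^bsub>R\<^esub> v \<oplus>\<^bsub>R\<^esub> x \<in> ?L" "y = \<phi> (k \<otimes>\<^bsub>R\<^esub> v \<oplus>\<^bsub>R\<^esub> x)"
          using * by (auto simp: R.line_extension_mem_iff)
        then show "y \<in> \<phi> ` ?L" by blast
      next
        fix y assume "y \<in> \<phi> ` ?L"
        then obtain k x where "k \<in> K" "x \<in> E" "y = \<phi> (k \<otimes>\<^bsub>R\<^esub> v \<oplus>\<^bsub>R\<^esub> x)"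
          by (auto simp: R.line_extension_mem_iff)
        then have "y = \<sigma> k \<otimes>\<^bsub>S\<^esub> \<phi> v \<oplus>\<^bsub>S\<^esub> \<phi> x" "\<sigma> k \<in> L" "\<phi> x \<in> \<phi> ` E"
          using * Suc_dim.prems(5) by auto
        then show "y \<in> S.line_extension L (\<phi> v) (\<phi> ` E)"
          unfolding S.line_extension_mem_iff by blast
      qed
    qed
    ultimately show ?case by simp
  qed
qed

text \<open>The rank formula for the map from \<open>W\<close> to the quotient by \<open>U\<close>,
  stated without the quotient: the kernel is the set of \<open>x\<close> in \<open>W\<close> with
  \<open>\<phi> x\<close> in \<open>U\<close>. It is used for multiplication by a ring element and
  for an inclusion in the growth estimates, and for the Toeplitz map in the count of dimensions of a
  cokernel.\<close>

lemma (in ring) dimension_add_image: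
  assumes K: "subfield K R" and U: "dimension u K U" and W: "dimension w K W"
    and W0: "dimension m K {x \<in> W. \<phi> x \<in> U}"
    and phi: "\<And>x. x \<in> W \<Longrightarrow> \<phi> x \<in> carrier R"
      "\<And>x y. x \<in> W \<Longrightarrow> y \<in> W \<Longrightarrow> \<phi> (x \<oplus> y) = \<phi> x \<oplus> \<phi> y"
      "\<And>k x. k \<in> K \<Longrightarrow> x \<in> W \<Longrightarrow> \<phi> (k \<otimes> x) = k \<otimes> \<phi> x"
  shows "dimension (u + w - m) K (U <+>\<^bsub>R\<^esub> \<phi> ` W)" "m \<le> w"
proof -
  note sU = subalgebraD[OF dimension_subalgebra[OF K U]]
  note sW = subalgebraD[OF dimension_subalgebra[OF K W]]
  obtain Bs where Bs: "set Bs \<subseteq> carrier R" "independent K Bs" "length Bs = m"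
      "Span K Bs = {x \<in> W. \<phi> x \<in> U}"
    using exists_base[OF K W0] by blast
  have "set Bs \<subseteq> W"
    using Span_base_incl[OF K Bs(1)] Bs(4) by auto
  \<comment> \<open>The basis \<open>Bs\<close> of the kernel is completed to a basis of
    \<open>W\<close>; each added vector will raise the dimension of the sum by exactly one.\<close>
  then obtain Vs where Vs: "length (Vs @ Bs) = w" "independent K (Vs @ Bs)" "Span K (Vs @ Bs) = W"
    using complete_base[OF K W Bs(2)] by blast
  have "dimension (u + length Us) K (U <+>\<^bsub>R\<^esub> \<phi> ` Span K (Us @ Bs))"
    if "independent K (Us @ Bs)" "Span K (Us @ Bs) \<subseteq> W" for Us
    using that
  proof (induction Us)
    case Nil
    have "\<zero> \<in> Span K Bs" using subalgebraD(2)[OF Span_is_subalgebra[OF K Bs(1)]] .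
    have z: "\<phi> \<zero> = \<zero>"
      using phi(2)[of \<zero> \<zero>] phi(1)[of \<zero>] sW(2) by (simp add: add.r_cancel_one')
    have "U <+>\<^bsub>R\<^esub> \<phi> ` {x \<in> W. \<phi> x \<in> U} = U"
    proof -
      have "y = y \<oplus> \<phi> \<zero>" if "y \<in> U" for y using z that sU(1) by auto
      moreover have "\<zero> \<in> W" "\<phi> \<zero> \<in> U" using sW(2) z sU(2) by auto
      ultimately show ?thesis
        unfolding set_eq_iff set_add_iff using sU(3) by (metis (mono_tags, lifting) image_iff mem_Collect_eq)
    qed
    then show ?case using U Bs(4) by simp
  next
    case (Cons a Us)
    let ?S = "Span K (Us @ Bs)"
    have ind: "independent K (Us @ Bs)" "a \<in> carrier R" "a \<notin> ?S"
      using independent_backwards[OF Cons.prems(1)[unfolded append_Cons]] by (simp_all del: Span.simps)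
    have car: "set (Us @ Bs) \<subseteq> carrier R"
      using independent_in_carrier[OF ind(1)] .
    have le: "line_extension K a ?S \<subseteq> W" using Cons.prems(2) by simp
    have mono: "?S \<subseteq> line_extension K a ?S"
      using mono_Span[OF K car ind(2)] by simp
    have S: "subalgebra K ?S R" using Span_is_subalgebra[OF K car] .
    note sS = subalgebraD[OF S]
    have IH: "dimension (u + length Us) K (U <+>\<^bsub>R\<^esub> \<phi> ` ?S)"
      using Cons.IH ind(1) le mono by auto
    have aW: "a \<in> W"
      using le Span_base_incl[OF K, of "a # Us @ Bs"] car ind(2) by auto
    have SW: "?S \<subseteq> W" using le mono by blast
    have Kc: "K \<subseteq> carrier R" using K by (simp add: subfieldE(3))
    \<comment> \<open>Otherwise \<open>a\<close> would differ from some \<open>s\<close> in the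
      current span by an element of the kernel, whose basis \<open>Bs\<close> is already part of
      that span.\<close>
    have "\<phi> a \<notin> U <+>\<^bsub>R\<^esub> \<phi> ` ?S"
    proof
      assume "\<phi> a \<in> U <+>\<^bsub>R\<^esub> \<phi> ` ?S"
      then obtain y s where y: "y \<in> U" "s \<in> ?S" "\<phi> a = y \<oplus> \<phi> s"
        by (auto simp: set_add_iff)
      have ms: "\<ominus> s \<in> ?S" using sS(4) y(2) .
      have c: "\<phi> s \<in> carrier R" "\<phi> (\<ominus> s) \<in> carrier R" "y \<in> carrier R" "s \<in> carrier R"
        using phi(1) SW y ms sU(1) sW(1) by auto
      have "\<phi> (s \<oplus> \<ominus> s) = \<phi> s \<oplus> \<phi> (\<ominus> s)"
        using phi(2) SW y(2) ms by blast
      moreover have "\<phi> \<zero> = \<zero>"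
        using phi(2)[of \<zero> \<zero>] phi(1)[of \<zero>] sW(2) by (simp add: add.r_cancel_one')
      ultimately have 0: "\<phi> s \<oplus> \<phi> (\<ominus> s) = \<zero>" using c by (simp add: r_neg)
      have "\<phi> (a \<oplus> \<ominus> s) = \<phi> a \<oplus> \<phi> (\<ominus> s)"
        using phi(2) SW aW ms by blast
      also have "\<dots> = y" using y(3) c 0 by (simp add: a_assoc)
      finally have "a \<oplus> \<ominus> s \<in> Span K Bs"
        unfolding Bs(4) using y(1) sW(3) aW ms SW by auto
      then have "a \<oplus> \<ominus> s \<in> ?S"
        using mono_Span_sublist[OF K, of Bs "Us @ Bs"] car by auto
      then have "(a \<oplus> \<ominus> s) \<oplus> s \<in> ?S" using sS(3) y(2) by blast
      then show False using ind c by (simp add: a_assoc l_neg)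
    qed
    moreover have "\<phi> a \<in> carrier R" using phi(1) aW .
    ultimately have "dimension (Suc (u + length Us)) K (line_extension K (\<phi> a) (U <+>\<^bsub>R\<^esub> \<phi> ` ?S))"
      using IH Suc_dim by blast
    moreover have "line_extension K (\<phi> a) (U <+>\<^bsub>R\<^esub> \<phi> ` ?S) = U <+>\<^bsub>R\<^esub> \<phi> ` line_extension K a ?S"
    proof -
      have *: "\<phi> (k \<otimes> a \<oplus> s) = k \<otimes> \<phi> a \<oplus> \<phi> s" if "k \<in> K" "s \<in> ?S" for k s
        using phi(2)[of "k \<otimes> a" s] phi(3)[of k a] that aW sW(5) SW by auto
      have **: "k \<otimes> \<phi> a \<oplus> (y \<oplus> \<phi> s) = y \<oplus> (k \<otimes> \<phi> a \<oplus> \<phi> s)" if "k \<in> K" "s \<in> ?S" "y \<in> U" for k s y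
        using that phi(1) aW SW sU(1) Kc by (intro a_lcomm) auto
      show ?thesis
      proof (intro equalityI subsetI)
        fix x assume "x \<in> line_extension K (\<phi> a) (U <+>\<^bsub>R\<^esub> \<phi> ` ?S)"
        then obtain k y s where "k \<in> K" "y \<in> U" "s \<in> ?S" "x = k \<otimes> \<phi> a \<oplus> (y \<oplus> \<phi> s)"
          unfolding line_extension_mem_iff Bex_def set_add_iff by blast
        then have "x = y \<oplus> \<phi> (k \<otimes> a \<oplus> s)" "y \<in> U" "k \<otimes> a \<oplus> s \<in> line_extension K a ?S"
          using * ** by (auto simp: line_extension_mem_iff)
        then show "x \<in> U <+>\<^bsub>R\<^esub> \<phi> ` line_extension K a ?S"
          unfolding set_add_iff by blast
      next
        fix x assume "x \<in> U <+>\<^bsub>R\<^esub> \<phi> ` line_extension K a ?S"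
        then obtain k y s where "k \<in> K" "y \<in> U" "s \<in> ?S" "x = y \<oplus> \<phi> (k \<otimes> a \<oplus> s)"
          unfolding set_add_iff by (auto simp: line_extension_mem_iff)
        then show "x \<in> line_extension K (\<phi> a) (U <+>\<^bsub>R\<^esub> \<phi> ` ?S)"
          unfolding line_extension_mem_iff Bex_def set_add_iff using * ** by (metis imageI)
      qed
    qed
    ultimately show ?case by simp
  qed
  from this[of Vs] Vs Bs(3) show "dimension (u + w - m) K (U <+>\<^bsub>R\<^esub> \<phi> ` W)" "m \<le> w"
    by auto
qed

section \<open>The Veronese section of a rational series\<close>

text \<open>Every exponent up to \<open>d * (r - 1)\<close> is a sum of \<open>d\<close> exponents
  below \<open>r\<close>, so at least one product of monomials contributes, and nothing
  cancels.\<close>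

lemma coeff_geometric_power:
  fixes r d k :: nat
  assumes "r \<ge> 1"
  shows "coeff ((\<Sum>i<r. monom 1 i) ^ d :: rat poly) k \<ge> 0 \<and>
    (k \<le> d * (r - 1) \<longrightarrow> coeff ((\<Sum>i<r. monom 1 i) ^ d :: rat poly) k \<ge> 1)"
proof (induction d arbitrary: k)
  case 0
  then show ?case by (simp add: coeff_1)
next
  case (Suc d)
  let ?q = "(\<Sum>i<r. monom 1 i) :: rat poly"
  have q: "coeff ?q i = (if i < r then 1 else 0)" for i
    by (simp add: coeff_sum)
  have eq: "coeff (?q ^ Suc d) k = (\<Sum>i\<le>k. (if i < r then 1 else 0) * coeff (?q ^ d) (k - i))"
    unfolding power_Suc coeff_mult q by simp
  have nonneg: "(if i < r then 1 else 0) * coeff (?q ^ d) (k - i) \<ge> 0" for i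
    using Suc.IH[of "k - i"] by simp
  have "coeff (?q ^ Suc d) k \<ge> 1" if "k \<le> Suc d * (r - 1)"
  proof -
    \<comment> \<open>The new factor takes as much of the exponent as it can hold, so that the
      remainder is at most \<open>d * (r - 1)\<close>.\<close>
    define i where "i = min k (r - 1)"
    have i: "i \<le> k" "i < r" "k - i \<le> d * (r - 1)"
      using assms that by (auto simp: i_def min_def)
    have "1 \<le> (if i < r then 1 else 0) * coeff (?q ^ d) (k - i)"
      using Suc.IH[of "k - i"] i by simp
    also have "\<dots> \<le> coeff (?q ^ Suc d) k"
      unfolding eq by (rule member_le_sum) (use i nonneg in auto)
    finally show ?thesis .
  qed
  then show ?case unfolding eq using nonneg by (auto intro!: sum_nonneg)
qed

text \<open>Taking every r-th coefficient is linear over the series in \<open>fps_X ^ r\<close> and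
  turns \<open>fps_X ^ r\<close> into \<open>fps_X\<close>; one factor at a time suffices.\<close>

lemma fps_section_mult:
  fixes a :: "'a::comm_ring_1 fps"
  assumes "r \<ge> 1"
  shows "Abs_fps (\<lambda>n. (a * (1 - fps_X ^ r) ^ d) $ (n * r)) = Abs_fps (\<lambda>n. a $ (n * r)) * (1 - fps_X) ^ d"
proof (induction d arbitrary: a)
  case (Suc d)
  have "Abs_fps (\<lambda>n. (a * (1 - fps_X ^ r)) $ (n * r)) = Abs_fps (\<lambda>n. a $ (n * r)) * (1 - fps_X)"
  proof (rule fps_ext)
    fix n show "Abs_fps (\<lambda>n. (a * (1 - fps_X ^ r)) $ (n * r)) $ n = (Abs_fps (\<lambda>n. a $ (n * r)) * (1 - fps_X)) $ n"
    proof (cases n)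
      case 0
      then show ?thesis using assms by (simp add: algebra_simps fps_X_power_mult_right_nth)
    next
      case (Suc m)
      then show ?thesis using assms
        by (simp add: right_diff_distrib fps_X_power_mult_right_nth)
    qed
  qed
  then show ?case
    using Suc.IH[of "a * (1 - fps_X ^ r)"] by (simp add: mult.assoc)
qed simp

text \<open>Since 1 - X^r is 1 - X times the geometric sum, the fraction can be given a denominator
  that the passage to every r-th coefficient respects. Only the numerator \<open>g\<close> is then
  thinned out.\<close>

lemma fps_section_rational:
  fixes f :: "rat poly" and d r :: nat
  assumes "r \<ge> 1"
  defines "g \<equiv> f * (\<Sum>i<r. monom 1 i) ^ d"
  obtains p where "degree p \<le> degree g div r" "\<And>i. coeff p i = coeff g (r * i)"
    "Abs_fps (\<lambda>n. (fps_of_poly f / (1 - fps_X) ^ d) $ (n * r)) = fps_of_poly p / (1 - fps_X) ^ d"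
proof -
  define p where "p = (\<Sum>i\<le>degree g div r. monom (coeff g (r * i)) i)"
  have p: "coeff p i = coeff g (r * i)" for i
  proof (cases "i \<le> degree g div r")
    case False
    then have "degree g < r * i"
      using assms(1) by (metis dual_order.strict_trans2 div_le_mono div_mult_self1_is_m linorder_not_le zero_less_one)
    then show ?thesis using False by (simp add: p_def coeff_sum coeff_eq_0)
  qed (simp add: p_def coeff_sum)
  have deg: "degree p \<le> degree g div r"
    unfolding p_def by (intro degree_sum_le) (auto intro: order.trans[OF degree_monom_le])
  let ?F = "fps_of_poly f / (1 - fps_X) ^ d" and ?q = "(\<Sum>i<r. fps_X ^ i) :: rat fps"
  have inv: "((1 - fps_X) ^ d :: rat fps) $ 0 \<noteq> 0" by (simp add: fps_nth_power_0)
  have u: "(1 - fps_X) ^ d dvd (x :: rat fps)" for x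
    using inv by (meson fps_is_unit_iff unit_imp_dvd)
  have "?F * (1 - fps_X ^ r) ^ d = ?F * (1 - fps_X) ^ d * ?q ^ d"
    using one_diff_power_eq[of "fps_X :: rat fps" r] by (simp add: power_mult_distrib mult.assoc)
  also have "?F * (1 - fps_X) ^ d = fps_of_poly f" using u by simp
  also have "fps_of_poly f * ?q ^ d = fps_of_poly g"
    by (simp add: g_def fps_of_poly_mult fps_of_poly_power fps_of_poly_sum fps_of_poly_monom')
  finally have "Abs_fps (\<lambda>n. fps_of_poly g $ (n * r)) = Abs_fps (\<lambda>n. ?F $ (n * r)) * (1 - fps_X) ^ d"
    using fps_section_mult[OF assms(1), of ?F d] by simp
  moreover have "Abs_fps (\<lambda>n. fps_of_poly g $ (n * r)) = fps_of_poly p"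
    by (rule fps_ext) (simp add: p mult.commute)
  ultimately have "fps_of_poly p = Abs_fps (\<lambda>n. ?F $ (n * r)) * (1 - fps_X) ^ d" by simp
  then have "Abs_fps (\<lambda>n. ?F $ (n * r)) = fps_of_poly p / (1 - fps_X) ^ d"
    by simp
  then show ?thesis using that[OF deg p] by blast
qed

lemma veronese_numerator:
  fixes h :: "rat poly" and d s r :: nat
  assumes "degree h \<le> s" "\<And>i. coeff h i \<ge> 0" "coeff h 0 = 1" "r \<ge> 1"
  obtains p where "degree p \<le> max s d"
    "Abs_fps (\<lambda>n. (fps_of_poly h / (1 - fps_X) ^ d) $ (n * r)) = fps_of_poly p / (1 - fps_X) ^ d"
    "\<forall>i\<le>d. coeff p i \<ge> coeff h i" "r \<ge> d \<longrightarrow> (\<forall>i\<in>{1..<d}. coeff p i > coeff h i)"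
proof -
  define q :: "rat poly" where "q = (\<Sum>i<r. monom 1 i) ^ d"
  define g :: "rat poly" where "g = h * q"
  have q0: "coeff q k \<ge> (0::rat)" for k
    using coeff_geometric_power[OF assms(4)] unfolding q_def by blast
  have qd: "degree q \<le> d * (r - 1)"
  proof -
    have "degree ((\<Sum>i<r. monom 1 i) :: rat poly) \<le> r - 1"
      by (intro degree_sum_le) (auto intro: order.trans[OF degree_monom_le])
    then show ?thesis
      unfolding q_def using order.trans[OF degree_power_le] by (metis mult.commute mult_le_mono2)
  qed
  obtain p where p: "degree p \<le> degree g div r" "\<And>i. coeff p i = coeff g (r * i)"
    "Abs_fps (\<lambda>n. (fps_of_poly h / (1 - fps_X) ^ d) $ (n * r)) = fps_of_poly p / (1 - fps_X) ^ d"
    using fps_section_rational[OF assms(4), of h d] unfolding g_def q_def by blast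
  have "degree p \<le> max s d"
  proof -
    \<comment> \<open>This bound is at most r times the maximum of s and d, and thinning out divides
      the degree by r.\<close>
    have "degree g \<le> s + d * (r - 1)"
      using degree_mult_le[of h q] qd assms(1) unfolding g_def by linarith
    also have "\<dots> \<le> max s d + max s d * (r - 1)" by (intro add_mono mult_right_mono) auto
    also have "\<dots> = max s d * r" using assms(4) by (cases r) (auto simp: algebra_simps)
    finally have "degree g div r \<le> max s d * r div r" by (rule div_le_mono)
    then show ?thesis using p(1) assms(4) by simp
  qed
  \<comment> \<open>All products are nonnegative, so keeping only the indices in \<open>J\<close>
    gives a lower bound; \<open>{i}\<close> and \<open>{0, i}\<close> are the selections used
    below.\<close>
  have ge: "coeff p i \<ge> (\<Sum>j\<in>J. coeff h j * coeff q (r * i - j))" if "J \<subseteq> {..r * i}" for i J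
    unfolding p(2) g_def coeff_mult
    by (rule sum_mono2) (use that assms(2) q0 in auto)
  have pos: "coeff q k \<ge> 1" if "k \<le> d * (r - 1)" for k
    using coeff_geometric_power[OF assms(4)] that unfolding q_def by blast
  have ri: "r * i - i = (r - 1) * i" for i by (cases r) auto
  have 1: "\<forall>i\<le>d. coeff p i \<ge> coeff h i"
  proof (intro allI impI)
    fix i assume "i \<le> d"
    have "coeff h i * 1 \<le> coeff h i * coeff q (r * i - i)"
      by (intro mult_left_mono pos assms(2)) (use \<open>i \<le> d\<close> ri in \<open>simp add: mult.commute mult_le_mono\<close>)
    also have "\<dots> \<le> coeff p i" using ge[of "{i}" i] assms(4) by simp
    finally show "coeff h i \<le> coeff p i" by simp
  qed
  have 2: "coeff p i > coeff h i" if "r \<ge> d" "i \<in> {1..<d}" for i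
  proof -
    have "coeff h i * 1 \<le> coeff h i * coeff q (r * i - i)"
      by (intro mult_left_mono pos assms(2)) (use that ri in \<open>simp add: mult.commute mult_le_mono\<close>)
    \<comment> \<open>For the summand with index 0, r i must not exceed d (r - 1); equivalently, d
      is at most r (d - i). This is where \<open>r \<ge> d\<close> and \<open>i < d\<close>
      enter.\<close>
    moreover have "1 \<le> coeff q (r * i)"
    proof (rule pos)
      define e where "e = d - i"
      have e: "d = i + e" "e \<ge> 1" using that by (auto simp: e_def)
      have "r \<le> r * e" using e(2) by (cases e) auto
      then have "r * i + d \<le> r * i + r * e" using that(1) by linarith
      also have "\<dots> = d * r" using e by (simp add: algebra_simps)
      finally show "r * i \<le> d * (r - 1)" by (simp add: diff_mult_distrib2)
    qed
    moreover have "coeff h 0 * coeff q (r * i - 0) + coeff h i * coeff q (r * i - i) \<le> coeff p i"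
      using ge[of "{0, i}" i] assms(4) that by simp
    ultimately show ?thesis using assms(3) by simp
  qed
  show ?thesis using that[OF \<open>degree p \<le> max s d\<close> p(3) 1] 2 by blast
qed

section \<open>Homogeneous components\<close>

lemma (in ring) subalgebra_finsum:
  assumes "subalgebra K V R" "finite N" "\<And>n. n \<in> N \<Longrightarrow> f n \<in> V"
  shows "finsum R f N \<in> V"
  using assms(2,3)
proof (induction N)
  case empty
  then show ?case using subalgebraD(2)[OF assms(1)] by simp
next
  case (insert n N)
  then have "f n \<in> V" "finsum R f N \<in> V" "f \<in> N \<rightarrow> carrier R" "f n \<in> carrier R"
    using subalgebraD(1)[OF assms(1)] by auto
  then show ?case using insert(1,2) subalgebraD(3)[OF assms(1)] by simp
qed

context graded_algebra
begin

lemma K_subfield: "subfield K A" by (rule K.subfield_axioms)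

lemma K_carrier: "K \<subseteq> carrier A"
  using K_subfield by (simp add: subfieldE(3))

lemmas gr_D = subalgebraD[OF gr_subspace]

lemma gr_carrier: "x \<in> gr n \<Longrightarrow> x \<in> carrier A"
  using gr_D(1) by blast

definition components :: "'a \<Rightarrow> nat \<Rightarrow> 'a" where
  "components x = (THE f. (\<forall>n. f n \<in> gr n) \<and> finite {n. f n \<noteq> \<zero>} \<and> x = (\<Oplus>n\<in>{n. f n \<noteq> \<zero>}. f n))"

definition proj :: "nat \<Rightarrow> 'a \<Rightarrow> 'a" where
  "proj n x = components x n"

lemma
  assumes "x \<in> carrier A"
  shows proj_gr: "proj n x \<in> gr n"
    and finite_proj: "finite {n. proj n x \<noteq> \<zero>}"
    and sum_proj: "(\<Oplus>n\<in>{n. proj n x \<noteq> \<zero>}. proj n x) = x"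
  using theI'[OF gr_decomp[OF assms]] unfolding proj_def components_def by auto

lemma proj_carrier: "x \<in> carrier A \<Longrightarrow> proj n x \<in> carrier A"
  using proj_gr gr_carrier by blast

lemma finsum_support:
  assumes "finite N" "\<And>n. f n \<in> carrier A" "\<And>n. n \<notin> N \<Longrightarrow> f n = \<zero>"
  shows "(\<Oplus>n\<in>{n. f n \<noteq> \<zero>}. f n) = (\<Oplus>n\<in>N. f n)"
  using assms by (intro add.finprod_mono_neutral_cong_left) auto

text \<open>The working form of uniqueness: \<open>f\<close> may vanish at some indices in
  \<open>N\<close>, so a decomposition can be indexed by any convenient finite set.\<close>

lemma proj_eqI:
  assumes "finite N" "\<And>n. f n \<in> gr n" "\<And>n. n \<notin> N \<Longrightarrow> f n = \<zero>" "x = (\<Oplus>n\<in>N. f n)"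
  shows "proj n x = f n"
proof -
  have f: "\<And>n. f n \<in> carrier A" using assms(2) gr_carrier by blast
  have x: "x \<in> carrier A" unfolding assms(4) using f by auto
  have "finite {n. f n \<noteq> \<zero>}"
    by (rule finite_subset[OF _ assms(1)]) (use assms(3) in blast)
  moreover have "x = (\<Oplus>n\<in>{n. f n \<noteq> \<zero>}. f n)"
    using finsum_support[OF assms(1) f assms(3)] assms(4) by simp
  ultimately have "components x = f"
    using the1_equality[OF gr_decomp[OF x], of f] assms(2) unfolding components_def by blast
  then show ?thesis by (simp add: proj_def)
qed

lemma sum_proj_superset:
  assumes "x \<in> carrier A" "finite N" "\<And>n. n \<notin> N \<Longrightarrow> proj n x = \<zero>"
  shows "(\<Oplus>n\<in>N. proj n x) = x"
  using finsum_support[OF assms(2), of "\<lambda>n. proj n x"] proj_carrier assms sum_proj by simp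

lemma proj_of_gr:
  assumes "x \<in> gr m"
  shows "proj n x = (if n = m then x else \<zero>)"
  by (rule proj_eqI[of "{m}" "\<lambda>n. if n = m then x else \<zero>"])
     (use assms gr_D(2) gr_carrier in \<open>auto simp: add.finprod_singleton\<close>)

lemma proj_add:
  assumes "x \<in> carrier A" "y \<in> carrier A"
  shows "proj n (x \<oplus> y) = proj n x \<oplus> proj n y"
proof (rule proj_eqI)
  let ?N = "{n. proj n x \<noteq> \<zero>} \<union> {n. proj n y \<noteq> \<zero>}"
  show N: "finite ?N" using finite_proj assms by auto
  show "proj n x \<oplus> proj n y \<in> gr n" for n using proj_gr assms gr_D(3) by blast
  show "n \<notin> ?N \<Longrightarrow> proj n x \<oplus> proj n y = \<zero>" for n by simp
  have "(\<Oplus>n\<in>?N. proj n x \<oplus> proj n y) = (\<Oplus>n\<in>?N. proj n x) \<oplus> (\<Oplus>n\<in>?N. proj n y)"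
    using proj_carrier assms by (intro finsum_addf) auto
  then show "x \<oplus> y = (\<Oplus>n\<in>?N. proj n x \<oplus> proj n y)"
    using sum_proj_superset[OF assms(1) N] sum_proj_superset[OF assms(2) N] by simp
qed

lemma proj_mult_gr:
  assumes "x \<in> gr m" "y \<in> carrier A"
  shows "proj n (x \<otimes> y) = (if n < m then \<zero> else x \<otimes> proj (n - m) y)"
proof (rule proj_eqI)
  have x: "x \<in> carrier A" using assms(1) gr_carrier by blast
  let ?N = "{n. proj n y \<noteq> \<zero>}"
  show "finite ((\<lambda>n. n + m) ` ?N)" using finite_proj[OF assms(2)] by simp
  show "(if n < m then \<zero> else x \<otimes> proj (n - m) y) \<in> gr n" for n
    using gr_mult[OF assms(1) proj_gr[OF assms(2), of "n - m"]] gr_D(2) by auto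
  show "(if n < m then \<zero> else x \<otimes> proj (n - m) y) = \<zero>" if "n \<notin> (\<lambda>n. n + m) ` ?N" for n
  proof (cases "n < m")
    case False
    then have "n = (n - m) + m" by simp
    then have "proj (n - m) y = \<zero>" using that by blast
    then show ?thesis using x by simp
  qed simp
  have "x \<otimes> y = x \<otimes> (\<Oplus>n\<in>?N. proj n y)" using sum_proj assms(2) by simp
  also have "\<dots> = (\<Oplus>n\<in>?N. x \<otimes> proj n y)"
    using finite_proj[OF assms(2)] x proj_carrier assms(2) by (intro finsum_rdistr) auto
  also have "\<dots> = (\<Oplus>n\<in>(\<lambda>n. n + m) ` ?N. if n < m then \<zero> else x \<otimes> proj (n - m) y)"
    using x proj_carrier assms(2) by (subst finsum_reindex) (auto simp: inj_on_def)
  finally show "x \<otimes> y = (\<Oplus>n\<in>(\<lambda>n. n + m) ` ?N. if n < m then \<zero> else x \<otimes> proj (n - m) y)" .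
qed

text \<open>\<open>above 1\<close> is the irrelevant ideal. The space \<open>below n\<close> defined
  next is a vector space complement of \<open>above n\<close>, which turns bounds on A modulo
  \<open>above n\<close> into bounds on a subspace of A.\<close>

definition above :: "nat \<Rightarrow> 'a set" where
  "above n = {x \<in> carrier A. \<forall>i<n. proj i x = \<zero>}"

definition below :: "nat \<Rightarrow> 'a set" where
  "below n = {x \<in> carrier A. \<forall>i\<ge>n. proj i x = \<zero>}"

lemma proj_zero: "proj n \<zero> = \<zero>"
  using proj_of_gr[OF gr_D(2)[of n], of n] by simp

lemma proj_minus:
  assumes "x \<in> carrier A"
  shows "proj n (\<ominus> x) = \<ominus> proj n x"
proof -
  have "proj n (x \<oplus> \<ominus> x) = proj n x \<oplus> proj n (\<ominus> x)"
    using assms by (intro proj_add) auto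
  then show ?thesis
    using assms proj_carrier proj_zero by (metis a_inv_closed minus_equality r_neg add.m_comm)
qed

lemma proj_a_minus:
  "x \<in> carrier A \<Longrightarrow> y \<in> carrier A \<Longrightarrow> proj n (x \<ominus> y) = proj n x \<ominus> proj n y"
  by (simp add: a_minus_def proj_add proj_minus)

lemma above_0: "above 0 = carrier A"
  by (simp add: above_def)

lemma above_antimono: "m \<le> n \<Longrightarrow> above n \<subseteq> above m"
  by (auto simp: above_def)

lemma below_mono: "m \<le> n \<Longrightarrow> below m \<subseteq> below n"
  by (auto simp: below_def)

end

section \<open>Filtrations by degree, truncation and generation\<close>

context standard_graded_algebra
begin

lemma proj_smult:
  assumes "k \<in> K" "x \<in> carrier A"
  shows "proj n (k \<otimes> x) = k \<otimes> proj n x"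
  using proj_mult_gr[of k 0 x n] assms gr_0 by simp

lemma above_subspace: "subalgebra K (above n) A"
  by (rule subalgebraI)
     (use K_carrier in \<open>auto simp: above_def proj_zero proj_add proj_minus proj_smult\<close>)

lemma below_subspace: "subalgebra K (below n) A"
  by (rule subalgebraI)
     (use K_carrier in \<open>auto simp: below_def proj_zero proj_add proj_minus proj_smult\<close>)

lemma gr_above: "x \<in> gr n \<Longrightarrow> x \<in> above n"
  using gr_carrier by (auto simp: above_def proj_of_gr)

lemma gr_below: "x \<in> gr n \<Longrightarrow> x \<in> below (Suc n)"
  using gr_carrier by (auto simp: below_def proj_of_gr)

lemma mult_above:
  assumes x: "x \<in> above m" and y: "y \<in> above n"
  shows "x \<otimes> y \<in> above (m + n)"
proof -
  have c: "x \<in> carrier A" "y \<in> carrier A" using assms by (auto simp: above_def)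
  let ?N = "{k. proj k x \<noteq> \<zero>}"
  have "x \<otimes> y = (\<Oplus>k\<in>?N. proj k x) \<otimes> y" using sum_proj c by simp
  also have "\<dots> = (\<Oplus>k\<in>?N. proj k x \<otimes> y)"
    using finite_proj c proj_carrier by (intro finsum_ldistr) auto
  also have "\<dots> \<in> above (m + n)"
  proof (intro subalgebra_finsum[OF above_subspace] finite_proj c)
    fix k assume "k \<in> ?N"
    then have k: "m \<le> k" by (rule_tac ccontr) (use x in \<open>auto simp: above_def\<close>)
    have "proj i (proj k x \<otimes> y) = \<zero>" if "i < m + n" for i
      using proj_mult_gr[OF proj_gr[OF c(1)] c(2), of i k] that k y proj_carrier[OF c(1)]
      by (auto simp: above_def)
    then show "proj k x \<otimes> y \<in> above (m + n)"
      using c proj_carrier by (simp add: above_def)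
  qed
  finally show ?thesis .
qed

text \<open>\<open>below (Suc m)\<close> consists of the elements of degree at most
  \<open>m\<close>, whence the shift by \<open>m\<close> and not by \<open>Suc m\<close>.\<close>

lemma mult_below:
  assumes x: "x \<in> below (Suc m)" and y: "y \<in> below n"
  shows "x \<otimes> y \<in> below (n + m)"
proof -
  have c: "x \<in> carrier A" "y \<in> carrier A" using assms by (auto simp: below_def)
  let ?N = "{k. proj k x \<noteq> \<zero>}"
  have "x \<otimes> y = (\<Oplus>k\<in>?N. proj k x) \<otimes> y" using sum_proj c by simp
  also have "\<dots> = (\<Oplus>k\<in>?N. proj k x \<otimes> y)"
    using finite_proj c proj_carrier by (intro finsum_ldistr) auto
  also have "\<dots> \<in> below (n + m)"
  proof (intro subalgebra_finsum[OF below_subspace] finite_proj c)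
    fix k assume "k \<in> ?N"
    then have k: "k \<le> m" by (rule_tac ccontr) (use x in \<open>auto simp: below_def not_le\<close>)
    have "proj i (proj k x \<otimes> y) = \<zero>" if "n + m \<le> i" for i
      using proj_mult_gr[OF proj_gr[OF c(1)] c(2), of i k] that k y proj_carrier[OF c(1)]
      by (auto simp: below_def)
    then show "proj k x \<otimes> y \<in> below (n + m)"
      using c proj_carrier by (simp add: below_def)
  qed
  finally show ?thesis .
qed

lemma above_ideal: "ideal (above n) A"
proof -
  note V = subalgebraD[OF above_subspace[of n]]
  have "x \<otimes> a \<in> above n" if "a \<in> above n" "x \<in> carrier A" for a x
    using mult_above[of x 0 a n] that by (simp add: above_0)
  moreover have "additive_subgroup (above n) A"
    using above_subspace unfolding subalgebra_def by (simp add: additive_subgroupI)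
  ultimately show ?thesis
    using V(1) m_comm by (intro idealI ring_axioms) (auto simp: additive_subgroup_def subset_iff)
qed

lemma in_below:
  assumes "x \<in> carrier A"
  obtains n where "x \<in> below (Suc n)"
proof -
  obtain n where "\<forall>i\<in>{n. proj n x \<noteq> \<zero>}. i \<le> n"
    using finite_proj[OF assms] by (meson finite_nat_set_iff_bounded_le)
  then have "x \<in> below (Suc n)" using assms by (force simp: below_def)
  then show ?thesis using that by blast
qed

definition trunc :: "nat \<Rightarrow> 'a \<Rightarrow> 'a" where
  "trunc n x = (\<Oplus>i\<in>{..<n}. proj i x)"

lemma proj_trunc:
  assumes "x \<in> carrier A"
  shows "proj i (trunc n x) = (if i < n then proj i x else \<zero>)"
proof (rule proj_eqI[of "{..<n}"])
  show "trunc n x = (\<Oplus>i\<in>{..<n}. if i < n then proj i x else \<zero>)"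
    unfolding trunc_def using proj_carrier assms by (intro add.finprod_cong') auto
qed (use assms proj_gr gr_D(2) in auto)

lemma trunc_carrier: "x \<in> carrier A \<Longrightarrow> trunc n x \<in> carrier A"
  unfolding trunc_def using proj_carrier by (intro finsum_closed) auto

lemma trunc_below: "x \<in> carrier A \<Longrightarrow> trunc n x \<in> below n"
  by (simp add: below_def proj_trunc trunc_carrier)

lemma trunc_eq:
  assumes "x \<in> below n"
  shows "trunc n x = x"
  unfolding trunc_def by (rule sum_proj_superset) (use assms in \<open>auto simp: below_def\<close>)

lemma minus_trunc_above: "x \<in> carrier A \<Longrightarrow> x \<ominus> trunc n x \<in> above n"
  using proj_a_minus[of x "trunc n x"] proj_carrier
  by (auto simp: above_def trunc_carrier proj_trunc r_right_minus_eq)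

lemma trunc_add:
  assumes "x \<in> carrier A" "y \<in> carrier A"
  shows "trunc n (x \<oplus> y) = trunc n x \<oplus> trunc n y"
  unfolding trunc_def using assms proj_carrier
  by (simp add: proj_add finsum_addf Pi_def)

lemma trunc_smult:
  assumes "k \<in> K" "x \<in> carrier A"
  shows "trunc n (k \<otimes> x) = k \<otimes> trunc n x"
proof -
  have "k \<in> carrier A" using assms K_carrier by blast
  then show ?thesis
    unfolding trunc_def using assms proj_carrier
    by (simp add: proj_smult finsum_rdistr Pi_def)
qed

lemma trunc_above:
  assumes "x \<in> above n"
  shows "trunc n x = \<zero>"
proof -
  have "trunc n x = (\<Oplus>i\<in>{..<n}. \<zero>)"
    unfolding trunc_def using assms by (intro add.finprod_cong') (auto simp: above_def)
  then show ?thesis by simp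
qed

text \<open>Truncation is a linear projection onto \<open>below n\<close> with kernel
  \<open>above n\<close>, so the truncations of \<open>Us\<close> span \<open>below n\<close> as
  soon as \<open>Us\<close> spans A modulo \<open>above n\<close>.\<close>

lemma dimension_below:
  assumes Us: "set Us \<subseteq> carrier A" and sum: "Span K Us <+>\<^bsub>A\<^esub> above n = carrier A"
  obtains m where "m \<le> length Us" "dimension m K (below n)"
proof -
  let ?Vs = "map (trunc n) Us"
  have Vs: "set ?Vs \<subseteq> carrier A" using Us trunc_carrier by auto
  note SV = subalgebraD[OF Span_is_subalgebra[OF K_subfield Vs]]
  have "Span K ?Vs = below n"
  proof
    show "Span K ?Vs \<subseteq> below n"
      using Us trunc_below by (intro subalgebra_Span_incl K_subfield below_subspace) auto
    have "subalgebra K {s \<in> carrier A. trunc n s \<in> Span K ?Vs} A"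
    proof (rule subalgebraI)
      show "\<zero> \<in> {s \<in> carrier A. trunc n s \<in> Span K ?Vs}"
        using SV(2) trunc_above[OF subalgebraD(2)[OF above_subspace]] by simp
      fix x assume x: "x \<in> {s \<in> carrier A. trunc n s \<in> Span K ?Vs}"
      have "trunc n (\<ominus> x) = \<ominus> trunc n x"
        using trunc_smult[of "\<ominus> \<one>" x n] x trunc_carrier[of x n] subringE(3,5)[OF subfieldE(1)[OF K_subfield]] by (simp add: l_minus)
      then show "\<ominus> x \<in> {s \<in> carrier A. trunc n s \<in> Span K ?Vs}"
        using x SV(4) by simp
    qed (use SV K_carrier in \<open>auto simp del: Span.simps simp: trunc_add trunc_smult\<close>)
    moreover have "set Us \<subseteq> {s \<in> carrier A. trunc n s \<in> Span K ?Vs}"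
      using Us Span_base_incl[OF K_subfield Vs] by auto
    ultimately have *: "Span K Us \<subseteq> {s \<in> carrier A. trunc n s \<in> Span K ?Vs}"
      by (intro subalgebra_Span_incl K_subfield)
    show "below n \<subseteq> Span K ?Vs"
    proof
      fix x assume x: "x \<in> below n"
      then have "x \<in> Span K Us <+>\<^bsub>A\<^esub> above n" using sum by (simp add: below_def)
      then obtain s g where sg: "s \<in> Span K Us" "g \<in> above n" "x = s \<oplus> g"
        unfolding set_add_iff by blast
      then have "s \<in> carrier A" "g \<in> carrier A" using * by (auto simp: above_def)
      then have "x = trunc n s"
        using sg x trunc_eq[OF x] trunc_above[OF sg(2)] by (simp add: trunc_add trunc_carrier)
      then show "x \<in> Span K ?Vs" using * sg(1) by blast
    qed
  qed
  then show ?thesis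
    using Span_dimension[OF K_subfield Vs] that by (metis length_map)
qed

text \<open>The ring elements that multiply \<open>Z\<close> into itself include the generators and
  are closed under the ring operations, hence they are all of A; applied to \<open>\<one>\<close>
  they fill \<open>Z\<close>.\<close>

lemma generation_induct:
  assumes "generate_ring A (K \<union> S) = carrier A"
    and Z: "subalgebra K Z A" "\<one> \<in> Z" and S: "S \<subseteq> carrier A" "\<And>y z. y \<in> S \<Longrightarrow> z \<in> Z \<Longrightarrow> y \<otimes> z \<in> Z"
  shows "Z = carrier A"
proof
  note V = subalgebraD[OF Z(1)]
  show "Z \<subseteq> carrier A" by (rule V(1))
  have "x \<in> carrier A \<and> (\<forall>z\<in>Z. x \<otimes> z \<in> Z)" if "x \<in> generate_ring A (K \<union> S)" for x
    using that
  proof (induction rule: generate_ring.induct)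
    case (incl h)
    then show ?case using V(5) S K_carrier by auto
  next
    case (a_inv h)
    then show ?case using V(1,4) by (metis a_inv_closed l_minus subsetD)
  next
    case (eng_add h1 h2)
    then show ?case using V(1,3) l_distr by (auto simp: subset_iff)
  next
    case (eng_mult h1 h2)
    then show ?case using V(1) m_assoc by (auto simp: subset_iff)
  qed (use V(1) in auto)
  then show "carrier A \<subseteq> Z" using Z(2) assms(1) by fastforce
qed

end

section \<open>Growth of an algebra modulo a sequence\<close>

text \<open>Each exponent is bounded by \<open>n\<close> separately, instead of the total degree.
  This makes the number of entries exactly a power of \<open>n\<close> and lets multiplication by a
  variable leave the list only through an n-th power.\<close>

fun (in ring) monomials :: "'a list \<Rightarrow> nat \<Rightarrow> 'a list" where
  "monomials [] n = [\<one>]"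
| "monomials (x # xs) n = concat (map (\<lambda>i. map (\<lambda>p. x [^] i \<otimes> p) (monomials xs n)) [0..<n])"

lemma (in ring) length_monomials: "length (monomials xs n) = n ^ length xs"
  by (induction xs) (auto simp: length_concat comp_def sum_list_triv)

lemma (in ring) monomials_carrier: "set xs \<subseteq> carrier R \<Longrightarrow> set (monomials xs n) \<subseteq> carrier R"
  by (induction xs) auto

lemma (in ring) one_in_monomials: "n \<ge> 1 \<Longrightarrow> set xs \<subseteq> carrier R \<Longrightarrow> \<one> \<in> set (monomials xs n)"
  by (induction xs) (auto intro!: bexI[of _ 0] image_eqI[of _ _ \<one>])

lemma (in cring) monomials_mult:
  assumes "set xs \<subseteq> carrier R" "x \<in> set xs" "p \<in> set (monomials xs n)"
  shows "x \<otimes> p \<in> set (monomials xs n) \<or> (\<exists>q\<in>carrier R. x \<otimes> p = x [^] n \<otimes> q)"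
  using assms
proof (induction xs arbitrary: p)
  case (Cons z xs)
  then obtain i q where iq: "i < n" "q \<in> set (monomials xs n)" "p = z [^] i \<otimes> q" by auto
  have c: "z \<in> carrier R" "q \<in> carrier R" "x \<in> carrier R"
    using iq Cons.prems monomials_carrier[of xs n] by auto
  show ?case
  proof (cases "x = z")
    case True
    have "x \<otimes> p = z [^] Suc i \<otimes> q"
      using True iq(3) c by (simp add: m_ac)
    moreover have "z [^] Suc i \<otimes> q \<in> set (monomials (z # xs) n)" if "Suc i < n"
      using that iq(2) by (auto intro!: bexI[of _ "Suc i"])
    ultimately show ?thesis using iq(1) True c by (cases "Suc i = n") auto
  next
    case False
    then have "x \<otimes> q \<in> set (monomials xs n) \<or> (\<exists>q'\<in>carrier R. x \<otimes> q = x [^] n \<otimes> q')"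
      using Cons iq by auto
    moreover have "x \<otimes> p = z [^] i \<otimes> (x \<otimes> q)" using iq(3) c by (simp add: m_ac)
    ultimately show ?thesis
    proof (elim disjE bexE)
      fix q' assume "q' \<in> carrier R" "x \<otimes> q = x [^] n \<otimes> q'"
      then have "x \<otimes> p = x [^] n \<otimes> (z [^] i \<otimes> q')" "z [^] i \<otimes> q' \<in> carrier R"
        using \<open>x \<otimes> p = _\<close> c by (simp_all add: m_ac)
      then show ?thesis by blast
    qed (use iq(1) in \<open>auto simp: \<open>x \<otimes> p = _\<close>\<close>)
  qed
qed simp

lemma (in cring) mult_Span_subset:
  assumes "subfield K R" "subalgebra K Z R" "set Us \<subseteq> carrier R" "x \<in> carrier R"
    and "\<And>u. u \<in> set Us \<Longrightarrow> x \<otimes> u \<in> Z" and "s \<in> Span K Us"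
  shows "x \<otimes> s \<in> Z"
proof -
  have Kc: "K \<subseteq> carrier R" using assms(1) by (simp add: subfieldE(3))
  note Z = subalgebraD[OF assms(2)]
  have "subalgebra K {s \<in> carrier R. x \<otimes> s \<in> Z} R"
  proof (rule subalgebraI)
    fix k s assume "k \<in> K" "s \<in> {s \<in> carrier R. x \<otimes> s \<in> Z}"
    moreover from this have "x \<otimes> (k \<otimes> s) = k \<otimes> (x \<otimes> s)"
      using Kc assms(4) by (auto intro!: m_lcomm)
    ultimately show "k \<otimes> s \<in> {s \<in> carrier R. x \<otimes> s \<in> Z}"
      using Z(5) Kc by auto
  qed (use Z(2-4) assms(4) in \<open>auto simp: r_distr r_minus\<close>)
  from subalgebra_Span_incl[OF assms(1) this, of Us] show ?thesis
    using assms(3,5,6) by blast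
qed

text \<open>\<open>W\<close> is only a subspace. The intersection \<open>G\<close> of all subspaces
  that contain the multiples of \<open>S\<close> is nevertheless closed under multiplication by any
  \<open>r\<close>: for each such subspace, the elements that \<open>r\<close> multiplies into it
  form another one of the same kind. So \<open>G\<close> is an ideal, and it lies inside
  \<open>W\<close>.\<close>

lemma (in cring) Idl_subset_subspace:
  assumes K: "K \<subseteq> carrier R" and W: "subalgebra K W R" "S \<subseteq> carrier R"
    and S: "\<And>x a. x \<in> S \<Longrightarrow> a \<in> carrier R \<Longrightarrow> x \<otimes> a \<in> W"
  shows "Idl S \<subseteq> W"
proof -
  define P where "P W \<longleftrightarrow> subalgebra K W R \<and> (\<forall>x\<in>S. \<forall>a\<in>carrier R. x \<otimes> a \<in> W)" for W
  define G where "G = {e \<in> carrier R. \<forall>W. P W \<longrightarrow> e \<in> W}"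
  have G1: "a \<oplus> b \<in> G" "\<ominus> a \<in> G" if "a \<in> G" "b \<in> G" for a b
    using that subalgebraD(3,4) unfolding G_def P_def by auto
  have G0: "\<zero> \<in> G" using subalgebraD(2) unfolding G_def P_def by auto
  have G2: "r \<otimes> e \<in> G" if "e \<in> G" "r \<in> carrier R" for e r
  proof -
    have "r \<otimes> e \<in> W" if "P W" for W
    proof -
      have "subalgebra K W R" using that by (simp add: P_def)
      note W = subalgebraD[OF this]
      have "subalgebra K {e \<in> carrier R. r \<otimes> e \<in> W} R"
      proof (rule subalgebraI)
        fix k s assume "k \<in> K" "s \<in> {s \<in> carrier R. r \<otimes> s \<in> W}"
        moreover from this have "r \<otimes> (k \<otimes> s) = k \<otimes> (r \<otimes> s)"
          using K \<open>r \<in> carrier R\<close> by (auto intro!: m_lcomm)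
        ultimately show "k \<otimes> s \<in> {s \<in> carrier R. r \<otimes> s \<in> W}"
          using W(5) K by auto
      qed (use W(2-4) \<open>r \<in> carrier R\<close> in \<open>auto simp: r_distr r_minus\<close>)
      moreover have "r \<otimes> (x \<otimes> a) \<in> W" if "x \<in> S" "a \<in> carrier R" for x a
      proof -
        have "r \<otimes> (x \<otimes> a) = x \<otimes> (r \<otimes> a)"
          using that \<open>r \<in> carrier R\<close> assms(3) by (auto intro!: m_lcomm)
        then show ?thesis using \<open>P W\<close> that \<open>r \<in> carrier R\<close> unfolding P_def by auto
      qed
      ultimately have "P {e \<in> carrier R. r \<otimes> e \<in> W}"
        using assms(3) unfolding P_def by auto
      then show ?thesis using \<open>e \<in> G\<close> unfolding G_def by blast
    qed
    then show ?thesis using that unfolding G_def by auto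
  qed
  have "ideal G R"
  proof (rule idealI[OF ring_axioms])
    show "subgroup G (add_monoid R)"
      using G0 G1 by (intro add.subgroupI) (auto simp: G_def a_inv_def)
    show "x \<otimes> a \<in> G" "a \<otimes> x \<in> G" if "a \<in> G" "x \<in> carrier R" for a x
      using G2[OF that] that m_comm[of a x] by (auto simp: G_def)
  qed
  moreover have "S \<subseteq> G"
  proof
    fix x assume x: "x \<in> S"
    have "x \<in> W" if "P W" for W
      using that x assms(3) r_one[of x] one_closed unfolding P_def by (metis subsetD)
    then show "x \<in> G" using x assms(3) unfolding G_def by auto
  qed
  ultimately have "Idl S \<subseteq> G" by (rule genideal_minimal)
  also have "G \<subseteq> W" using W S unfolding G_def P_def by blast
  finally show ?thesis .
qed

section \<open>Generators of degree one and the irrelevant ideal\<close>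

locale graded_generators = standard_graded_algebra +
  fixes ys :: "'a list"
  assumes ys_gr: "set ys \<subseteq> gr 1" and ys_generate: "generate_ring A (K \<union> set ys) = carrier A"
begin

lemma ys_carrier: "set ys \<subseteq> carrier A"
  using ys_gr gr_carrier by blast

lemma ys_above: "set ys \<subseteq> above 1"
  using ys_gr gr_above by blast

lemma ideal_subspace: "ideal J A \<Longrightarrow> subalgebra K J A"
  using ideal_is_subalgebra[OF K_carrier] .

text \<open>By generation, A is the sum of \<open>K\<close> and the part of \<open>J\<close> in
  positive degree; an element without constant term has no share in \<open>K\<close>.\<close>

lemma irrelevant_subset:
  assumes "ideal J A" "set ys \<subseteq> J"
  shows "above 1 \<subseteq> J"
proof
  have J: "ideal (J \<inter> above 1) A"
    using i_intersect[OF assms(1) above_ideal] .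
  note sJ = subalgebraD[OF ideal_subspace[OF J]]
  have sK: "subalgebra K K A" using gr_subspace[of 0] gr_0 by simp
  have "K <+>\<^bsub>A\<^esub> (J \<inter> above 1) = carrier A"
  proof (rule generation_induct[OF ys_generate])
    show "subalgebra K (K <+>\<^bsub>A\<^esub> (J \<inter> above 1)) A"
      by (intro subalgebra_set_add sK ideal_subspace J K_carrier)
    have "\<one> \<in> K" using subringE(3)[OF subfieldE(1)[OF K_subfield]] .
    then show "\<one> \<in> K <+>\<^bsub>A\<^esub> (J \<inter> above 1)"
      unfolding set_add_iff using sJ(2) by (intro bexI[of _ \<one>] bexI[of _ \<zero>]) auto
    show "set ys \<subseteq> carrier A" by (rule ys_carrier)
    fix y z assume y: "y \<in> set ys" and "z \<in> K <+>\<^bsub>A\<^esub> (J \<inter> above 1)"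
    then have z: "z \<in> carrier A"
      using K_carrier sJ(1) by (auto simp: set_add_iff)
    have "y \<otimes> z \<in> J \<inter> above 1"
      using ideal.I_r_closed[OF J, of y z] y z assms(2) ys_above by blast
    moreover have "\<zero> \<in> K" using subringE(2)[OF subfieldE(1)[OF K_subfield]] .
    ultimately show "y \<otimes> z \<in> K <+>\<^bsub>A\<^esub> (J \<inter> above 1)"
      unfolding set_add_iff using sJ(1) by (intro bexI[of _ \<zero>] bexI[of _ "y \<otimes> z"]) auto
  qed
  fix x assume x: "x \<in> above 1"
  then have "x \<in> K <+>\<^bsub>A\<^esub> (J \<inter> above 1)"
    using \<open>_ = carrier A\<close> by (simp add: above_def)
  then obtain k j where kj: "k \<in> K" "j \<in> J \<inter> above 1" "x = k \<oplus> j"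
    unfolding set_add_iff by blast
  have c: "k \<in> carrier A" "j \<in> carrier A" using kj K_carrier sJ(1) by auto
  have "proj 0 x = k \<oplus> \<zero>"
    using kj c proj_add[of k j 0] proj_of_gr[of k 0 0] gr_0 by (simp add: above_def)
  then have "k = \<zero>" using x c by (simp add: above_def)
  then show "x \<in> J" using kj c by simp
qed

text \<open>An element outside \<open>above 1\<close> differs from a nonzero scalar by an element of
  \<open>above 1\<close>, so every properly larger ideal contains a unit.\<close>

lemma irrelevant_maximal: "maximalideal (above 1) A"
proof (rule maximalidealI[OF above_ideal])
  show "carrier A \<noteq> above 1"
  proof
    assume "carrier A = above 1"
    then have "\<one> \<in> above 1" by blast
    moreover have "\<one> \<in> gr 0" using subringE(3)[OF subfieldE(1)[OF K_subfield]] gr_0 by simp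
    ultimately have "\<one> = \<zero>" using proj_of_gr[of \<one> 0 0] by (simp add: above_def)
    then show False using subfieldE(5)[OF K_subfield] by simp
  qed
  fix J assume J: "ideal J A" "above 1 \<subseteq> J" "J \<subseteq> carrier A"
  show "J = above 1 \<or> J = carrier A"
  proof (cases "J = above 1")
    case False
    then obtain x where x: "x \<in> J" "x \<notin> above 1" using J(2) by blast
    then have xc: "x \<in> carrier A" using J(3) by blast
    let ?k = "proj 0 x"
    have k: "?k \<in> K" "?k \<noteq> \<zero>" using x xc proj_gr[of x 0] gr_0 by (auto simp: above_def)
    have kc: "?k \<in> carrier A" using k K_carrier by blast
    have "trunc 1 x = ?k" using kc by (simp add: trunc_def lessThan_Suc)
    then have "x \<ominus> ?k \<in> J" using minus_trunc_above[OF xc, of 1] J(2) by auto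
    then have "x \<ominus> (x \<ominus> ?k) \<in> J"
      using x(1) subalgebraD(6)[OF ideal_subspace[OF J(1)]] by blast
    then have kJ: "?k \<in> J" using xc kc by (simp add: a_minus_def minus_add r_neg2 a_assoc[symmetric] r_neg)
    obtain l where "l \<in> K" "?k \<otimes> l = \<one>"
      using subfield_m_inv(1,2)[OF K_subfield, of ?k] k by auto
    then have "\<one> \<in> J" using ideal.I_r_closed[OF J(1) kJ, of l] K_carrier by auto
    then show ?thesis using ideal.one_imp_carrier[OF J(1)] by blast
  qed simp
qed

text \<open>This takes the place of localization at the irrelevant ideal. The constant term gives an
  inverse modulo \<open>above 1\<close>; from there on, Newton iteration replaces \<open>v\<close>
  by \<open>v \<otimes> (\<one> \<ominus> e)\<close>, where
  \<open>e = u \<otimes> v \<ominus> \<one>\<close> is the error, and the new error is minus the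
  square of the old one.\<close>

lemma unit_modulo_above:
  assumes "u \<in> carrier A" "u \<notin> above 1"
  shows "\<exists>v\<in>carrier A. u \<otimes> v \<ominus> \<one> \<in> above n"
proof (induction n)
  case 0
  then show ?case using assms by (auto simp: above_0)
next
  case (Suc n)
  show ?case
  proof (cases "n = 0")
    case True
    let ?k = "proj 0 u"
    have k: "?k \<in> K" "?k \<noteq> \<zero>" using assms proj_gr[of u 0] gr_0 by (auto simp: above_def)
    obtain l where l: "l \<in> K" "l \<otimes> ?k = \<one>"
      using subfield_m_inv(1,3)[OF K_subfield, of ?k] k by auto
    have lc: "l \<in> carrier A" "l \<in> gr 0" using l K_carrier gr_0 by auto
    have "\<one> \<in> gr 0" using subringE(3)[OF subfieldE(1)[OF K_subfield]] gr_0 by simp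
    then have "proj 0 (u \<otimes> l \<ominus> \<one>) = l \<otimes> ?k \<ominus> \<one>"
      using assms lc proj_of_gr[of \<one> 0 0] proj_smult[of l u 0] l m_comm[of u l]
      by (simp add: proj_a_minus)
    then have "u \<otimes> l \<ominus> \<one> \<in> above 1"
      using l assms lc by (simp add: above_def a_minus_def r_neg)
    then show ?thesis using True lc by auto
  next
    case False
    obtain v where v: "v \<in> carrier A" "u \<otimes> v \<ominus> \<one> \<in> above n" using Suc by blast
    define e where "e = u \<otimes> v \<ominus> \<one>"
    have e: "e \<in> carrier A" "e \<in> above n" using v assms by (auto simp: e_def)
    have uv: "u \<otimes> v = \<one> \<oplus> e" using v(1) assms(1) unfolding e_def by algebra
    have "u \<otimes> (v \<otimes> (\<one> \<ominus> e)) \<ominus> \<one> = (\<one> \<oplus> e) \<otimes> (\<one> \<ominus> e) \<ominus> \<one>"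
      using assms v e uv by (simp add: m_assoc[symmetric])
    also have "\<dots> = \<ominus> (e \<otimes> e)"
      using e(1) by algebra
    also have "\<dots> \<in> above (Suc n)"
    proof -
      have "e \<otimes> e \<in> above (n + n)" using mult_above e(2) by blast
      then have "e \<otimes> e \<in> above (Suc n)" using above_antimono[of "Suc n" "n + n"] False by auto
      then show ?thesis using subalgebraD(4)[OF above_subspace] by blast
    qed
    finally show ?thesis using v e by (intro bexI[of _ "v \<otimes> (\<one> \<ominus> e)"]) auto
  qed
qed

lemma pow_above: "x \<in> above 1 \<Longrightarrow> x [^] n \<in> above n"
proof (induction n)
  case (Suc n)
  then show ?case using mult_above[of "x [^] n" n x 1] by simp
qed (simp add: above_0)

text \<open>Multiplying a monomial by a generator either stays within the list or produces a factor
  \<open>y [^] n\<close>, which lies in \<open>J\<close>.\<close>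

lemma Span_monomials_sum_ideal:
  assumes J: "ideal J A" and n: "n \<ge> 1" and pow: "\<And>y. y \<in> set ys \<Longrightarrow> y [^] n \<in> J"
  shows "Span K (monomials ys n) <+>\<^bsub>A\<^esub> J = carrier A"
proof (rule generation_induct[OF ys_generate])
  let ?M = "monomials ys n"
  have Mc: "set ?M \<subseteq> carrier A" using monomials_carrier ys_carrier by blast
  have sM: "subalgebra K (Span K ?M) A" using Span_is_subalgebra[OF K_subfield Mc] .
  show sZ: "subalgebra K (Span K ?M <+>\<^bsub>A\<^esub> J) A"
    by (intro subalgebra_set_add sM ideal_subspace J K_carrier)
  have SZ: "Span K ?M \<subseteq> Span K ?M <+>\<^bsub>A\<^esub> J" and JZ: "J \<subseteq> Span K ?M <+>\<^bsub>A\<^esub> J"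
    using subalgebraD(1,2)[OF sM] subalgebraD(1,2)[OF ideal_subspace[OF J]]
    unfolding subset_iff set_add_iff by (metis r_zero l_zero)+
  show "\<one> \<in> Span K ?M <+>\<^bsub>A\<^esub> J"
    using one_in_monomials[OF n ys_carrier] Span_base_incl[OF K_subfield Mc] SZ by blast
  show "set ys \<subseteq> carrier A" by (rule ys_carrier)
  fix y z assume y: "y \<in> set ys" and z: "z \<in> Span K ?M <+>\<^bsub>A\<^esub> J"
  have yc: "y \<in> carrier A" using y ys_carrier by blast
  obtain s j where sj: "s \<in> Span K ?M" "j \<in> J" "z = s \<oplus> j" using z unfolding set_add_iff by blast
  have c: "s \<in> carrier A" "j \<in> carrier A"
    using sj subalgebraD(1)[OF sM] subalgebraD(1)[OF ideal_subspace[OF J]] by auto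
  have "y \<otimes> p \<in> Span K ?M <+>\<^bsub>A\<^esub> J" if "p \<in> set ?M" for p
    using monomials_mult[OF ys_carrier y that]
  proof (elim disjE bexE)
    assume "y \<otimes> p \<in> set ?M"
    then show ?thesis using Span_base_incl[OF K_subfield Mc] SZ by blast
  next
    fix q assume "q \<in> carrier A" "y \<otimes> p = y [^] n \<otimes> q"
    then show ?thesis using ideal.I_r_closed[OF J pow[OF y]] JZ by auto
  qed
  then have "y \<otimes> s \<in> Span K ?M <+>\<^bsub>A\<^esub> J"
    using mult_Span_subset[OF K_subfield sZ Mc yc] sj(1) by blast
  moreover have "y \<otimes> j \<in> Span K ?M <+>\<^bsub>A\<^esub> J"
    using ideal.I_l_closed[OF J sj(2) yc] JZ by blast
  ultimately show "y \<otimes> z \<in> Span K ?M <+>\<^bsub>A\<^esub> J"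
    using sj(3) yc c subalgebraD(3)[OF sZ] by (simp add: r_distr)
qed

lemma finite_dimension_below: "\<exists>m. dimension m K (below n)"
proof -
  \<comment> \<open>The exponent is \<open>Suc n\<close> because the list of monomials needs a
    positive bound, also for \<open>n = 0\<close>.\<close>
  have "y [^] Suc n \<in> above n" if "y \<in> set ys" for y
    using pow_above[of y "Suc n"] that ys_above above_antimono[of n "Suc n"] by auto
  then have "Span K (monomials ys (Suc n)) <+>\<^bsub>A\<^esub> above n = carrier A"
    by (intro Span_monomials_sum_ideal above_ideal) auto
  then show ?thesis
    using dimension_below monomials_carrier[OF ys_carrier] by metis
qed

lemma finite_dimension_gr: "\<exists>m. dimension m K (gr n)"
proof -
  obtain m where "dimension m K (below (Suc n))" using finite_dimension_below by blast
  then show ?thesis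
    using dimension_subspace[OF K_subfield _ gr_subspace, of m "below (Suc n)" n] gr_below by blast
qed

text \<open>Modulo \<open>xs\<close> and \<open>above n\<close>, the algebra is spanned by finitely
  many monomials in \<open>ys\<close>, their number being independent of \<open>n\<close>.
  Multiplied by the monomials in \<open>xs\<close> with exponents below \<open>n\<close>, they span
  modulo \<open>above n\<close> alone, because the n-th power of an element of \<open>xs\<close>
  lies in \<open>above n\<close>.\<close>

lemma growth_bound:
  assumes xs: "set xs \<subseteq> above 1"
    and loc: "\<And>y. y \<in> set ys \<Longrightarrow> \<exists>u\<in>carrier A - above 1. \<exists>k::nat. u \<otimes> y [^] k \<in> Idl (set xs)"
  shows "\<exists>C. \<forall>n\<ge>1. \<exists>m\<le>C * n ^ length xs. dimension m K (below n)"
proof -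
  have xc: "set xs \<subseteq> carrier A" using xs by (auto simp: above_def)
  define J where "J = Idl (set xs)"
  have J: "ideal J A" unfolding J_def using genideal_ideal[OF xc] .
  have "\<exists>k\<ge>1::nat. \<forall>y\<in>set ys. \<exists>u\<in>carrier A - above 1. u \<otimes> y [^] k \<in> J"
  proof -
    have "\<forall>y\<in>set ys. \<exists>k::nat. \<exists>u\<in>carrier A - above 1. u \<otimes> y [^] k \<in> J" using loc J_def by blast
    then obtain k :: "'a \<Rightarrow> nat" where k: "\<And>y. y \<in> set ys \<Longrightarrow> \<exists>u\<in>carrier A - above 1. u \<otimes> y [^] k y \<in> J" by metis
    \<comment> \<open>One exponent that serves all generators; \<open>Suc\<close> keeps it
      positive.\<close>
    let ?k = "Suc (sum k (set ys))"
    have "\<exists>u\<in>carrier A - above 1. u \<otimes> y [^] ?k \<in> J" if y: "y \<in> set ys" for y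
    proof -
      obtain u where u: "u \<in> carrier A" "u \<notin> above 1" "u \<otimes> y [^] k y \<in> J" using k[OF y] by blast
      have yc: "y \<in> carrier A" using y ys_carrier by blast
      have "k y \<le> sum k (set ys)" using y by (intro member_le_sum) auto
      then have "?k = k y + (?k - k y)" by simp
      then have "y [^] ?k = y [^] k y \<otimes> y [^] (?k - k y)" using yc nat_pow_mult by metis
      then have "u \<otimes> y [^] ?k = (u \<otimes> y [^] k y) \<otimes> y [^] (?k - k y)" using yc u by (simp add: m_assoc)
      then have "u \<otimes> y [^] ?k \<in> J" using ideal.I_r_closed[OF J u(3)] yc by simp
      then show ?thesis using u by blast
    qed
    then show ?thesis by (intro exI[of _ ?k] conjI ballI) (simp, blast)
  qed
  then obtain k :: nat where k: "k \<ge> 1"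
    "\<And>y. y \<in> set ys \<Longrightarrow> \<exists>u\<in>carrier A - above 1. u \<otimes> y [^] k \<in> J" by blast
  let ?M = "monomials ys k"
  have Mc: "set ?M \<subseteq> carrier A" using monomials_carrier ys_carrier by blast
  have "\<exists>m\<le>k ^ length ys * n ^ length xs. dimension m K (below n)" if n: "n \<ge> 1" for n
  proof -
    have Jn: "ideal (J <+>\<^bsub>A\<^esub> above n) A" using add_ideals[OF J above_ideal] .
    have "y [^] k \<in> J <+>\<^bsub>A\<^esub> above n" if y: "y \<in> set ys" for y
    proof -
      obtain u where u: "u \<in> carrier A" "u \<notin> above 1" "u \<otimes> y [^] k \<in> J" using k(2)[OF y] by blast
      obtain v where v: "v \<in> carrier A" "u \<otimes> v \<ominus> \<one> \<in> above n" using unit_modulo_above u by blast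
      define z where "z = y [^] k"
      have zc: "z \<in> carrier A" using y ys_carrier by (auto simp: z_def)
      \<comment> \<open>As \<open>v\<close> inverts \<open>u\<close> modulo \<open>above n\<close>,
        membership of \<open>u \<otimes> z\<close> in \<open>J\<close> passes to \<open>z\<close>
        itself, up to \<open>above n\<close>.\<close>
      have "z = (u \<otimes> z) \<otimes> v \<oplus> \<ominus> ((u \<otimes> v \<ominus> \<one>) \<otimes> z)"
        using zc u(1) v(1) by algebra
      moreover have "(u \<otimes> z) \<otimes> v \<in> J" using ideal.I_r_closed[OF J u(3) v(1)] by (simp add: z_def)
      moreover have "\<ominus> ((u \<otimes> v \<ominus> \<one>) \<otimes> z) \<in> above n"
        using ideal.I_r_closed[OF above_ideal v(2) zc] subalgebraD(4)[OF above_subspace] by blast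
      ultimately show ?thesis unfolding set_add_iff z_def by blast
    qed
    then have sumJ: "Span K ?M <+>\<^bsub>A\<^esub> (J <+>\<^bsub>A\<^esub> above n) = carrier A"
      by (intro Span_monomials_sum_ideal Jn k(1))
    define Us where "Us = concat (map (\<lambda>p. map (\<lambda>w. p \<otimes> w) ?M) (monomials xs n))"
    have lUs: "length Us = k ^ length ys * n ^ length xs"
      unfolding Us_def by (simp add: length_concat comp_def sum_list_triv length_monomials)
    have Uc: "set Us \<subseteq> carrier A"
      unfolding Us_def using Mc monomials_carrier[OF xc, of n] by auto
    define Y where "Y = Span K Us <+>\<^bsub>A\<^esub> above n"
    have sS: "subalgebra K (Span K Us) A" using Span_is_subalgebra[OF K_subfield Uc] .
    have sY: "subalgebra K Y A"
      unfolding Y_def by (intro subalgebra_set_add sS above_subspace K_carrier)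
    have SY: "Span K Us \<subseteq> Y" and aY: "above n \<subseteq> Y"
      using subalgebraD(1,2)[OF sS] subalgebraD(1,2)[OF above_subspace[of n]]
      unfolding Y_def subset_iff set_add_iff by (metis r_zero l_zero)+
    have UY: "set Us \<subseteq> Y" using SY Span_base_incl[OF K_subfield Uc] by blast
    have MY: "Span K ?M \<subseteq> Y"
    proof (rule subalgebra_Span_incl[OF K_subfield sY])
      have "set ?M \<subseteq> set Us"
      proof
        fix w assume w: "w \<in> set ?M"
        then have "\<one> \<otimes> w \<in> set Us" unfolding Us_def using one_in_monomials[OF n xc] by auto
        then show "w \<in> set Us" using w Mc by auto
      qed
      then show "set ?M \<subseteq> Y" using UY by blast
    qed
    have xY: "x \<otimes> z \<in> Y" if x: "x \<in> set xs" and z: "z \<in> Y" for x z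
    proof -
      have x1: "x \<in> carrier A" "x \<in> above 1" using x xc xs by auto
      have "x \<otimes> q \<in> Y" if q: "q \<in> set Us" for q
      proof -
        obtain p w where pw: "p \<in> set (monomials xs n)" "w \<in> set ?M" "q = p \<otimes> w"
          using q unfolding Us_def by auto
        have c: "p \<in> carrier A" "w \<in> carrier A" using pw Mc monomials_carrier[OF xc] by auto
        have eq: "x \<otimes> q = (x \<otimes> p) \<otimes> w" using pw c x1 by (simp add: m_assoc)
        show ?thesis
          using monomials_mult[OF xc x pw(1)]
        proof (elim disjE bexE)
          assume "x \<otimes> p \<in> set (monomials xs n)"
          then have "x \<otimes> q \<in> set Us" unfolding eq Us_def using pw(2) by auto
          then show ?thesis using UY by blast
        next
          fix t assume "t \<in> carrier A" "x \<otimes> p = x [^] n \<otimes> t"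
          then have "x \<otimes> q = x [^] n \<otimes> (t \<otimes> w)" using eq c x1 by (simp add: m_assoc)
          then show ?thesis
            using ideal.I_r_closed[OF above_ideal pow_above[OF x1(2)]] \<open>t \<in> carrier A\<close> c aY by auto
        qed
      qed
      moreover obtain s g where sg: "s \<in> Span K Us" "g \<in> above n" "z = s \<oplus> g"
        using z unfolding Y_def set_add_iff by blast
      ultimately have "x \<otimes> s \<in> Y" using mult_Span_subset[OF K_subfield sY Uc x1(1)] by blast
      moreover have "x \<otimes> g \<in> Y" using ideal.I_l_closed[OF above_ideal sg(2) x1(1)] aY by blast
      ultimately show ?thesis
        using sg x1 subalgebraD(1)[OF sS] subalgebraD(1)[OF above_subspace[of n]] subalgebraD(3)[OF sY]
        by (auto simp: r_distr subset_iff simp del: Span.simps)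
    qed
    \<comment> \<open>Successive approximation: if \<open>Y\<close> exhausts A up to
      \<open>above j\<close>, then the ideal \<open>J\<close> lies in \<open>Y\<close> up to
      \<open>above (Suc j)\<close>, because \<open>Y\<close> is stable under \<open>xs\<close> and
      \<open>xs\<close> has positive degree. Since A is the sum of a subspace of \<open>Y\<close>,
      of \<open>J\<close> and of \<open>above n\<close>, the approximation improves by one degree.
      At \<open>j = n\<close> the error is absorbed by \<open>Y\<close>.\<close>
    have "carrier A \<subseteq> Y <+>\<^bsub>A\<^esub> above j" for j
    proof (induction j)
      case 0
      have "x = \<zero> \<oplus> x" if "x \<in> carrier A" for x using that by simp
      then show ?case using subalgebraD(2)[OF sY] unfolding above_0 subset_iff set_add_iff by metis
    next
      case (Suc j)
      let ?W = "Y <+>\<^bsub>A\<^esub> above (Suc j)"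
      have sW: "subalgebra K ?W A" by (intro subalgebra_set_add sY above_subspace K_carrier)
      have YW: "Y \<subseteq> ?W" and aW: "above (Suc j) \<subseteq> ?W"
        using subalgebraD(1,2)[OF sY] subalgebraD(1,2)[OF above_subspace[of "Suc j"]]
        unfolding subset_iff set_add_iff by (metis r_zero l_zero)+
      have "J \<subseteq> ?W"
        unfolding J_def
      proof (rule Idl_subset_subspace[OF K_carrier sW xc])
        fix x a assume x: "x \<in> set xs" and a: "a \<in> carrier A"
        obtain y g where yg: "y \<in> Y" "g \<in> above j" "a = y \<oplus> g"
          using Suc a unfolding set_add_iff subset_iff by blast
        have "x \<otimes> y \<in> ?W" using xY[OF x yg(1)] YW by blast
        moreover have "x \<otimes> g \<in> ?W"
          using mult_above[of x 1 g j] x xs yg(2) aW by auto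
        ultimately show "x \<otimes> a \<in> ?W"
          using yg x xc subalgebraD(1)[OF sY] subalgebraD(1)[OF above_subspace[of j]] subalgebraD(3)[OF sW]
          by (auto simp: r_distr subset_iff)
      qed
      show ?case
      proof
        fix a assume "a \<in> carrier A"
        then obtain s e g where "s \<in> Span K ?M" "e \<in> J" "g \<in> above n" "a = s \<oplus> (e \<oplus> g)"
          using sumJ unfolding set_eq_iff set_add_iff Bex_def by metis
        then have "s \<in> ?W" "e \<in> ?W" "g \<in> ?W" "a = s \<oplus> (e \<oplus> g)"
          using MY YW \<open>J \<subseteq> ?W\<close> aY by (auto simp del: Span.simps)
        then show "a \<in> ?W" using subalgebraD(3)[OF sW] by (simp del: Span.simps)
      qed
    qed
    from this[of n] have "carrier A \<subseteq> Y"
      using aY subalgebraD(3)[OF sY] by (force simp: set_add_iff)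
    then have "Span K Us <+>\<^bsub>A\<^esub> above n = carrier A"
      using subalgebraD(1)[OF sY] Y_def by blast
    from dimension_below[OF Uc this] show ?thesis using lUs by metis
  qed
  then show ?thesis by blast
qed

end

section \<open>Krull dimension and growth\<close>

text \<open>An ideal maximal among those that contain \<open>J\<close> and avoid \<open>S\<close>,
  as provided by Zorn's lemma, is prime: enlarging it by either of two outside elements meets
  \<open>S\<close>, and if their product were inside, so would be the product of the two elements of
  \<open>S\<close> found in this way.\<close>

lemma (in cring) exists_prime_avoiding:
  assumes J: "ideal J R" and S: "\<one> \<in> S" "S \<subseteq> carrier R" "\<And>x y. x \<in> S \<Longrightarrow> y \<in> S \<Longrightarrow> x \<otimes> y \<in> S"
    and disj: "J \<inter> S = {}"
  obtains P where "primeideal P R" "J \<subseteq> P" "P \<inter> S = {}"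
proof -
  define \<I> where "\<I> = {I. ideal I R \<and> J \<subseteq> I \<and> I \<inter> S = {}}"
  have "\<exists>M\<in>\<I>. \<forall>I\<in>\<I>. M \<subseteq> I \<longrightarrow> I = M"
  proof (rule subset_Zorn_nonempty)
    show "\<I> \<noteq> {}" using J disj by (auto simp: \<I>_def)
    fix C assume C: "C \<noteq> {}" "subset.chain \<I> C"
    have "subset.chain {I. ideal I R} C" using C(2) by (auto simp: subset_chain_def \<I>_def)
    then have "ideal (\<Union>C) R" using chain_Union_is_ideal[of C] C(1) by simp
    then show "\<Union>C \<in> \<I>" using C by (auto simp: subset_chain_def \<I>_def)
  qed
  then obtain P where P: "ideal P R" "J \<subseteq> P" "P \<inter> S = {}"
    and max: "\<And>I. ideal I R \<Longrightarrow> P \<subseteq> I \<Longrightarrow> I \<inter> S = {} \<Longrightarrow> I = P"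
    unfolding \<I>_def by (auto 4 3)
  interpret P: ideal P R by fact
  have ext: "\<exists>p\<in>P. \<exists>r\<in>carrier R. p \<oplus> r \<otimes> a \<in> S" if a: "a \<in> carrier R" "a \<notin> P" for a
  proof -
    let ?I = "P <+>\<^bsub>R\<^esub> PIdl a"
    have I: "ideal ?I R" using add_ideals[OF P(1) cgenideal_ideal[OF a(1)]] .
    have "P \<subseteq> ?I"
    proof
      fix p assume "p \<in> P"
      moreover from this have "p = p \<oplus> \<zero>" using P.Icarr by simp
      moreover have "\<zero> \<in> PIdl a" using additive_subgroup.zero_closed[OF ideal.axioms(1)[OF cgenideal_ideal[OF a(1)]]] .
      ultimately show "p \<in> ?I" unfolding set_add_iff by blast
    qed
    moreover have "a \<in> ?I"
    proof -
      have "a = \<zero> \<oplus> a" using a by simp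
      then show ?thesis using P.zero_closed cgenideal_self[OF a(1)] unfolding set_add_iff by blast
    qed
    ultimately have "?I \<inter> S \<noteq> {}" using max[OF I] a(2) by auto
    then show ?thesis unfolding set_add_iff cgenideal_def by (auto simp: set_add_iff)
  qed
  have "primeideal P R"
  proof (rule primeidealI[OF P(1) is_cring])
    show "carrier R \<noteq> P" using P(3) S(1) by blast
    fix a b assume ab: "a \<in> carrier R" "b \<in> carrier R" "a \<otimes> b \<in> P"
    show "a \<in> P \<or> b \<in> P"
    proof (rule ccontr)
      assume "\<not> (a \<in> P \<or> b \<in> P)"
      then obtain p r q t where pr: "p \<in> P" "r \<in> carrier R" "p \<oplus> r \<otimes> a \<in> S"
        "q \<in> P" "t \<in> carrier R" "q \<oplus> t \<otimes> b \<in> S"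
        using ext ab by meson
      have c: "p \<in> carrier R" "q \<in> carrier R" using pr P.Icarr by auto
      have "(p \<oplus> r \<otimes> a) \<otimes> (q \<oplus> t \<otimes> b) = p \<otimes> (q \<oplus> t \<otimes> b) \<oplus> ((r \<otimes> a) \<otimes> q \<oplus> (r \<otimes> t) \<otimes> (a \<otimes> b))"
        using ab pr c by algebra
      also have "\<dots> \<in> P"
      proof -
        have "p \<otimes> (q \<oplus> t \<otimes> b) \<in> P" using P.I_r_closed[OF pr(1)] pr c ab by simp
        moreover have "(r \<otimes> a) \<otimes> q \<in> P" using P.I_l_closed[OF pr(4)] pr ab by simp
        moreover have "(r \<otimes> t) \<otimes> (a \<otimes> b) \<in> P" using P.I_l_closed[OF ab(3)] pr by simp
        ultimately show ?thesis by (intro P.a_closed)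
      qed
      finally show False using S(3)[OF pr(3,6)] P(3) by auto
    qed
  qed
  then show ?thesis using that P by blast
qed

lemma (in cring) regular_sequence_append:
  assumes "regular_sequence R (xs @ zs)"
  shows "regular_sequence R xs"
proof -
  have c: "set (xs @ zs) \<subseteq> carrier R" "Idl (set (xs @ zs)) \<noteq> carrier R"
    using assms unfolding regular_sequence_def by auto
  have "Idl (set xs) \<noteq> carrier R"
  proof
    assume "Idl (set xs) = carrier R"
    then have "\<one> \<in> Idl (set xs)" by simp
    moreover have "Idl (set xs) \<subseteq> Idl (set (xs @ zs))"
      using c(1) by (intro subset_Idl_subset) auto
    ultimately show False using ideal.one_imp_carrier[OF genideal_ideal[OF c(1)]] c(2) by blast
  qed
  moreover have "(xs @ zs) ! i = xs ! i" "take i (xs @ zs) = take i xs" if "i < length xs" for i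
    using that by (auto simp: nth_append)
  ultimately show ?thesis
    using assms unfolding regular_sequence_def by (metis le_sup_iff set_append trans_less_add1 length_append)
qed

text \<open>The prime chosen inside \<open>Q\<close> contains the shorter sequence but not its last
  element \<open>x\<close>: it avoids all \<open>u \<otimes> x [^] k\<close> with \<open>u\<close>
  outside \<open>Q\<close>. None of these lies in the ideal \<open>I\<close> of the shorter
  sequence, since cancelling the regular element \<open>x\<close> would put \<open>u\<close> into
  \<open>I\<close> and thus into \<open>Q\<close>.\<close>

lemma (in cring) prime_chain_of_regular_sequence:
  assumes "regular_sequence R xs" "primeideal Q R" "set xs \<subseteq> Q"
  shows "\<exists>C. subset.chain {P. primeideal P R \<and> P \<subseteq> Q} C \<and> finite C \<and> card C = Suc (length xs) \<and> Q \<in> C"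
  using assms
proof (induction xs arbitrary: Q rule: rev_induct)
  case Nil
  then show ?case by (intro exI[of _ "{Q}"]) (auto simp: subset_chain_def)
next
  case (snoc x xs)
  interpret Q: primeideal Q R by fact
  have xs: "set xs \<subseteq> carrier R" "x \<in> carrier R" "x \<in> Q"
    using snoc.prems by (auto simp: regular_sequence_def)
  define I where "I = Idl (set xs)"
  have I: "ideal I R" unfolding I_def using genideal_ideal[OF xs(1)] .
  have IQ: "I \<subseteq> Q" unfolding I_def using snoc.prems(3) by (intro genideal_minimal Q.is_ideal) auto
  have reg: "z \<in> I" if "z \<in> carrier R" "x \<otimes> z \<in> I" for z
    using snoc.prems(1) that unfolding regular_sequence_def I_def
    by (auto dest!: spec[of _ "length xs"])
  have pow: "u \<in> I" if "u \<in> carrier R" "u \<otimes> x [^] k \<in> I" for u and k :: nat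
    using that
  proof (induction k)
    case (Suc k)
    have "u \<otimes> x [^] Suc k = x \<otimes> (u \<otimes> x [^] k)" using Suc.prems xs by (simp add: m_ac)
    then show ?case using Suc reg[of "u \<otimes> x [^] k"] xs by auto
  qed auto
  define S where "S = {u \<otimes> x [^] (k::nat) | u k. u \<in> carrier R - Q}"
  have uS: "u \<in> S" if "u \<in> carrier R - Q" for u
    using that unfolding S_def by (auto intro!: exI[of _ u] exI[of _ "0::nat"])
  have one: "\<one> \<in> carrier R - Q" using Q.I_notcarr Q.one_imp_carrier by auto
  obtain P where P: "primeideal P R" "I \<subseteq> P" "P \<inter> S = {}"
  proof (rule exists_prime_avoiding[OF I])
    show "\<one> \<in> S" using uS one by blast
    show "S \<subseteq> carrier R" using xs by (auto simp: S_def)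
    show "I \<inter> S = {}" using pow IQ by (auto simp: S_def)
    fix a b assume "a \<in> S" "b \<in> S"
    then obtain u v and k l :: nat where uv: "u \<in> carrier R - Q" "v \<in> carrier R - Q"
      "a = u \<otimes> x [^] k" "b = v \<otimes> x [^] l" unfolding S_def by blast
    then have "a \<otimes> b = (u \<otimes> v) \<otimes> x [^] (k + l)"
      using xs by (simp add: nat_pow_mult[symmetric] m_ac)
    moreover have "u \<otimes> v \<in> carrier R - Q" using uv Q.I_prime by auto
    ultimately show "a \<otimes> b \<in> S" unfolding S_def by blast
  qed
  have PQ: "P \<subseteq> Q"
  proof
    fix z assume z: "z \<in> P"
    then have "z \<in> carrier R" using ideal.Icarr[OF primeideal.axioms(1)[OF P(1)]] by simp
    then show "z \<in> Q" using uS[of z] z P(3) by blast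
  qed
  have "x \<in> S" using one xs unfolding S_def by (auto intro!: exI[of _ \<one>] exI[of _ "1::nat"])
  then have xP: "x \<notin> P" using P(3) by blast
  have "set xs \<subseteq> P" using P(2) genideal_self[OF xs(1)] I_def by blast
  then obtain C where C: "subset.chain {P'. primeideal P' R \<and> P' \<subseteq> P} C" "finite C"
    "card C = Suc (length xs)" "P \<in> C"
    using snoc.IH[OF regular_sequence_append[OF snoc.prems(1)] P(1)] by blast
  have "Q \<notin> C" using C(1) xP xs(3) by (auto simp: subset_chain_def)
  then have "card (insert Q C) = Suc (length (xs @ [x]))" using C by simp
  moreover have "subset.chain {P. primeideal P R \<and> P \<subseteq> Q} (insert Q C)"
    using C(1) PQ snoc.prems(2) unfolding subset_chain_def by blast
  ultimately show ?case using C(2) by blast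
qed

lemma card_chain_le_height:
  assumes "subset.chain {Q. primeideal Q A \<and> Q \<subseteq> P} C" "finite C" "C \<noteq> {}"
  shows "enat (card C - 1) \<le> height A P"
  unfolding height_def by (rule SUP_upper) (use assms in auto)

lemma height_le_krull_dim: "height A P \<le> krull_dim A"
  unfolding height_def krull_dim_def by (rule SUP_subset_mono) (auto simp: subset_chain_def)

text \<open>A set of extended natural numbers with a finite supremum is finite, so its supremum is a
  maximum.\<close>

lemma Sup_enat_attained:
  assumes "Sup E = enat n" "E \<noteq> {}"
  shows "enat n \<in> E"
proof -
  have "finite E" using assms by (auto simp: Sup_enat_def split: if_splits)
  then show ?thesis using assms Max_in[of E] by (simp add: Sup_enat_def)
qed

text \<open>Regularity of the empty sequence makes the supremum range over a nonempty set; the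
  supremum of the empty set would be 0 as well, but would not come with a sequence.\<close>

lemma depth_attained:
  assumes "depth A I = enat n" "regular_sequence A []"
  obtains xs where "regular_sequence A xs" "set xs \<subseteq> I" "length xs = n"
proof -
  let ?E = "(\<lambda>xs. enat (length xs)) ` {xs. regular_sequence A xs \<and> set xs \<subseteq> I}"
  have "enat n \<in> ?E"
    using assms(1) unfolding depth_def by (rule Sup_enat_attained) (use assms(2) in auto)
  then show ?thesis using that by auto
qed

section \<open>Growth modulo prime ideals\<close>

context graded_generators
begin

text \<open>Minimality of the irrelevant ideal over \<open>xs\<close>, phrased without localization.
  If the claim failed, some prime containing \<open>xs\<close> and lying in \<open>above 1\<close>
  would avoid \<open>y\<close>; the chain of primes that the regular sequence produces below it
  could be prolonged by \<open>above 1\<close>, beyond the height.\<close>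

lemma locally_nilpotent_modulo_sequence:
  assumes reg: "regular_sequence A xs" "set xs \<subseteq> above 1" and ht: "height A (above 1) \<le> enat (length xs)"
    and y: "y \<in> above 1"
  shows "\<exists>u\<in>carrier A - above 1. \<exists>k::nat. u \<otimes> y [^] k \<in> Idl (set xs)"
proof (rule ccontr)
  assume neg: "\<not> ?thesis"
  interpret M: maximalideal "above 1" A by (rule irrelevant_maximal)
  have M: "primeideal (above 1) A" using maximalideal_prime irrelevant_maximal by blast
  have c: "set xs \<subseteq> carrier A" "y \<in> carrier A"
    using reg(2) y ideal.Icarr[OF above_ideal] by blast+
  define S where "S = {u \<otimes> y [^] (k::nat) | u k. u \<in> carrier A - above 1}"
  have uS: "u \<in> S" if "u \<in> carrier A - above 1" for u
  proof -
    have "u = u \<otimes> y [^] (0::nat)" using that by simp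
    then show ?thesis using that unfolding S_def by blast
  qed
  have one: "\<one> \<in> carrier A - above 1" using M.I_notcarr M.one_imp_carrier by auto
  obtain P where P: "primeideal P A" "Idl (set xs) \<subseteq> P" "P \<inter> S = {}"
  proof (rule exists_prime_avoiding[OF genideal_ideal[OF c(1)]])
    show "\<one> \<in> S" using uS one by blast
    show "S \<subseteq> carrier A" using c by (auto simp: S_def)
    show "Idl (set xs) \<inter> S = {}" using neg by (auto simp: S_def)
    fix a b assume "a \<in> S" "b \<in> S"
    then obtain u v and k l :: nat where uv: "u \<in> carrier A - above 1" "v \<in> carrier A - above 1"
      "a = u \<otimes> y [^] k" "b = v \<otimes> y [^] l" unfolding S_def by blast
    then have "a \<otimes> b = (u \<otimes> v) \<otimes> y [^] (k + l)"
      using c by (simp add: nat_pow_mult[symmetric] m_ac)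
    moreover have "u \<otimes> v \<in> carrier A - above 1" using uv primeideal.I_prime[OF M] by auto
    ultimately show "a \<otimes> b \<in> S" unfolding S_def by blast
  qed
  have PM: "P \<subseteq> above 1"
  proof
    fix z assume z: "z \<in> P"
    then have "z \<in> carrier A" using ideal.Icarr[OF primeideal.axioms(1)[OF P(1)]] by simp
    then show "z \<in> above 1" using uS[of z] z P(3) by blast
  qed
  have "y \<in> S" using one c unfolding S_def by (auto intro!: exI[of _ \<one>] exI[of _ "1::nat"])
  then have yP: "y \<notin> P" using P(3) by blast
  have "set xs \<subseteq> P" using P(2) genideal_self[OF c(1)] by blast
  then obtain C where C: "subset.chain {P'. primeideal P' A \<and> P' \<subseteq> P} C" "finite C"
    "card C = Suc (length xs)" "P \<in> C"
    using prime_chain_of_regular_sequence[OF reg(1) P(1)] by blast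
  have "above 1 \<notin> C" using C(1) yP y by (auto simp: subset_chain_def)
  then have "card (insert (above 1) C) = Suc (Suc (length xs))" using C by simp
  moreover have "subset.chain {P. primeideal P A \<and> P \<subseteq> above 1} (insert (above 1) C)"
    using C(1) PM M unfolding subset_chain_def by blast
  ultimately have "enat (Suc (length xs)) \<le> height A (above 1)"
    using card_chain_le_height[of A "above 1" "insert (above 1) C"] C(2) by simp
  then show False using ht by (metis enat_ord_simps(1) not_less_eq_eq order.refl order.trans)
qed

text \<open>The dimension of the image of \<open>below n\<close> in A modulo \<open>P\<close>.
  Primes of a chain need not be homogeneous, so the quotient is measured by a filtration and not by
  a grading.\<close>

definition qdim :: "'a set \<Rightarrow> nat \<Rightarrow> nat" where
  "qdim P n = dim K (below n) - dim K (below n \<inter> P)"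

lemma
  assumes "ideal P A"
  shows dimension_below_Int: "dimension (dim K (below n \<inter> P)) K (below n \<inter> P)"
    and qdim_add: "qdim P n + dim K (below n \<inter> P) = dim K (below n)"
proof -
  obtain m where m: "dimension m K (below n)" using finite_dimension_below by blast
  have s: "subalgebra K (below n \<inter> P) A"
    using subalgebra_inter below_subspace ideal_subspace[OF assms] by blast
  show *: "dimension (dim K (below n \<inter> P)) K (below n \<inter> P)"
    by (rule dimension_subspace[OF K_subfield m s]) auto
  have "dim K (below n \<inter> P) \<le> dim K (below n)"
    unfolding dim_eq[OF K_subfield m] using dimension_mono[OF K_subfield * m] by blast
  then show "qdim P n + dim K (below n \<inter> P) = dim K (below n)" by (simp add: qdim_def)
qed

lemma dimension_dim_below: "dimension (dim K (below n)) K (below n)"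
  using finite_dimension_below dim_eq[OF K_subfield] by metis

text \<open>Multiplication by \<open>f\<close> embeds A modulo \<open>P\<close> into
  \<open>Q\<close> modulo \<open>P\<close> and raises degrees by at most \<open>k\<close>; what is
  left of A modulo \<open>P\<close> is A modulo \<open>Q\<close>.\<close>

lemma qdim_step:
  assumes P: "ideal P A" and Q: "ideal Q A" and f: "f \<in> Q" "f \<in> below (Suc k)"
    and reg: "\<And>x. x \<in> carrier A \<Longrightarrow> f \<otimes> x \<in> P \<longleftrightarrow> x \<in> P" and PQ: "P \<subseteq> Q"
  shows "qdim P n + qdim Q (n + k) \<le> qdim P (n + k)"
proof -
  let ?U = "below (n + k) \<inter> P" and ?W = "below n"
  have fc: "f \<in> carrier A" using f by (auto simp: below_def)
  have fW: "f \<otimes> x \<in> below (n + k)" if "x \<in> ?W" for x using mult_below[OF f(2) that] .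
  have Wc: "?W \<subseteq> carrier A" by (auto simp: below_def)
  have W0: "{x \<in> ?W. f \<otimes> x \<in> ?U} = below n \<inter> P" using fW reg Wc by auto
  note * = dimension_add_image[OF K_subfield dimension_below_Int[OF P, of "n + k"] dimension_dim_below[of n],
      of _ "\<lambda>x. f \<otimes> x", unfolded W0, OF dimension_below_Int[OF P]]
  have "f \<otimes> (k \<otimes> x) = k \<otimes> (f \<otimes> x)" if "k \<in> K" "x \<in> ?W" for k x
    using that K_carrier Wc fc by (intro m_lcomm) auto
  moreover have "f \<otimes> x \<in> carrier A" if "x \<in> ?W" for x using that Wc fc by auto
  moreover have "f \<otimes> (x \<oplus> y) = f \<otimes> x \<oplus> f \<otimes> y" if "x \<in> ?W" "y \<in> ?W" for x y
    using that Wc fc by (intro r_distr) auto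
  ultimately have "dimension (dim K ?U + dim K ?W - dim K (below n \<inter> P)) K (?U <+>\<^bsub>A\<^esub> (\<lambda>x. f \<otimes> x) ` ?W)"
    and le: "dim K (below n \<inter> P) \<le> dim K ?W"
    using * by blast+
  moreover have "?U <+>\<^bsub>A\<^esub> (\<lambda>x. f \<otimes> x) ` ?W \<subseteq> below (n + k) \<inter> Q"
  proof
    fix z assume "z \<in> ?U <+>\<^bsub>A\<^esub> (\<lambda>x. f \<otimes> x) ` ?W"
    then obtain u x where z: "u \<in> ?U" "x \<in> ?W" "z = u \<oplus> f \<otimes> x" unfolding set_add_iff by blast
    have "f \<otimes> x \<in> Q" using ideal.I_r_closed[OF Q f(1)] z Wc by blast
    then show "z \<in> below (n + k) \<inter> Q"
      using z fW PQ subalgebraD(3)[OF below_subspace] subalgebraD(3)[OF ideal_subspace[OF Q]] by blast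
  qed
  ultimately have "dim K ?U + dim K ?W - dim K (below n \<inter> P) \<le> dim K (below (n + k) \<inter> Q)"
    using dimension_mono[OF K_subfield _ dimension_below_Int[OF Q]] by blast
  then show ?thesis
    using qdim_add[OF P, of n] qdim_add[OF P, of "n + k"] qdim_add[OF Q, of "n + k"] le by linarith
qed

lemma qdim_mono:
  assumes P: "ideal P A"
  shows "qdim P n \<le> qdim P (n + k)"
proof -
  let ?U = "below (n + k) \<inter> P" and ?W = "below n"
  have sub: "?W \<subseteq> below (n + k)" by (rule below_mono) simp
  have Wc: "?W \<subseteq> carrier A" by (auto simp: below_def)
  have W0: "{x \<in> ?W. x \<in> ?U} = below n \<inter> P" using sub by auto
  note * = dimension_add_image[OF K_subfield dimension_below_Int[OF P, of "n + k"] dimension_dim_below[of n],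
      of _ "\<lambda>x. x", unfolded W0, OF dimension_below_Int[OF P]]
  have "dimension (dim K ?U + dim K ?W - dim K (below n \<inter> P)) K (?U <+>\<^bsub>A\<^esub> (\<lambda>x. x) ` ?W)"
    and le: "dim K (below n \<inter> P) \<le> dim K ?W"
    by (rule *; use Wc in auto)+
  moreover have "?U <+>\<^bsub>A\<^esub> (\<lambda>x. x) ` ?W \<subseteq> below (n + k)"
    using sub subalgebraD(3)[OF below_subspace] unfolding subset_iff set_add_iff by auto
  ultimately have "dim K ?U + dim K ?W - dim K (below n \<inter> P) \<le> dim K (below (n + k))"
    using dimension_mono[OF K_subfield _ dimension_dim_below] by blast
  then show ?thesis
    using qdim_add[OF P, of n] qdim_add[OF P, of "n + k"] le by linarith
qed

text \<open>Iterating the embedding by an element \<open>f\<close> of \<open>Q\<close> outside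
  \<open>P\<close> gains at least \<open>qdim Q n\<close> at every step. With as many steps as the
  degree \<open>n\<close>, this makes A modulo \<open>Q\<close> grow more slowly by a factor of
  \<open>n\<close>.\<close>

lemma qdim_prime_pair:
  assumes "primeideal P A" "primeideal Q A" "P \<subset> Q"
  obtains k where "\<And>m n. m * qdim Q n \<le> qdim P (n + m * k)"
proof -
  have P: "ideal P A" and Q: "ideal Q A" using assms primeideal.axioms(1) by auto
  obtain f where f: "f \<in> Q" "f \<notin> P" using assms(3) by blast
  have fc: "f \<in> carrier A" using f(1) ideal.Icarr[OF Q] by blast
  obtain k where k: "f \<in> below (Suc k)" using in_below[OF fc] .
  have reg: "f \<otimes> x \<in> P \<longleftrightarrow> x \<in> P" if "x \<in> carrier A" for x
    using primeideal.I_prime[OF assms(1) fc that] f(2) ideal.I_l_closed[OF P _ fc, of x] by blast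
  have "m * qdim Q n \<le> qdim P (n + m * k)" for m n
  proof (induction m)
    case (Suc m)
    have "m * qdim Q n + qdim Q n \<le> qdim P (n + m * k) + qdim Q (n + (m * k + k))"
      by (intro add_mono Suc qdim_mono Q)
    also have "\<dots> \<le> qdim P (n + m * k + k)"
      using qdim_step[OF P Q f(1) k reg, of "n + m * k"] assms(3) by (simp add: add.assoc psubset_imp_subset)
    finally show ?case by (simp add: algebra_simps)
  qed simp
  then show ?thesis using that by blast
qed

text \<open>Passing to the least prime of the chain lowers the exponent of growth by one. At
  exponent 0 nothing can lie above \<open>P\<close>: all multiples of \<open>qdim Q 1\<close> would
  stay below one constant, so \<open>qdim Q 1 = 0\<close> and \<open>Q\<close> would contain
  \<open>\<one>\<close>.\<close>

lemma prime_chain_above_bound: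
  assumes "primeideal P A" "\<forall>n\<ge>1. qdim P n \<le> c * n ^ a"
    and "subset.chain {Q. primeideal Q A} C" "finite C" "\<forall>Q\<in>C. P \<subset> Q"
  shows "card C \<le> a"
  using assms
proof (induction a arbitrary: P C c)
  case 0
  have "C = {}"
  proof (rule ccontr)
    assume "C \<noteq> {}"
    then obtain Q where Q: "primeideal Q A" "P \<subset> Q" using 0 by (auto simp: subset_chain_def)
    obtain k where k: "\<And>m n. m * qdim Q n \<le> qdim P (n + m * k)"
      using qdim_prime_pair[OF "0.prems"(1) Q] by blast
    have "m * qdim Q 1 \<le> c" for m
      using k[of m 1] "0.prems"(2) by (metis le_add1 mult.right_neutral order.trans power_0)
    from this[of "Suc c"] have "qdim Q 1 = 0" by (cases "qdim Q 1") auto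
    moreover have Qi: "ideal Q A" using Q primeideal.axioms(1) by auto
    ultimately have eq: "dim K (below 1 \<inter> Q) = dim K (below 1)" using qdim_add[OF Qi, of 1] by simp
    obtain Us where Us: "independent K Us" "length Us = dim K (below 1 \<inter> Q)" "Span K Us = below 1 \<inter> Q"
      "set Us \<subseteq> carrier A"
      using exists_base[OF K_subfield dimension_below_Int[OF Qi]] by blast
    then have "Span K Us = below 1"
      using independent_length_eq_dimension[OF K_subfield dimension_dim_below[of 1] Us(1)] eq
        Span_base_incl[OF K_subfield Us(4)] by auto
    moreover have "\<one> \<in> gr 0" using subringE(3)[OF subfieldE(1)[OF K_subfield]] gr_0 by simp
    ultimately have "\<one> \<in> Q" using gr_below[of \<one> 0] Us(3) by auto
    then show False using ideal.one_imp_carrier[OF Qi] primeideal.I_notcarr[OF Q(1)] by simp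
  qed
  then show ?case by simp
next
  case (Suc a)
  show ?case
  proof (cases "C = {}")
    case False
    then obtain Q where Q: "Q \<in> C" "\<forall>Q'\<in>C. Q' \<subseteq> Q \<longrightarrow> Q = Q'"
      using finite_has_minimal[OF Suc.prems(4)] by blast
    have Q': "\<forall>Q'\<in>C - {Q}. Q \<subset> Q'"
    proof
      fix Q' assume "Q' \<in> C - {Q}"
      moreover from this have "Q \<subseteq> Q' \<or> Q' \<subseteq> Q" using Q(1) Suc.prems(3) by (auto simp: subset_chain_def)
      ultimately show "Q \<subset> Q'" using Q(2) by auto
    qed
    have Qp: "primeideal Q A" "P \<subset> Q" using Q Suc.prems(3,5) by (auto simp: subset_chain_def)
    obtain k where k: "\<And>m n. m * qdim Q n \<le> qdim P (n + m * k)"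
      using qdim_prime_pair[OF Suc.prems(1) Qp] by blast
    have "qdim Q n \<le> (c * Suc k ^ Suc a) * n ^ a" if "n \<ge> 1" for n
    proof -
      \<comment> \<open>The number of steps is chosen equal to the degree, so that a factor
        \<open>n\<close> can be cancelled from both sides.\<close>
      have "n * qdim Q n \<le> qdim P (n + n * k)" by (rule k)
      also have "\<dots> \<le> c * (n + n * k) ^ Suc a" using Suc.prems(2) that by simp
      also have "n + n * k = Suc k * n" by simp
      also have "c * (Suc k * n) ^ Suc a = n * (c * Suc k ^ Suc a * n ^ a)"
        by (simp only: power_Suc power_mult_distrib mult_ac)
      finally show ?thesis using that by simp
    qed
    moreover have "subset.chain {Q. primeideal Q A} (C - {Q})" "finite (C - {Q})"
      using Suc.prems(3,4) by (auto simp: subset_chain_def)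
    ultimately have "card (C - {Q}) \<le> a"
      using Suc.IH[OF Qp(1), of "c * Suc k ^ Suc a" "C - {Q}"] Q' by blast
    then show ?thesis using Q(1) Suc.prems(4) by simp
  qed simp
qed

lemma krull_dim_le_growth:
  assumes "\<forall>n\<ge>1. \<exists>m\<le>c * n ^ a. dimension m K (below n)"
  shows "krull_dim A \<le> enat a"
  unfolding krull_dim_def
proof (rule SUP_least)
  fix C assume "C \<in> {C. subset.chain {P. primeideal P A} C \<and> finite C \<and> C \<noteq> {}}"
  then have C: "subset.chain {P. primeideal P A} C" "finite C" "C \<noteq> {}" by auto
  obtain P where P: "P \<in> C" "\<forall>Q\<in>C. Q \<subseteq> P \<longrightarrow> P = Q"
    using finite_has_minimal[OF C(2,3)] by blast
  have "\<forall>n\<ge>1. qdim P n \<le> c * n ^ a"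
    using assms dim_eq[OF K_subfield] by (metis diff_le_self order.trans qdim_def)
  moreover have "\<forall>Q\<in>C - {P}. P \<subset> Q"
  proof
    fix Q assume "Q \<in> C - {P}"
    moreover from this have "Q \<subseteq> P \<or> P \<subseteq> Q" using P(1) C(1) by (auto simp: subset_chain_def)
    ultimately show "P \<subset> Q" using P(2) by auto
  qed
  moreover have "primeideal P A" "subset.chain {Q. primeideal Q A} (C - {P})" "finite (C - {P})"
    using P C(1,2) by (auto simp: subset_chain_def)
  ultimately have "card (C - {P}) \<le> a"
    using prime_chain_above_bound[of P c a "C - {P}"] by blast
  then show "enat (card C - 1) \<le> enat a" using P C(2) by simp
qed

text \<open>The height of \<open>above 1\<close> is at most \<open>d\<close>, hence finite, so the
  depth is attained by an actual sequence. The growth bound for that sequence shows that it has at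
  least \<open>d\<close> elements, and a prefix of a regular sequence is regular.\<close>

lemma cohen_macaulay_regular_sequence:
  assumes CM: "cohen_macaulay A" and d: "krull_dim A = enat d"
  obtains xs where "regular_sequence A xs" "set xs \<subseteq> above 1" "length xs = d"
proof -
  have M: "primeideal (above 1) A" using maximalideal_prime irrelevant_maximal by blast
  have eq: "depth A (above 1) = height A (above 1)"
    using CM irrelevant_maximal by (simp add: cohen_macaulay_def)
  have "height A (above 1) \<le> enat d" using height_le_krull_dim[of A "above 1"] d by simp
  then obtain e where e: "height A (above 1) = enat e" by (cases "height A (above 1)") auto
  have "regular_sequence A []"
    using genideal_zero genideal_minimal[OF above_ideal[of 1], of "{}"] primeideal.I_notcarr[OF M]
      ideal.Icarr[OF above_ideal[of 1]]
    unfolding regular_sequence_def by auto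
  then obtain xs where xs: "regular_sequence A xs" "set xs \<subseteq> above 1" "length xs = e"
    using depth_attained[of A "above 1" e] eq e by metis
  obtain c where "\<forall>n\<ge>1. \<exists>m\<le>c * n ^ length xs. dimension m K (below n)"
    using growth_bound[OF xs(2)] locally_nilpotent_modulo_sequence[OF xs(1,2)] ys_above e xs(3) by auto
  from krull_dim_le_growth[OF this] have "d \<le> length xs" using d by simp
  moreover have "regular_sequence A (take d xs)"
    using regular_sequence_append[of "take d xs" "drop d xs"] xs(1) by simp
  moreover have "set (take d xs) \<subseteq> above 1" using set_take_subset[of d xs] xs(2) by blast
  ultimately show ?thesis using that[of "take d xs"] by simp
qed

end

section \<open>Toeplitz matrices of a linear form\<close>

text \<open>The coefficient of z^k in the product of the polynomial with coefficients y 0, ..., y (n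
  - 1) and the series with coefficients \<open>c\<close>. Both live in one ring, later a ring of
  functions, where the \<open>y i\<close> are constants and the \<open>c k\<close> are
  vectors.\<close>

primrec (in ring) conv :: "(nat \<Rightarrow> 'a) \<Rightarrow> nat \<Rightarrow> (nat \<Rightarrow> 'a) \<Rightarrow> nat \<Rightarrow> 'a" where
  "conv y 0 c k = \<zero>"
| "conv y (Suc n) c k = conv y n c k \<oplus> (if n \<le> k then y n \<otimes> c (k - n) else \<zero>)"

context cring
begin

lemma conv_subspace:
  assumes "subalgebra C N R" "\<And>i. i < n \<Longrightarrow> y i \<in> C" "\<And>k. c k \<in> N"
  shows "conv y n c k \<in> N"
  using assms(2) by (induction n) (use assms(3) subalgebraD(2,3,5)[OF assms(1)] in auto)

lemma conv_carrier:
  assumes "\<And>i. i < n \<Longrightarrow> y i \<in> carrier R" "\<And>k. c k \<in> carrier R"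
  shows "conv y n c k \<in> carrier R"
  using assms(1) by (induction n) (use assms(2) in auto)

lemma conv_add:
  assumes "\<And>i. i < n \<Longrightarrow> y i \<in> carrier R" "\<And>k. b k \<in> carrier R" "\<And>k. c k \<in> carrier R"
  shows "conv y n (\<lambda>k. b k \<oplus> c k) k = conv y n b k \<oplus> conv y n c k"
  using assms(1)
proof (induction n)
  case (Suc n)
  have "conv y n b k \<in> carrier R" "conv y n c k \<in> carrier R"
    using Suc.prems assms by (auto intro!: conv_carrier)
  moreover have "y n \<in> carrier R" "b (k - n) \<in> carrier R" "c (k - n) \<in> carrier R"
    using Suc.prems assms by auto
  ultimately show ?case using Suc by (auto simp: r_distr a_ac)
qed simp

lemma conv_smult:
  assumes "\<And>i. i < n \<Longrightarrow> y i \<in> carrier R" "\<And>k. c k \<in> carrier R" "a \<in> carrier R"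
  shows "conv y n (\<lambda>k. a \<otimes> c k) k = a \<otimes> conv y n c k"
  using assms(1)
proof (induction n)
  case (Suc n)
  have "conv y n c k \<in> carrier R"
    using Suc.prems assms by (auto intro!: conv_carrier)
  moreover have "y n \<in> carrier R" "c (k - n) \<in> carrier R"
    using Suc.prems assms by auto
  ultimately show ?case using Suc assms(3) by (auto simp: r_distr m_lcomm)
qed (use assms in simp)

lemma conv_eq_zero:
  assumes "\<And>i. i < n \<Longrightarrow> y i \<in> carrier R" "\<And>j. j \<ge> m \<Longrightarrow> c j = \<zero>" "k \<ge> m + n"
  shows "conv y n c k = \<zero>"
  using assms(1,3) by (induction n) (use assms(2) in auto)

lemma conv_isolate:
  assumes N: "subalgebra C N R" and carr: "\<And>i. i < n \<Longrightarrow> y i \<in> carrier R" "\<And>k. c k \<in> carrier R"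
    and "conv y n c k \<in> N" "i < n" "i \<le> k"
    and "\<And>j. j < n \<Longrightarrow> j \<noteq> i \<Longrightarrow> j \<le> k \<Longrightarrow> y j \<otimes> c (k - j) \<in> N"
  shows "y i \<otimes> c (k - i) \<in> N"
proof -
  note N = subalgebraD[OF N]
  have cancel: "u \<in> N \<longleftrightarrow> u \<oplus> v \<in> N" "v \<oplus> u \<in> N \<longleftrightarrow> u \<in> N" if "v \<in> N" "u \<in> carrier R" for u v
  proof -
    have "v \<in> carrier R" using that N(1) by blast
    then have "u = (u \<oplus> v) \<oplus> \<ominus> v" using that(2) by (simp add: a_assoc r_neg)
    then show "u \<in> N \<longleftrightarrow> u \<oplus> v \<in> N" using that N(3,4) by metis
    then show "v \<oplus> u \<in> N \<longleftrightarrow> u \<in> N" using that \<open>v \<in> carrier R\<close> a_comm by metis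
  qed
  have other: "conv y m c k \<in> N" if "m \<le> n" "m \<le> i" for m
    using that
  proof (induction m)
    case (Suc m)
    then show ?case using assms(7)[of m] N(2,3) by auto
  qed (use N(2) in auto)
  have "conv y m c k \<in> N \<longleftrightarrow> y i \<otimes> c (k - i) \<in> N" if "m \<le> n" "i < m" for m
    using that
  proof (induction m)
    case (Suc m)
    show ?case
    proof (cases "i = m")
      case True
      then show ?thesis using other[of m] Suc.prems assms(6) cancel(2) carr by auto
    next
      case False
      have "(if m \<le> k then y m \<otimes> c (k - m) else \<zero>) \<in> N"
        using assms(7)[of m] False Suc.prems N(2) by auto
      then have "conv y (Suc m) c k \<in> N \<longleftrightarrow> conv y m c k \<in> N"
        using cancel(1) conv_carrier[of m y c k] carr Suc.prems by simp
      then show ?thesis using Suc False by simp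
    qed
  qed simp
  then show ?thesis using assms(4,5) by blast
qed

text \<open>McCoy's argument: of all \<open>c\<close> that \<open>y\<close> annihilates modulo \<open>N\<close>, one of least degree is
  annihilated by every coefficient of \<open>y\<close>.\<close>

lemma conv_injective_modulo:
  assumes N: "subalgebra C N R" and V: "subalgebra C V R" and C: "C \<subseteq> carrier R"
    and y: "\<And>i. i < n \<Longrightarrow> y i \<in> C"
    and socle: "\<And>v. v \<in> V \<Longrightarrow> (\<And>i. i < n \<Longrightarrow> y i \<otimes> v \<in> N) \<Longrightarrow> v \<in> N"
    and c: "\<And>k. c k \<in> V" "\<And>k. conv y n c k \<in> N" "\<And>k. k \<ge> m \<Longrightarrow> c k \<in> N"
  shows "c k \<in> N"
  using c
proof (induction m arbitrary: c k)
  case 0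
  then show ?case by simp
next
  case (Suc m)
  have yc: "y i \<in> carrier R" if "i < n" for i using y that C by blast
  have cc: "c k \<in> carrier R" for k using Suc.prems(1) subalgebraD(1)[OF V] by blast
  \<comment> \<open>A descending induction on the index \<open>i\<close>, encoded by
    \<open>j\<close> with \<open>n \<le> j + i\<close>, runs inside the induction on the degree
    bound \<open>m\<close> of \<open>c\<close>.\<close>
  have top: "y i \<otimes> c k \<in> N" if "i < n" "n \<le> j + i" for i j k
    using that
  proof (induction j arbitrary: i k)
    case (Suc j)
    show ?case
    proof (cases "n \<le> j + i")
      case False
      then have i: "n = Suc j + i" using Suc.prems by simp
      \<comment> \<open>In the coefficient of index \<open>m + i\<close>, the terms with
        \<open>l < i\<close> involve entries of \<open>c\<close> beyond \<open>m\<close>, and those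
        with \<open>l > i\<close> are settled by the inner induction; only the product of
        \<open>y i\<close> and \<open>c m\<close> remains.\<close>
      have "y i \<otimes> c (m + i - i) \<in> N"
      proof (rule conv_isolate[OF N yc cc \<open>\<And>k. conv y n c k \<in> N\<close>])
        fix l assume l: "l < n" "l \<noteq> i" "l \<le> m + i"
        show "y l \<otimes> c (m + i - l) \<in> N"
        proof (cases "l < i")
          case True
          then have "c (m + i - l) \<in> N" by (intro \<open>\<And>k. Suc m \<le> k \<Longrightarrow> c k \<in> N\<close>) simp
          then show ?thesis using y[OF l(1)] subalgebraD(5)[OF N] by blast
        next
          case False
          then show ?thesis using Suc.IH[of l] l i by simp
        qed
      qed (use Suc.prems in auto)
      then have top: "y i \<otimes> c k \<in> N" if "k \<ge> m" for k
        using that \<open>\<And>k. Suc m \<le> k \<Longrightarrow> c k \<in> N\<close>[of k] y[OF \<open>i < n\<close>] subalgebraD(5)[OF N]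
        by (cases "k = m") auto
      \<comment> \<open>Multiplication by \<open>y i\<close> pushes the top entry of
        \<open>c\<close> into \<open>N\<close>, so the outer induction hypothesis applies to the
        family of products.\<close>
      show ?thesis
      proof (rule \<open>\<And>c k. \<lbrakk>\<And>k. c k \<in> V; \<And>k. conv y n c k \<in> N; \<And>k. m \<le> k \<Longrightarrow> c k \<in> N\<rbrakk> \<Longrightarrow> c k \<in> N\<close>[of "\<lambda>k. y i \<otimes> c k"])
        show "y i \<otimes> c k \<in> V" for k
          using y[OF \<open>i < n\<close>] \<open>\<And>k. c k \<in> V\<close> subalgebraD(5)[OF V] by blast
        show "conv y n (\<lambda>k. y i \<otimes> c k) k \<in> N" for k
          using conv_smult[OF yc cc yc[OF \<open>i < n\<close>]] \<open>\<And>k. conv y n c k \<in> N\<close> y[OF \<open>i < n\<close>]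
            subalgebraD(5)[OF N] by simp
      qed (use top in auto)
    qed (use Suc in auto)
  qed simp
  show ?case using socle[OF Suc.prems(1)] top[of _ n] by simp
qed

end

text \<open>The predicates \<open>subalgebra\<close> and \<open>dimension\<close> speak about
  subsets of a ring. Modules over A are therefore realized inside a ring of functions with values in
  A, on which A acts through constant functions.\<close>

definition fun_ring :: "('a, 'b) ring_scheme \<Rightarrow> ('i \<Rightarrow> 'a) ring" where
  "fun_ring A = \<lparr>carrier = {f. \<forall>i. f i \<in> carrier A}, monoid.mult = (\<lambda>f g i. f i \<otimes>\<^bsub>A\<^esub> g i),
     one = (\<lambda>i. \<one>\<^bsub>A\<^esub>), ring.zero = (\<lambda>i. \<zero>\<^bsub>A\<^esub>), ring.add = (\<lambda>f g i. f i \<oplus>\<^bsub>A\<^esub> g i)\<rparr>"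

lemma fun_ring_simps:
  "f \<in> carrier (fun_ring A) \<longleftrightarrow> (\<forall>i. f i \<in> carrier A)"
  "f \<otimes>\<^bsub>fun_ring A\<^esub> g = (\<lambda>i. f i \<otimes>\<^bsub>A\<^esub> g i)" "\<one>\<^bsub>fun_ring A\<^esub> = (\<lambda>i. \<one>\<^bsub>A\<^esub>)"
  "f \<oplus>\<^bsub>fun_ring A\<^esub> g = (\<lambda>i. f i \<oplus>\<^bsub>A\<^esub> g i)" "\<zero>\<^bsub>fun_ring A\<^esub> = (\<lambda>i. \<zero>\<^bsub>A\<^esub>)"
  by (auto simp: fun_ring_def)

lemma (in cring) fun_ring_cring: "cring (fun_ring R)"
proof (rule cringI)
  show "abelian_group (fun_ring R)"
  proof (rule abelian_groupI)
    fix f assume "f \<in> carrier (fun_ring R :: ('i \<Rightarrow> 'a) ring)"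
    then show "\<exists>g\<in>carrier (fun_ring R). g \<oplus>\<^bsub>fun_ring R\<^esub> f = \<zero>\<^bsub>fun_ring R\<^esub>"
      by (intro bexI[of _ "\<lambda>i. \<ominus> f i"]) (auto simp: fun_ring_simps l_neg)
  qed (auto simp: fun_ring_simps a_ac)
  show "comm_monoid (fun_ring R)"
    by (rule comm_monoidI) (auto simp: fun_ring_simps m_ac)
qed (auto simp: fun_ring_simps l_distr)

definition const_fun :: "'a \<Rightarrow> 'i \<Rightarrow> 'a" where
  "const_fun a = (\<lambda>_. a)"

lemma (in cring) const_fun_hom: "const_fun \<in> ring_hom R (fun_ring R)"
  by (auto simp: ring_hom_def fun_ring_simps const_fun_def)

lemma (in cring) const_fun_subfield:
  assumes "subfield K R"
  shows "subfield (const_fun ` K) (fun_ring R :: ('c \<Rightarrow> 'a) ring)"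
proof -
  interpret F: cring "fun_ring R :: ('c \<Rightarrow> 'a) ring" by (rule fun_ring_cring)
  interpret h: ring_hom_ring R "fun_ring R :: ('c \<Rightarrow> 'a) ring" const_fun
    by (rule ring_hom_ringI2[OF ring_axioms F.ring_axioms const_fun_hom])
  have "\<one>\<^bsub>fun_ring R\<^esub> \<noteq> (\<zero>\<^bsub>fun_ring R\<^esub> :: 'c \<Rightarrow> 'a)"
    using subfieldE(6)[OF assms] by (simp add: fun_ring_simps fun_eq_iff)
  then show ?thesis using h.img_is_subfield(2)[OF assms] by simp
qed

lemma (in cring) fun_ring_minus:
  assumes "f \<in> carrier (fun_ring R)"
  shows "\<ominus>\<^bsub>fun_ring R\<^esub> f = (\<lambda>i. \<ominus> f i)"
proof -
  interpret F: cring "fun_ring R" by (rule fun_ring_cring)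
  show ?thesis
    by (rule F.minus_equality) (use assms in \<open>auto simp: fun_ring_simps l_neg\<close>)
qed


text \<open>A function on lists is read as a sequence of such functions, the head of the list being
  the position. The value at \<open>[]\<close> belongs to no slice and is passed to
  \<open>glue\<close> separately.\<close>

definition slice :: "(nat list \<Rightarrow> 'a) \<Rightarrow> nat \<Rightarrow> nat list \<Rightarrow> 'a" where
  "slice f k = (\<lambda>w. f (k # w))"

definition glue :: "'a \<Rightarrow> (nat \<Rightarrow> nat list \<Rightarrow> 'a) \<Rightarrow> nat list \<Rightarrow> 'a" where
  "glue z c v = (case v of [] \<Rightarrow> z | k # w \<Rightarrow> c k w)"

lemma slice_glue [simp]: "slice (glue z c) k = c k"
  by (simp add: slice_def glue_def)

lemma glue_Nil [simp]: "glue z c [] = z"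
  by (simp add: glue_def)

lemma slices_eqI:
  assumes "f [] = g []" "\<And>k. slice f k = slice g k"
  shows "f = g"
proof
  fix v show "f v = g v"
    using assms(1) fun_cong[OF assms(2)] by (cases v) (auto simp: slice_def)
qed

section \<open>Submodules of the function ring and their direct powers\<close>

context cring
begin

abbreviation F :: "(nat list \<Rightarrow> 'a) ring" where "F \<equiv> fun_ring R"

lemma F_cring: "cring F" by (rule fun_ring_cring)

lemma F_ring: "ring F" using F_cring cring.axioms(1) by blast

text \<open>As \<open>subalgebra\<close> only demands an additive subgroup closed under the given
  scalars, it expresses the notion of a submodule when the scalars are all constants from R, which
  need not form a field.\<close>

definition submod :: "(nat list \<Rightarrow> 'a) set \<Rightarrow> bool" where
  "submod S \<longleftrightarrow> subalgebra (const_fun ` carrier R) S F"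

lemma const_F [simp]: "a \<in> carrier R \<Longrightarrow> const_fun a \<in> carrier F"
  by (simp add: fun_ring_simps const_fun_def)

lemma const_subset: "const_fun ` carrier R \<subseteq> carrier F"
  by auto

lemma submodD:
  assumes "submod S"
  shows "S \<subseteq> carrier F" "\<zero>\<^bsub>F\<^esub> \<in> S" "\<And>f g. f \<in> S \<Longrightarrow> g \<in> S \<Longrightarrow> f \<oplus>\<^bsub>F\<^esub> g \<in> S"
    "\<And>f. f \<in> S \<Longrightarrow> \<ominus>\<^bsub>F\<^esub> f \<in> S" "\<And>a f. a \<in> carrier R \<Longrightarrow> f \<in> S \<Longrightarrow> const_fun a \<otimes>\<^bsub>F\<^esub> f \<in> S"
    "\<And>f g. f \<in> S \<Longrightarrow> g \<in> S \<Longrightarrow> f \<ominus>\<^bsub>F\<^esub> g \<in> S"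
  using ring.subalgebraD[OF F_ring assms[unfolded submod_def]] by auto

lemma submodI:
  assumes "S \<subseteq> carrier F" "\<zero>\<^bsub>F\<^esub> \<in> S" "\<And>f g. f \<in> S \<Longrightarrow> g \<in> S \<Longrightarrow> f \<oplus>\<^bsub>F\<^esub> g \<in> S"
    "\<And>f. f \<in> S \<Longrightarrow> \<ominus>\<^bsub>F\<^esub> f \<in> S" "\<And>a f. a \<in> carrier R \<Longrightarrow> f \<in> S \<Longrightarrow> const_fun a \<otimes>\<^bsub>F\<^esub> f \<in> S"
  shows "submod S"
  unfolding submod_def using assms by (intro ring.subalgebraI[OF F_ring]) auto

lemma submod_add: "submod S \<Longrightarrow> submod S' \<Longrightarrow> submod (S <+>\<^bsub>F\<^esub> S')"
  unfolding submod_def by (intro ring.subalgebra_set_add[OF F_ring] const_subset)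

lemma submod_smult:
  assumes "submod S" "x \<in> carrier R"
  shows "submod ((\<lambda>f. const_fun x \<otimes>\<^bsub>F\<^esub> f) ` S)"
proof -
  interpret F: cring F by (rule F_cring)
  note S = submodD[OF assms(1)]
  note x = const_F[OF assms(2)]
  show ?thesis
  proof (rule submodI; (elim imageE)?)
    show "\<zero>\<^bsub>F\<^esub> \<in> (\<lambda>f. const_fun x \<otimes>\<^bsub>F\<^esub> f) ` S"
      using S(2) x by (intro image_eqI[of _ _ "\<zero>\<^bsub>F\<^esub>"]) auto
    fix f g p q assume "p \<in> S" "q \<in> S" "f = const_fun x \<otimes>\<^bsub>F\<^esub> p" "g = const_fun x \<otimes>\<^bsub>F\<^esub> q"
    then show "f \<oplus>\<^bsub>F\<^esub> g \<in> (\<lambda>f. const_fun x \<otimes>\<^bsub>F\<^esub> f) ` S"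
      using S(1,3) x by (intro image_eqI[of _ _ "p \<oplus>\<^bsub>F\<^esub> q"]) (auto simp: F.r_distr subset_iff)
  next
    fix f p assume "p \<in> S" "f = const_fun x \<otimes>\<^bsub>F\<^esub> p"
    then show "\<ominus>\<^bsub>F\<^esub> f \<in> (\<lambda>f. const_fun x \<otimes>\<^bsub>F\<^esub> f) ` S"
      using S(1,4) x by (intro image_eqI[of _ _ "\<ominus>\<^bsub>F\<^esub> p"]) (auto simp: F.r_minus subset_iff)
  next
    fix a f p assume "a \<in> carrier R" "p \<in> S" "f = const_fun x \<otimes>\<^bsub>F\<^esub> p"
    then show "const_fun a \<otimes>\<^bsub>F\<^esub> f \<in> (\<lambda>f. const_fun x \<otimes>\<^bsub>F\<^esub> f) ` S"
      using S(1,5) x by (intro image_eqI[of _ _ "const_fun a \<otimes>\<^bsub>F\<^esub> p"]) (auto simp: F.m_lcomm subset_iff)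
  qed (use S(1) x in auto)
qed

lemma slice_ops [simp]:
  "slice (f \<oplus>\<^bsub>F\<^esub> g) k = slice f k \<oplus>\<^bsub>F\<^esub> slice g k" "slice \<zero>\<^bsub>F\<^esub> k = \<zero>\<^bsub>F\<^esub>"
  "slice (const_fun a \<otimes>\<^bsub>F\<^esub> f) k = const_fun a \<otimes>\<^bsub>F\<^esub> slice f k"
  by (simp_all add: slice_def fun_ring_simps const_fun_def)

lemma slice_carrier [simp]: "f \<in> carrier F \<Longrightarrow> slice f k \<in> carrier F"
  by (simp add: slice_def fun_ring_simps)

lemma slice_minus [simp]: "f \<in> carrier F \<Longrightarrow> slice (\<ominus>\<^bsub>F\<^esub> f) k = \<ominus>\<^bsub>F\<^esub> slice f k"
  using fun_ring_minus[of f] fun_ring_minus[of "slice f k"] by (simp add: slice_def fun_ring_simps)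

text \<open>\<open>Glue S m\<close> is the direct power \<open>S\<^sup>m\<close>, indexed by the head of the list.  Lists as arguments
  make iterated powers live in the single ring \<open>F\<close>.\<close>

definition Glue :: "(nat list \<Rightarrow> 'a) set \<Rightarrow> nat \<Rightarrow> (nat list \<Rightarrow> 'a) set" where
  "Glue S m = {f. f [] = \<zero> \<and> (\<forall>k<m. slice f k \<in> S) \<and> (\<forall>k\<ge>m. slice f k = \<zero>\<^bsub>F\<^esub>)}"

lemma Glue_slice: "\<zero>\<^bsub>F\<^esub> \<in> S \<Longrightarrow> f \<in> Glue S m \<Longrightarrow> slice f k \<in> S"
  by (cases "k < m") (auto simp: Glue_def)

lemma Glue_carrier:
  assumes "S \<subseteq> carrier F"
  shows "Glue S m \<subseteq> carrier F"
proof
  fix f assume f: "f \<in> Glue S m"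
  have "f v \<in> carrier R" for v
  proof (cases v)
    case (Cons k w)
    have "slice f k \<in> carrier F"
      using f assms by (cases "k < m") (auto simp: Glue_def fun_ring_simps)
    then show ?thesis using Cons by (simp add: slice_def fun_ring_simps)
  qed (use f in \<open>simp add: Glue_def\<close>)
  then show "f \<in> carrier F" by (simp add: fun_ring_simps)
qed

lemma Glue_mono: "S \<subseteq> S' \<Longrightarrow> Glue S m \<subseteq> Glue S' m"
  by (auto simp: Glue_def)

lemma Glue_zero: "\<zero>\<^bsub>F\<^esub> \<in> S \<Longrightarrow> \<zero>\<^bsub>F\<^esub> \<in> Glue S m"
  by (simp add: Glue_def) (simp add: fun_ring_simps)

lemma Glue_subspace:
  assumes "subalgebra (const_fun ` C) S F" "C \<subseteq> carrier R"
  shows "subalgebra (const_fun ` C) (Glue S m) F"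
proof -
  interpret F: cring F by (rule F_cring)
  note S = F.subalgebraD[OF assms(1)]
  note G = Glue_carrier[OF S(1), of m]
  show ?thesis
  proof (rule F.subalgebraI)
    fix f assume f: "f \<in> Glue S m"
    then have "f \<in> carrier F" using G by blast
    then have "(\<ominus>\<^bsub>F\<^esub> f) [] = \<ominus> f []" using fun_ring_minus by (metis)
    then show "\<ominus>\<^bsub>F\<^esub> f \<in> Glue S m"
      using f \<open>f \<in> carrier F\<close> S(4) by (simp add: Glue_def)
  next
    fix f g assume "f \<in> Glue S m" "g \<in> Glue S m"
    moreover from this have "(f \<oplus>\<^bsub>F\<^esub> g) [] = \<zero>" by (simp add: Glue_def fun_ring_simps)
    ultimately show "f \<oplus>\<^bsub>F\<^esub> g \<in> Glue S m"
      using S(3) by (simp add: Glue_def)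
  next
    fix a f :: "nat list \<Rightarrow> 'a" assume a: "a \<in> const_fun ` C" and f: "f \<in> Glue S m"
    then obtain b where b: "a = const_fun b" "b \<in> carrier R" using assms(2) by auto
    then have "(const_fun b \<otimes>\<^bsub>F\<^esub> f) [] = \<zero>" using f by (simp add: Glue_def fun_ring_simps const_fun_def)
    then show "a \<otimes>\<^bsub>F\<^esub> f \<in> Glue S m" using a b f S(5) by (simp add: Glue_def)
  qed (use G Glue_zero S(2) in auto)
qed

lemma Glue_submod: "submod S \<Longrightarrow> submod (Glue S m)"
  unfolding submod_def by (rule Glue_subspace) auto

lemma Glue_glue:
  assumes "\<And>k. k < m \<Longrightarrow> c k \<in> S"
  shows "glue \<zero> (\<lambda>k. if k < m then c k else \<zero>\<^bsub>F\<^esub>) \<in> Glue S m"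
  using assms by (simp add: Glue_def)

lemma Glue_set_add:
  assumes "submod S" "submod S'"
  shows "Glue (S <+>\<^bsub>F\<^esub> S') m = Glue S m <+>\<^bsub>F\<^esub> Glue S' m"
proof -
  interpret F: cring F by (rule F_cring)
  show ?thesis
  proof
    show "Glue (S <+>\<^bsub>F\<^esub> S') m \<subseteq> Glue S m <+>\<^bsub>F\<^esub> Glue S' m"
    proof
      fix f assume f: "f \<in> Glue (S <+>\<^bsub>F\<^esub> S') m"
      then have "\<forall>k. \<exists>p q. k < m \<longrightarrow> p \<in> S \<and> q \<in> S' \<and> slice f k = p \<oplus>\<^bsub>F\<^esub> q"
        unfolding Glue_def F.set_add_iff by blast
      then obtain p q where pq: "\<And>k. k < m \<Longrightarrow> p k \<in> S \<and> q k \<in> S' \<and> slice f k = p k \<oplus>\<^bsub>F\<^esub> q k"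
        by metis
      let ?g = "glue \<zero> (\<lambda>k. if k < m then p k else \<zero>\<^bsub>F\<^esub>)"
      let ?h = "glue \<zero> (\<lambda>k. if k < m then q k else \<zero>\<^bsub>F\<^esub>)"
      have "f = ?g \<oplus>\<^bsub>F\<^esub> ?h"
      proof (rule slices_eqI)
        show "f [] = (?g \<oplus>\<^bsub>F\<^esub> ?h) []" using f by (simp add: Glue_def fun_ring_simps)
        show "slice f k = slice (?g \<oplus>\<^bsub>F\<^esub> ?h) k" for k
          using pq[of k] f by (auto simp: Glue_def)
      qed
      moreover have "?g \<in> Glue S m" "?h \<in> Glue S' m" using pq by (auto intro!: Glue_glue)
      ultimately show "f \<in> Glue S m <+>\<^bsub>F\<^esub> Glue S' m" unfolding F.set_add_iff by blast
    qed
    show "Glue S m <+>\<^bsub>F\<^esub> Glue S' m \<subseteq> Glue (S <+>\<^bsub>F\<^esub> S') m"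
    proof
      fix f assume "f \<in> Glue S m <+>\<^bsub>F\<^esub> Glue S' m"
      then obtain g h where gh: "g \<in> Glue S m" "h \<in> Glue S' m" "f = g \<oplus>\<^bsub>F\<^esub> h"
        unfolding F.set_add_iff by blast
      have "f [] = \<zero>" using gh by (simp add: Glue_def fun_ring_simps)
      moreover have "slice f k \<in> S <+>\<^bsub>F\<^esub> S'" if "k < m" for k
      proof -
        have "slice g k \<in> S" "slice h k \<in> S'" using gh(1,2) that by (auto simp: Glue_def)
        then show ?thesis unfolding gh(3) slice_ops F.set_add_iff by blast
      qed
      moreover have "slice f k = \<zero>\<^bsub>F\<^esub>" if "k \<ge> m" for k
        using gh that by (simp add: Glue_def)
      ultimately show "f \<in> Glue (S <+>\<^bsub>F\<^esub> S') m" by (simp add: Glue_def)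
    qed
  qed
qed

lemma Glue_smult:
  assumes "S \<subseteq> carrier F" "x \<in> carrier R"
  shows "Glue ((\<lambda>f. const_fun x \<otimes>\<^bsub>F\<^esub> f) ` S) m = (\<lambda>f. const_fun x \<otimes>\<^bsub>F\<^esub> f) ` Glue S m"
proof -
  interpret F: cring F by (rule F_cring)
  have 0: "(const_fun x \<otimes>\<^bsub>F\<^esub> f) [] = x \<otimes> f []" for f by (simp add: fun_ring_simps const_fun_def)
  show ?thesis
  proof
    show "Glue ((\<lambda>f. const_fun x \<otimes>\<^bsub>F\<^esub> f) ` S) m \<subseteq> (\<lambda>f. const_fun x \<otimes>\<^bsub>F\<^esub> f) ` Glue S m"
    proof
      fix f assume f: "f \<in> Glue ((\<lambda>f. const_fun x \<otimes>\<^bsub>F\<^esub> f) ` S) m"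
      then have "\<forall>k. \<exists>p. k < m \<longrightarrow> p \<in> S \<and> slice f k = const_fun x \<otimes>\<^bsub>F\<^esub> p"
        unfolding Glue_def by blast
      then obtain p where p: "\<And>k. k < m \<Longrightarrow> p k \<in> S \<and> slice f k = const_fun x \<otimes>\<^bsub>F\<^esub> p k" by metis
      let ?g = "glue \<zero> (\<lambda>k. if k < m then p k else \<zero>\<^bsub>F\<^esub>)"
      have "f = const_fun x \<otimes>\<^bsub>F\<^esub> ?g"
      proof (rule slices_eqI)
        show "f [] = (const_fun x \<otimes>\<^bsub>F\<^esub> ?g) []" using f assms(2) by (simp add: Glue_def 0)
        show "slice f k = slice (const_fun x \<otimes>\<^bsub>F\<^esub> ?g) k" for k
          using p[of k] f const_F[OF assms(2)] by (auto simp: Glue_def)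
      qed
      moreover have "?g \<in> Glue S m" using p by (auto intro!: Glue_glue)
      ultimately show "f \<in> (\<lambda>f. const_fun x \<otimes>\<^bsub>F\<^esub> f) ` Glue S m" by blast
    qed
    show "(\<lambda>f. const_fun x \<otimes>\<^bsub>F\<^esub> f) ` Glue S m \<subseteq> Glue ((\<lambda>f. const_fun x \<otimes>\<^bsub>F\<^esub> f) ` S) m"
      using const_F[OF assms(2)] assms(2) by (auto simp: Glue_def 0)
  qed
qed

text \<open>The power with one more factor is the direct sum of the previous one and a copy of
  \<open>S\<close> inserted at position \<open>m\<close>.\<close>

lemma dimension_Glue:
  assumes K: "subfield K R" and S: "ring.dimension F v (const_fun ` K) S"
  shows "ring.dimension F (m * v) (const_fun ` K) (Glue S m)"
proof -
  interpret F: cring F by (rule F_cring)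
  have KF: "subfield (const_fun ` K) F" using const_fun_subfield[OF K] .
  have Kc: "K \<subseteq> carrier R" using K by (simp add: subfieldE(3))
  have sS: "subalgebra (const_fun ` K) S F" using F.dimension_subalgebra[OF KF S] .
  note S' = F.subalgebraD[OF sS]
  show ?thesis
  proof (induction m)
    case 0
    have "f \<in> Glue S 0 \<longleftrightarrow> f = \<zero>\<^bsub>F\<^esub>" for f
    proof
      assume f: "f \<in> Glue S 0"
      show "f = \<zero>\<^bsub>F\<^esub>"
        by (rule slices_eqI) (use f in \<open>auto simp: Glue_def\<close>, simp add: fun_ring_simps)
    qed (use Glue_zero S'(2) in auto)
    then have "Glue S 0 = {\<zero>\<^bsub>F\<^esub>}" by blast
    then show ?case by auto
  next
    case (Suc m)
    define ins where "ins s = glue \<zero> (\<lambda>k. if k = m then s else \<zero>\<^bsub>F\<^esub>)" for s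
    have "F.dimension v (const_fun ` K) (ins ` S)"
    proof (rule dimension_inj_image[OF F.ring_axioms KF F.ring_axioms KF S, where \<sigma> = id])
      show "inj_on ins S"
      proof (rule inj_onI)
        fix s t assume "ins s = ins t"
        then have "slice (ins s) m = slice (ins t) m" by simp
        then show "s = t" by (simp add: ins_def)
      qed
      show "ins s \<in> carrier F" if "s \<in> S" for s
      proof -
        have "ins s \<in> Glue S (Suc m)"
          using that S'(2) by (auto simp: ins_def Glue_def)
        then show ?thesis using Glue_carrier[OF S'(1)] by blast
      qed
      show "ins (s \<oplus>\<^bsub>F\<^esub> t) = ins s \<oplus>\<^bsub>F\<^esub> ins t" if "s \<in> S" "t \<in> S" for s t
        by (rule slices_eqI) (auto simp: ins_def, simp add: fun_ring_simps)
      show "ins (k \<otimes>\<^bsub>F\<^esub> s) = id k \<otimes>\<^bsub>F\<^esub> ins s" if k: "k \<in> const_fun ` K" "s \<in> S" for k s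
      proof -
        obtain a where a: "k = const_fun a" "a \<in> carrier R" using k Kc by auto
        show ?thesis
          by (rule slices_eqI) (use a in \<open>auto simp: ins_def\<close>, simp add: fun_ring_simps const_fun_def)
      qed
    qed auto
    moreover have "Glue S m \<inter> ins ` S = {\<zero>\<^bsub>F\<^esub>}"
    proof
      have ins_zero: "ins \<zero>\<^bsub>F\<^esub> = \<zero>\<^bsub>F\<^esub>"
        by (rule slices_eqI) (auto simp: ins_def, simp add: fun_ring_simps)
      show "Glue S m \<inter> ins ` S \<subseteq> {\<zero>\<^bsub>F\<^esub>}"
      proof
        fix f assume "f \<in> Glue S m \<inter> ins ` S"
        then obtain s where s: "f \<in> Glue S m" "f = ins s" by blast
        then have "s = \<zero>\<^bsub>F\<^esub>" by (auto simp: Glue_def ins_def)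
        then show "f \<in> {\<zero>\<^bsub>F\<^esub>}" using s(2) ins_zero by simp
      qed
      show "{\<zero>\<^bsub>F\<^esub>} \<subseteq> Glue S m \<inter> ins ` S"
        using S'(2) Glue_zero image_eqI[of "\<zero>\<^bsub>F\<^esub>" ins "\<zero>\<^bsub>F\<^esub>" S] ins_zero by auto
    qed
    ultimately have "F.dimension (m * v + v) (const_fun ` K) (Glue S m <+>\<^bsub>F\<^esub> ins ` S)"
      by (intro F.dimension_direct_sum_space[OF KF Suc])
    moreover have "Glue S m <+>\<^bsub>F\<^esub> ins ` S = Glue S (Suc m)"
    proof
      show "Glue S m <+>\<^bsub>F\<^esub> ins ` S \<subseteq> Glue S (Suc m)"
      proof
        fix f assume "f \<in> Glue S m <+>\<^bsub>F\<^esub> ins ` S"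
        then obtain g s where g: "g \<in> Glue S m" "s \<in> S" "f = g \<oplus>\<^bsub>F\<^esub> ins s"
          unfolding F.set_add_iff by blast
        have "f [] = \<zero>" using g by (simp add: Glue_def ins_def fun_ring_simps)
        moreover have "slice f k = (if k = m then s else slice g k)" for k
        proof -
          have "slice g k \<in> carrier F" "s \<in> carrier F"
            using Glue_slice[OF S'(2) g(1)] g(2) S'(1) by auto
          then show ?thesis using g(1,3) by (auto simp: ins_def Glue_def)
        qed
        ultimately show "f \<in> Glue S (Suc m)" using g(1,2) by (auto simp: Glue_def less_Suc_eq)
      qed
      show "Glue S (Suc m) \<subseteq> Glue S m <+>\<^bsub>F\<^esub> ins ` S"
      proof
        fix f assume f: "f \<in> Glue S (Suc m)"
        let ?g = "glue \<zero> (\<lambda>k. if k < m then slice f k else \<zero>\<^bsub>F\<^esub>)"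
        have "?g \<in> Glue S m" using f by (intro Glue_glue) (auto simp: Glue_def)
        moreover have "slice f m \<in> S" using f by (simp add: Glue_def)
        moreover have "f = ?g \<oplus>\<^bsub>F\<^esub> ins (slice f m)"
        proof (rule slices_eqI)
          show "f [] = (?g \<oplus>\<^bsub>F\<^esub> ins (slice f m)) []" using f by (simp add: Glue_def ins_def fun_ring_simps)
          have "slice f k \<in> carrier F" for k using Glue_slice[OF S'(2) f] S'(1) by blast
          moreover have "slice f k = \<zero>\<^bsub>F\<^esub>" if "\<not> k < m" "k \<noteq> m" for k
            using f that by (simp add: Glue_def)
          ultimately show "slice f k = slice (?g \<oplus>\<^bsub>F\<^esub> ins (slice f m)) k" for k
            by (auto simp: ins_def)
        qed
        ultimately show "f \<in> Glue S m <+>\<^bsub>F\<^esub> ins ` S" unfolding F.set_add_iff by blast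
      qed
    qed
    ultimately show ?case by (simp add: add.commute)
  qed
qed

end


section \<open>The Toeplitz map on graded modules\<close>

locale graded_sequence = graded_generators +
  fixes xs :: "'a list"
  assumes xs_above: "set xs \<subseteq> above 1"
begin

definition pj :: "nat \<Rightarrow> (nat list \<Rightarrow> 'a) \<Rightarrow> nat list \<Rightarrow> 'a" where
  "pj i f = (\<lambda>w. proj i (f w))"

text \<open>The slices of the argument are read as the coefficients of a polynomial in z. The number
  of columns is not fixed here; it enters through the domain \<open>Glue V m\<close>.\<close>

definition toeplitz :: "(nat list \<Rightarrow> 'a) \<Rightarrow> nat list \<Rightarrow> 'a" where
  "toeplitz f = glue \<zero> (ring.conv F (\<lambda>i. const_fun (ys ! i)) (length ys) (slice f))"

definition homog :: "nat \<Rightarrow> (nat list \<Rightarrow> 'a) set" where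
  "homog i = {f. \<forall>w. f w \<in> gr i}"

abbreviation KF :: "(nat list \<Rightarrow> 'a) set" where "KF \<equiv> const_fun ` K"

lemma KF_subfield: "subfield KF F"
  using const_fun_subfield[OF K_subfield] .

lemma y_carrier: "i < length ys \<Longrightarrow> ys ! i \<in> carrier A"
  using ys_carrier nth_mem by blast

lemma yF_carrier: "i < length ys \<Longrightarrow> const_fun (ys ! i) \<in> carrier F"
  using y_carrier by simp

lemma x_carrier: "i < length xs \<Longrightarrow> xs ! i \<in> carrier A"
  using xs_above nth_mem by (fastforce simp: above_def)

lemma slice_toeplitz: "slice (toeplitz f) k = ring.conv F (\<lambda>i. const_fun (ys ! i)) (length ys) (slice f) k"
  by (simp add: toeplitz_def)

lemma toeplitz_carrier:
  assumes "f \<in> carrier F"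
  shows "toeplitz f \<in> carrier F"
proof -
  have "toeplitz f v \<in> carrier A" for v
  proof (cases v)
    case (Cons k w)
    have "slice (toeplitz f) k \<in> carrier F"
      unfolding slice_toeplitz using cring.conv_carrier[OF F_cring] yF_carrier assms by simp
    then show ?thesis using Cons by (simp add: slice_def fun_ring_simps)
  qed (simp add: toeplitz_def)
  then show ?thesis by (simp add: fun_ring_simps)
qed

lemma toeplitz_add:
  assumes "f \<in> carrier F" "g \<in> carrier F"
  shows "toeplitz (f \<oplus>\<^bsub>F\<^esub> g) = toeplitz f \<oplus>\<^bsub>F\<^esub> toeplitz g"
proof (rule slices_eqI)
  interpret F: cring F by (rule F_cring)
  show "toeplitz (f \<oplus>\<^bsub>F\<^esub> g) [] = (toeplitz f \<oplus>\<^bsub>F\<^esub> toeplitz g) []"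
    by (simp add: toeplitz_def fun_ring_simps)
  have "slice (f \<oplus>\<^bsub>F\<^esub> g) = (\<lambda>k. slice f k \<oplus>\<^bsub>F\<^esub> slice g k)" by (rule ext) simp
  then show "slice (toeplitz (f \<oplus>\<^bsub>F\<^esub> g)) k = slice (toeplitz f \<oplus>\<^bsub>F\<^esub> toeplitz g) k" for k
    using assms yF_carrier by (simp add: slice_toeplitz F.conv_add)
qed

lemma toeplitz_smult:
  assumes "f \<in> carrier F" "a \<in> carrier A"
  shows "toeplitz (const_fun a \<otimes>\<^bsub>F\<^esub> f) = const_fun a \<otimes>\<^bsub>F\<^esub> toeplitz f"
proof (rule slices_eqI)
  interpret F: cring F by (rule F_cring)
  show "toeplitz (const_fun a \<otimes>\<^bsub>F\<^esub> f) [] = (const_fun a \<otimes>\<^bsub>F\<^esub> toeplitz f) []"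
    using assms(2) by (simp add: toeplitz_def fun_ring_simps const_fun_def)
  have "slice (const_fun a \<otimes>\<^bsub>F\<^esub> f) = (\<lambda>k. const_fun a \<otimes>\<^bsub>F\<^esub> slice f k)" by (rule ext) simp
  then show "slice (toeplitz (const_fun a \<otimes>\<^bsub>F\<^esub> f)) k = slice (const_fun a \<otimes>\<^bsub>F\<^esub> toeplitz f) k" for k
    using assms yF_carrier by (simp add: slice_toeplitz F.conv_smult)
qed

lemma toeplitz_zero: "toeplitz \<zero>\<^bsub>F\<^esub> = \<zero>\<^bsub>F\<^esub>"
proof -
  interpret F: cring F by (rule F_cring)
  have "const_fun \<zero> \<otimes>\<^bsub>F\<^esub> f = \<zero>\<^bsub>F\<^esub>" if "f \<in> carrier F" for f
    using that by (simp add: fun_ring_simps const_fun_def)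
  then show ?thesis using toeplitz_smult[of "\<zero>\<^bsub>F\<^esub>" \<zero>] toeplitz_carrier[of "\<zero>\<^bsub>F\<^esub>"] by simp
qed

lemma toeplitz_Glue:
  assumes S: "submod S" and f: "f \<in> Glue S m"
  shows "toeplitz f \<in> Glue S (m + length ys)"
proof -
  interpret F: cring F by (rule F_cring)
  have "slice f k \<in> S" for k using Glue_slice[OF submodD(2)[OF S] f] .
  then have "slice (toeplitz f) k \<in> S" for k
    unfolding slice_toeplitz using y_carrier
    by (intro F.conv_subspace[OF S[unfolded submod_def]]) auto
  moreover have "slice (toeplitz f) k = \<zero>\<^bsub>F\<^esub>" if "k \<ge> m + length ys" for k
    unfolding slice_toeplitz by (rule F.conv_eq_zero[of _ _ m]) (use that f yF_carrier in \<open>auto simp: Glue_def\<close>)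
  ultimately show ?thesis by (simp add: Glue_def toeplitz_def)
qed

text \<open>The ring elements that carry \<open>v\<close> into \<open>N\<close> form an ideal. If it
  contains all of \<open>ys\<close>, it contains the irrelevant ideal and hence \<open>x\<close>,
  and regularity of \<open>x\<close> puts \<open>v\<close> into \<open>N\<close>. This is the
  condition under which McCoy's argument works; \<open>x\<close> may be inhomogeneous.\<close>

lemma toeplitz_injective_modulo:
  assumes N: "submod N" and V: "submod V" and x: "x \<in> above 1"
    and regular: "\<And>v. v \<in> V \<Longrightarrow> const_fun x \<otimes>\<^bsub>F\<^esub> v \<in> N \<Longrightarrow> v \<in> N"
    and f: "f \<in> Glue V m" "\<And>k. slice (toeplitz f) k \<in> N"
  shows "f \<in> Glue N m"
proof -
  interpret F: cring F by (rule F_cring)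
  note N' = submodD[OF N] and V' = submodD[OF V]
  have socle: "v \<in> N" if v: "v \<in> V" "\<And>i. i < length ys \<Longrightarrow> const_fun (ys ! i) \<otimes>\<^bsub>F\<^esub> v \<in> N" for v
  proof -
    define J where "J = {a \<in> carrier A. const_fun a \<otimes>\<^bsub>F\<^esub> v \<in> N}"
    have vc: "v \<in> carrier F" using v V'(1) by blast
    have ops: "const_fun (a \<oplus> b) \<otimes>\<^bsub>F\<^esub> v = const_fun a \<otimes>\<^bsub>F\<^esub> v \<oplus>\<^bsub>F\<^esub> const_fun b \<otimes>\<^bsub>F\<^esub> v"
      "const_fun (a \<otimes> b) \<otimes>\<^bsub>F\<^esub> v = const_fun a \<otimes>\<^bsub>F\<^esub> (const_fun b \<otimes>\<^bsub>F\<^esub> v)"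
      "const_fun (\<ominus> a) \<otimes>\<^bsub>F\<^esub> v = \<ominus>\<^bsub>F\<^esub> (const_fun a \<otimes>\<^bsub>F\<^esub> v)"
      if "a \<in> carrier A" "b \<in> carrier A" for a b
    proof -
      show "const_fun (a \<oplus> b) \<otimes>\<^bsub>F\<^esub> v = const_fun a \<otimes>\<^bsub>F\<^esub> v \<oplus>\<^bsub>F\<^esub> const_fun b \<otimes>\<^bsub>F\<^esub> v"
        "const_fun (a \<otimes> b) \<otimes>\<^bsub>F\<^esub> v = const_fun a \<otimes>\<^bsub>F\<^esub> (const_fun b \<otimes>\<^bsub>F\<^esub> v)"
        using that vc by (auto simp: fun_ring_simps const_fun_def l_distr m_assoc)
      show "const_fun (\<ominus> a) \<otimes>\<^bsub>F\<^esub> v = \<ominus>\<^bsub>F\<^esub> (const_fun a \<otimes>\<^bsub>F\<^esub> v)"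
        using fun_ring_minus[of "const_fun a \<otimes>\<^bsub>F\<^esub> v"] that vc
        by (auto simp: fun_ring_simps const_fun_def l_minus)
    qed
    have "const_fun \<zero> \<otimes>\<^bsub>F\<^esub> v = \<zero>\<^bsub>F\<^esub>" using vc by (simp add: fun_ring_simps const_fun_def)
    then have sub: "subgroup J (add_monoid A)"
      by (intro add.subgroupI) (use N'(2-4) ops in \<open>auto simp: J_def a_inv_def[symmetric]\<close>)
    have mult: "r \<otimes> a \<in> J" if "a \<in> J" "r \<in> carrier A" for a r
      using that N'(5)[of r] ops(2)[of r a] by (simp add: J_def)
    have "ideal J A"
    proof (rule idealI[OF ring_axioms sub])
      show "r \<otimes> a \<in> J" "a \<otimes> r \<in> J" if "a \<in> J" "r \<in> carrier A" for a r
        using mult[OF that] m_comm[of a r] that by (simp_all add: J_def)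
    qed
    moreover have "set ys \<subseteq> J"
      using v(2) ys_carrier by (auto simp: J_def in_set_conv_nth)
    ultimately have "x \<in> J" using irrelevant_subset x by blast
    then show ?thesis using regular[OF v(1)] by (simp add: J_def)
  qed
  have "slice f k \<in> N" for k
  proof (rule F.conv_injective_modulo[OF N[unfolded submod_def] V[unfolded submod_def] const_subset])
    show "F.conv (\<lambda>i. const_fun (ys ! i)) (length ys) (slice f) k \<in> N" for k
      using f(2)[of k] by (simp add: slice_toeplitz)
    show "slice f k \<in> V" for k using Glue_slice[OF V'(2) f(1)] .
    show "slice f k \<in> N" if "k \<ge> m" for k using f(1) that N'(2) by (simp add: Glue_def)
  qed (use socle y_carrier in auto)
  then show ?thesis using f(1) by (simp add: Glue_def)
qed

lemma pj_ops:
  assumes "f \<in> carrier F" "g \<in> carrier F"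
  shows "pj i (f \<oplus>\<^bsub>F\<^esub> g) = pj i f \<oplus>\<^bsub>F\<^esub> pj i g" "pj i f \<in> carrier F" "slice (pj i f) k = pj i (slice f k)"
    "pj i \<zero>\<^bsub>F\<^esub> = \<zero>\<^bsub>F\<^esub>"
  using assms by (auto simp: pj_def fun_ring_simps proj_add proj_carrier slice_def proj_zero)

lemma pj_homog: "f \<in> homog i \<Longrightarrow> pj i f = f"
  by (rule ext) (auto simp: pj_def homog_def intro: proj_of_gr[THEN trans])

lemma pj_in_homog: "f \<in> carrier F \<Longrightarrow> pj i f \<in> homog i"
  by (auto simp: pj_def homog_def proj_gr fun_ring_simps)

lemma homog_carrier: "homog i \<subseteq> carrier F"
  unfolding homog_def subset_iff mem_Collect_eq fun_ring_simps(1) using gr_carrier by blast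

lemma slice_homog: "f \<in> homog i \<Longrightarrow> slice f k \<in> homog i"
  by (auto simp: slice_def homog_def)

lemma Glue_homog: "Glue (S \<inter> homog i) m = Glue S m \<inter> homog i"
proof
  show "Glue S m \<inter> homog i \<subseteq> Glue (S \<inter> homog i) m"
    using slice_homog by (auto simp: Glue_def)
  show "Glue (S \<inter> homog i) m \<subseteq> Glue S m \<inter> homog i"
  proof
    fix f assume f: "f \<in> Glue (S \<inter> homog i) m"
    have "f v \<in> gr i" for v
    proof (cases v)
      case (Cons k w)
      have "slice f k \<in> homog i"
        using f gr_D(2) by (cases "k < m") (auto simp: Glue_def homog_def fun_ring_simps)
      then show ?thesis using Cons by (simp add: slice_def homog_def)
    qed (use f gr_D(2) in \<open>simp add: Glue_def\<close>)
    then show "f \<in> Glue S m \<inter> homog i" using f by (auto simp: Glue_def homog_def)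
  qed
qed

lemma pj_Glue:
  assumes "S \<subseteq> carrier F" "\<And>f. f \<in> S \<Longrightarrow> pj i f \<in> S" "f \<in> Glue S m"
  shows "pj i f \<in> Glue S m"
proof -
  have f: "f \<in> carrier F" using Glue_carrier[OF assms(1)] assms(3) by blast
  have "slice (pj i f) k = pj i (slice f k)" for k using pj_ops(3)[OF f f] .
  moreover have "pj i f [] = \<zero>" using assms(3) by (simp add: Glue_def pj_def proj_zero)
  ultimately show ?thesis
    using assms(2,3) pj_ops(4)[OF f f] by (simp add: Glue_def)
qed

text \<open>All entries of the matrix have degree 1, so degrees rise by one. Nothing lands in degree
  0, which has to be singled out because \<open>i - 1\<close> is 0 there.\<close>

lemma pj_toeplitz:
  assumes f: "f \<in> carrier F"
  shows "pj i (toeplitz f) = (if i = 0 then \<zero>\<^bsub>F\<^esub> else toeplitz (pj (i - 1) f))"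
proof (rule slices_eqI)
  interpret F: cring F by (rule F_cring)
  show "pj i (toeplitz f) [] = (if i = 0 then \<zero>\<^bsub>F\<^esub> else toeplitz (pj (i - 1) f)) []"
    by (simp add: pj_def toeplitz_def proj_zero fun_ring_simps)
  have mult: "pj i (const_fun y \<otimes>\<^bsub>F\<^esub> g) = (if i = 0 then \<zero>\<^bsub>F\<^esub> else const_fun y \<otimes>\<^bsub>F\<^esub> pj (i - 1) g)"
    if "y \<in> gr 1" "g \<in> carrier F" for y g
    using that proj_mult_gr[OF that(1), of _ i] by (auto simp: pj_def fun_ring_simps const_fun_def)
  fix k
  have "pj i (F.conv (\<lambda>i. const_fun (ys ! i)) n (slice f) k) =
      (if i = 0 then \<zero>\<^bsub>F\<^esub> else F.conv (\<lambda>i. const_fun (ys ! i)) n (slice (pj (i - 1) f)) k)"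
    if "n \<le> length ys" for n
    using that
  proof (induction n)
    case 0
    then show ?case using pj_ops(4)[OF f f] by simp
  next
    case (Suc n)
    let ?t = "if n \<le> k then const_fun (ys ! n) \<otimes>\<^bsub>F\<^esub> slice f (k - n) else \<zero>\<^bsub>F\<^esub>"
    have y: "ys ! n \<in> gr 1" "ys ! n \<in> carrier A"
      using Suc.prems ys_gr y_carrier[of n] nth_mem[of n ys] by auto
    have c: "F.conv (\<lambda>i. const_fun (ys ! i)) n (slice f) k \<in> carrier F" "?t \<in> carrier F"
      using Suc.prems f yF_carrier y by (auto intro!: F.conv_carrier)
    have "pj i ?t = (if i = 0 then \<zero>\<^bsub>F\<^esub> else if n \<le> k then const_fun (ys ! n) \<otimes>\<^bsub>F\<^esub> slice (pj (i - 1) f) (k - n) else \<zero>\<^bsub>F\<^esub>)"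
      using mult[OF y(1), of "slice f (k - n)"] f pj_ops(3,4)[OF f f] by (cases "i = 0") auto
    then show ?case using Suc pj_ops(1)[OF c] by simp
  qed
  then show "slice (pj i (toeplitz f)) k = slice (if i = 0 then \<zero>\<^bsub>F\<^esub> else toeplitz (pj (i - 1) f)) k"
    using pj_ops(3)[OF toeplitz_carrier[OF f] f] by (simp add: slice_toeplitz)
qed

text \<open>In usual notation I + (x_0, ..., x_(i-1)) V. This need not be graded, which is why
  dimensions are only counted for \<open>V\<close> and \<open>I\<close> themselves.\<close>

primrec extend :: "(nat list \<Rightarrow> 'a) set \<Rightarrow> (nat list \<Rightarrow> 'a) set \<Rightarrow> nat \<Rightarrow> (nat list \<Rightarrow> 'a) set" where
  "extend I V 0 = I"
| "extend I V (Suc i) = extend I V i <+>\<^bsub>F\<^esub> (\<lambda>f. const_fun (xs ! i) \<otimes>\<^bsub>F\<^esub> f) ` V"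

lemma extend_submod:
  assumes "submod I" "submod V" "i \<le> length xs"
  shows "submod (extend I V i)"
  using assms(3)
proof (induction i)
  case (Suc i)
  then show ?case using submod_add submod_smult assms x_carrier by simp
qed (use assms in simp)

text \<open>\<open>V\<close> and \<open>I\<close> stand for the graded module \<open>V / I\<close> with Hilbert function \<open>H\<close>, on which the first
  \<open>d\<close> elements of \<open>xs\<close> form a regular sequence.\<close>

definition stage :: "nat \<Rightarrow> (nat list \<Rightarrow> 'a) set \<Rightarrow> (nat list \<Rightarrow> 'a) set \<Rightarrow> (nat \<Rightarrow> rat) \<Rightarrow> bool" where
  "stage d V I H \<longleftrightarrow> submod V \<and> submod I \<and> I \<subseteq> V \<and> (\<forall>i. \<forall>f\<in>V. pj i f \<in> V) \<and> (\<forall>i. \<forall>f\<in>I. pj i f \<in> I) \<and>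
     (\<forall>i<d. \<forall>f\<in>V. const_fun (xs ! i) \<otimes>\<^bsub>F\<^esub> f \<in> extend I V i \<longrightarrow> f \<in> extend I V i) \<and>
     (\<forall>i. \<exists>v u. ring.dimension F v KF (V \<inter> homog i) \<and> ring.dimension F u KF (I \<inter> homog i) \<and>
       H i = of_nat v - of_nat u)"

text \<open>\<open>Glue\<close> commutes with sums and with multiplication by a ring element. Hence
  the cokernel modulo x_0, ..., x_(i-1) is again a cokernel of the Toeplitz map, with
  \<open>extend I V i\<close> in place of \<open>I\<close>.\<close>

lemma extend_next:
  assumes V: "submod V" and I: "submod I" and i: "i \<le> length xs"
  shows "extend (Glue I (m + length ys) <+>\<^bsub>F\<^esub> toeplitz ` Glue V m) (Glue V (m + length ys)) i =
    Glue (extend I V i) (m + length ys) <+>\<^bsub>F\<^esub> toeplitz ` Glue V m"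
  using i
proof (induction i)
  case (Suc i)
  interpret F: cring F by (rule F_cring)
  let ?n = "m + length ys" and ?T = "toeplitz ` Glue V m" and ?E = "extend I V i"
    and ?x = "\<lambda>f. const_fun (xs ! i) \<otimes>\<^bsub>F\<^esub> f"
  have x: "xs ! i \<in> carrier A" using Suc.prems x_carrier by simp
  have E: "submod ?E" using extend_submod[OF I V] Suc.prems by simp
  have eq: "Glue (?E <+>\<^bsub>F\<^esub> ?x ` V) ?n = Glue ?E ?n <+>\<^bsub>F\<^esub> ?x ` Glue V ?n"
    using Glue_set_add[OF E submod_smult[OF V x]] Glue_smult[OF submodD(1)[OF V] x] by simp
  have c: "Glue ?E ?n \<subseteq> carrier F" "?x ` Glue V ?n \<subseteq> carrier F" "?T \<subseteq> carrier F"
    using Glue_carrier[OF submodD(1)] E V submod_smult[OF Glue_submod[OF V] x, THEN submodD(1)] toeplitz_carrier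
    by blast+
  have swap: "(P <+>\<^bsub>F\<^esub> Q) <+>\<^bsub>F\<^esub> S \<subseteq> (P <+>\<^bsub>F\<^esub> S) <+>\<^bsub>F\<^esub> Q"
    if "P \<subseteq> carrier F" "Q \<subseteq> carrier F" "S \<subseteq> carrier F" for P Q S
  proof
    fix z assume "z \<in> (P <+>\<^bsub>F\<^esub> Q) <+>\<^bsub>F\<^esub> S"
    then obtain p q s where pqs: "p \<in> P" "q \<in> Q" "s \<in> S" "z = (p \<oplus>\<^bsub>F\<^esub> q) \<oplus>\<^bsub>F\<^esub> s"
      unfolding F.set_add_iff Bex_def by blast
    then have "z = (p \<oplus>\<^bsub>F\<^esub> s) \<oplus>\<^bsub>F\<^esub> q" using that by (simp add: F.a_ac subset_iff)
    then show "z \<in> (P <+>\<^bsub>F\<^esub> S) <+>\<^bsub>F\<^esub> Q" using pqs(1-3) unfolding F.set_add_iff Bex_def by blast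
  qed
  show ?case
    using swap[OF c(1,3,2)] swap[OF c] Suc by (simp add: eq)
qed simp

text \<open>A diagram chase. Write x for \<open>xs ! i\<close>, E for \<open>extend I V i\<close>
  and T for the Toeplitz map. Regularity of x passes from V modulo E to the cokernel of T because T
  is injective modulo E and x; there \<open>xs ! Suc i\<close> is the regular element that McCoy's
  argument needs.\<close>

lemma stage_regular_next:
  assumes st: "stage (Suc d) V I H" and d: "Suc d \<le> length xs" and i: "i < d"
    and f: "f \<in> Glue V (m + length ys)"
    and xf: "const_fun (xs ! i) \<otimes>\<^bsub>F\<^esub> f \<in> Glue (extend I V i) (m + length ys) <+>\<^bsub>F\<^esub> toeplitz ` Glue V m"
  shows "f \<in> Glue (extend I V i) (m + length ys) <+>\<^bsub>F\<^esub> toeplitz ` Glue V m"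
proof -
  interpret F: cring F by (rule F_cring)
  have V: "submod V" and I: "submod I" and IV: "I \<subseteq> V"
    and reg: "\<And>j v. j < Suc d \<Longrightarrow> v \<in> V \<Longrightarrow> const_fun (xs ! j) \<otimes>\<^bsub>F\<^esub> v \<in> extend I V j \<Longrightarrow> v \<in> extend I V j"
    using st unfolding stage_def by blast+
  let ?n = "m + length ys" and ?E = "extend I V i" and ?x = "const_fun (xs ! i)"
  have x: "xs ! i \<in> carrier A" "?x \<in> carrier F" using i d x_carrier by simp_all
  have E: "submod ?E" and E': "submod (extend I V (Suc i))"
    using extend_submod[OF I V] i d by (simp_all del: extend.simps)
  note GE = submodD[OF Glue_submod[OF E, of ?n]]
  have GV: "Glue V k \<subseteq> carrier F" for k using Glue_carrier[OF submodD(1)[OF V]] .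
  obtain p g where p: "p \<in> Glue ?E ?n" and g: "g \<in> Glue V m" and pg: "?x \<otimes>\<^bsub>F\<^esub> f = p \<oplus>\<^bsub>F\<^esub> toeplitz g"
    using xf unfolding F.set_add_iff by blast
  have c: "f \<in> carrier F" "p \<in> carrier F" "g \<in> carrier F" "toeplitz g \<in> carrier F"
    using f p g GV GE(1) toeplitz_carrier by auto
  have "toeplitz g = \<ominus>\<^bsub>F\<^esub> p \<oplus>\<^bsub>F\<^esub> ?x \<otimes>\<^bsub>F\<^esub> f"
    using pg c by (simp add: F.r_neg1)
  moreover have "\<ominus>\<^bsub>F\<^esub> p \<in> Glue ?E ?n" using GE(4) p .
  moreover have "?x \<otimes>\<^bsub>F\<^esub> f \<in> (\<lambda>f. ?x \<otimes>\<^bsub>F\<^esub> f) ` Glue V ?n" using f by blast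
  ultimately have "toeplitz g \<in> Glue ?E ?n <+>\<^bsub>F\<^esub> (\<lambda>f. ?x \<otimes>\<^bsub>F\<^esub> f) ` Glue V ?n"
    unfolding F.set_add_iff by blast
  \<comment> \<open>The relation x f = p + T g shows that T g vanishes modulo E and x.\<close>
  then have Tg: "toeplitz g \<in> Glue (extend I V (Suc i)) ?n"
    using Glue_set_add[OF E submod_smult[OF V x(1)]] Glue_smult[OF submodD(1)[OF V] x(1)] by simp
  have "g \<in> Glue (extend I V (Suc i)) m"
  proof (rule toeplitz_injective_modulo[OF E' V])
    show "xs ! Suc i \<in> above 1" using xs_above i d nth_mem[of "Suc i" xs] by auto
    show "v \<in> extend I V (Suc i)" if "v \<in> V" "const_fun (xs ! Suc i) \<otimes>\<^bsub>F\<^esub> v \<in> extend I V (Suc i)" for v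
      using reg[of "Suc i" v] i that by (simp del: extend.simps)
    show "slice (toeplitz g) k \<in> extend I V (Suc i)" for k
      using Glue_slice[OF submodD(2)[OF E'] Tg] .
  qed (rule g)
  \<comment> \<open>Injectivity yields g = g0 + x g1. Then x (f - T g1) lies in the power of E, x
    can be cancelled entry by entry, and f agrees with T g1 modulo E.\<close>
  then have "g \<in> Glue ?E m <+>\<^bsub>F\<^esub> (\<lambda>f. ?x \<otimes>\<^bsub>F\<^esub> f) ` Glue V m"
    using Glue_set_add[OF E submod_smult[OF V x(1)]] Glue_smult[OF submodD(1)[OF V] x(1)] by simp
  then obtain g0 g1 where g0: "g0 \<in> Glue ?E m" and g1: "g1 \<in> Glue V m" and gg: "g = g0 \<oplus>\<^bsub>F\<^esub> ?x \<otimes>\<^bsub>F\<^esub> g1"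
    unfolding F.set_add_iff by blast
  have c': "g0 \<in> carrier F" "g1 \<in> carrier F" "toeplitz g0 \<in> carrier F" "toeplitz g1 \<in> carrier F"
    using g0 g1 GV submodD(1)[OF Glue_submod[OF E]] toeplitz_carrier by blast+
  let ?q = "f \<ominus>\<^bsub>F\<^esub> toeplitz g1"
  have Tg1: "toeplitz g1 \<in> Glue V ?n" using toeplitz_Glue[OF V g1] .
  have q: "?q \<in> Glue V ?n" using submodD(6)[OF Glue_submod[OF V] f Tg1] .
  have "toeplitz g = toeplitz g0 \<oplus>\<^bsub>F\<^esub> ?x \<otimes>\<^bsub>F\<^esub> toeplitz g1"
    using toeplitz_add[of g0 "?x \<otimes>\<^bsub>F\<^esub> g1"] toeplitz_smult[of g1 "xs ! i"] c' x gg by simp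
  then have "?x \<otimes>\<^bsub>F\<^esub> ?q = p \<oplus>\<^bsub>F\<^esub> toeplitz g0"
    using pg c c' x(2)
    by (simp add: F.minus_eq F.r_distr F.r_minus F.a_assoc F.r_neg)
  also have "\<dots> \<in> Glue ?E ?n" using GE(3)[OF p toeplitz_Glue[OF E g0]] .
  finally have xq: "?x \<otimes>\<^bsub>F\<^esub> ?q \<in> Glue ?E ?n" .
  have "slice ?q k \<in> ?E" for k
  proof (rule reg)
    show "slice ?q k \<in> V" using Glue_slice[OF submodD(2)[OF V] q] .
    show "?x \<otimes>\<^bsub>F\<^esub> slice ?q k \<in> ?E" using Glue_slice[OF submodD(2)[OF E] xq, of k] by simp
  qed (use i in simp)
  then have "?q \<in> Glue ?E ?n" using q by (simp add: Glue_def)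
  moreover have "f = ?q \<oplus>\<^bsub>F\<^esub> toeplitz g1" using c c' by (simp add: F.minus_eq F.a_assoc F.l_neg)
  ultimately show ?thesis using g1 unfolding F.set_add_iff by blast
qed

text \<open>Both summands are graded and the Toeplitz map raises degrees by one, so projecting a
  representation to degree \<open>i\<close> gives one by homogeneous elements. In degree 0 the image
  contributes nothing.\<close>

lemma homog_next:
  assumes V: "submod V" "\<And>i f. f \<in> V \<Longrightarrow> pj i f \<in> V" and I: "submod I" "\<And>i f. f \<in> I \<Longrightarrow> pj i f \<in> I"
  shows "(Glue I k <+>\<^bsub>F\<^esub> toeplitz ` Glue V m) \<inter> homog i =
    (if i = 0 then Glue (I \<inter> homog 0) k
     else Glue (I \<inter> homog i) k <+>\<^bsub>F\<^esub> toeplitz ` Glue (V \<inter> homog (i - 1)) m)" (is "?L = ?R")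
    and "f \<in> Glue I k <+>\<^bsub>F\<^esub> toeplitz ` Glue V m \<Longrightarrow> pj i f \<in> Glue I k <+>\<^bsub>F\<^esub> toeplitz ` Glue V m"
proof -
  interpret F: cring F by (rule F_cring)
  have GV: "Glue V m \<subseteq> carrier F" using Glue_carrier[OF submodD(1)[OF V(1)]] .
  have GI: "Glue I k \<subseteq> carrier F" using Glue_carrier[OF submodD(1)[OF I(1)]] .
  have z: "\<zero>\<^bsub>F\<^esub> \<in> Glue V m" "\<zero>\<^bsub>F\<^esub> \<in> Glue I k" using Glue_zero submodD(2) V I by auto
  have T0: "Glue I k \<subseteq> Glue I k <+>\<^bsub>F\<^esub> toeplitz ` Glue V m"
  proof
    fix p assume "p \<in> Glue I k"
    moreover from this have "p = p \<oplus>\<^bsub>F\<^esub> toeplitz \<zero>\<^bsub>F\<^esub>" using GI by (auto simp: toeplitz_zero)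
    ultimately show "p \<in> Glue I k <+>\<^bsub>F\<^esub> toeplitz ` Glue V m" using z unfolding F.set_add_iff by blast
  qed
  have pjR: "pj i f \<in> ?R" if f: "f \<in> Glue I k <+>\<^bsub>F\<^esub> toeplitz ` Glue V m" for f
  proof -
    obtain p g where pg: "p \<in> Glue I k" "g \<in> Glue V m" "f = p \<oplus>\<^bsub>F\<^esub> toeplitz g"
      using f unfolding F.set_add_iff by blast
    have c: "p \<in> carrier F" "g \<in> carrier F" "toeplitz g \<in> carrier F" using pg GV GI toeplitz_carrier by blast+
    have p: "pj i p \<in> Glue (I \<inter> homog i) k"
      unfolding Glue_homog using pj_Glue[OF submodD(1)[OF I(1)] I(2) pg(1)] pj_in_homog[OF c(1)] by blast
    have g: "pj (i - 1) g \<in> Glue (V \<inter> homog (i - 1)) m"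
      unfolding Glue_homog using pj_Glue[OF submodD(1)[OF V(1)] V(2) pg(2)] pj_in_homog[OF c(2)] by blast
    have eq: "pj i f = pj i p \<oplus>\<^bsub>F\<^esub> (if i = 0 then \<zero>\<^bsub>F\<^esub> else toeplitz (pj (i - 1) g))"
      unfolding pg(3) using pj_ops(1)[OF c(1,3)] pj_toeplitz[OF c(2)] by simp
    show ?thesis
    proof (cases "i = 0")
      case True
      then show ?thesis using eq p pj_ops(2)[OF c(1,1)] by simp
    next
      case False
      have "pj i f = pj i p \<oplus>\<^bsub>F\<^esub> toeplitz (pj (i - 1) g)" using eq False by simp
      then have "pj i f \<in> Glue (I \<inter> homog i) k <+>\<^bsub>F\<^esub> toeplitz ` Glue (V \<inter> homog (i - 1)) m"
        using p g unfolding F.set_add_iff by blast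
      then show ?thesis using False by simp
    qed
  qed
  have RL: "?R \<subseteq> ?L"
  proof
    fix f assume f: "f \<in> ?R"
    show "f \<in> ?L"
    proof (cases "i = 0")
      case True
      then show ?thesis using f T0 by (auto simp: Glue_homog)
    next
      case False
      then have "f \<in> Glue (I \<inter> homog i) k <+>\<^bsub>F\<^esub> toeplitz ` Glue (V \<inter> homog (i - 1)) m"
        using f by simp
      then obtain p g where pg: "p \<in> Glue (I \<inter> homog i) k" "g \<in> Glue (V \<inter> homog (i - 1)) m" "f = p \<oplus>\<^bsub>F\<^esub> toeplitz g"
        unfolding F.set_add_iff by blast
      have gh: "g \<in> homog (i - 1)" "g \<in> Glue V m" "p \<in> homog i" "p \<in> Glue I k" using pg(1,2) by (auto simp: Glue_homog)
      have c: "p \<in> carrier F" "g \<in> carrier F" "toeplitz g \<in> carrier F"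
        using gh homog_carrier toeplitz_carrier by blast+
      have "toeplitz g = pj i (toeplitz g)"
        using pj_toeplitz[OF c(2), of i] pj_homog[OF gh(1)] False by simp
      then have "pj i f = f"
        unfolding pg(3) using pj_ops(1)[OF c(1,3), of i] pj_homog[OF gh(3)] by simp
      moreover have fc: "f \<in> carrier F" using pg(3) c by simp
      ultimately have "f \<in> homog i" using pj_in_homog[OF fc, of i] by simp
      then show ?thesis using pg(3) gh unfolding Int_iff F.set_add_iff by blast
    qed
  qed
  show "?L = ?R"
  proof
    show "?L \<subseteq> ?R"
    proof
      fix f assume "f \<in> ?L"
      then show "f \<in> ?R" using pjR[of f] pj_homog[of f i] by simp
    qed
  qed (rule RL)
  show "f \<in> Glue I k <+>\<^bsub>F\<^esub> toeplitz ` Glue V m \<Longrightarrow> pj i f \<in> Glue I k <+>\<^bsub>F\<^esub> toeplitz ` Glue V m"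
    using pjR[of f] RL by blast
qed

end


lemma (in cring) Idl_insert:
  assumes "S \<subseteq> carrier R" "x \<in> carrier R"
  shows "Idl (insert x S) = Idl S <+>\<^bsub>R\<^esub> PIdl x"
proof
  have I: "ideal (Idl S <+>\<^bsub>R\<^esub> PIdl x) R"
    using add_ideals[OF genideal_ideal[OF assms(1)] cgenideal_ideal[OF assms(2)]] .
  have z: "\<zero> \<in> Idl S" "\<zero> \<in> PIdl x"
    using genideal_ideal[OF assms(1)] cgenideal_ideal[OF assms(2)]
    by (auto simp: ideal_def additive_subgroup.zero_closed)
  have "insert x S \<subseteq> Idl S <+>\<^bsub>R\<^esub> PIdl x"
  proof
    fix y assume y: "y \<in> insert x S"
    then have c: "y \<in> carrier R" using assms by auto
    then have "y = y \<oplus> \<zero>" "y = \<zero> \<oplus> y" by auto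
    then show "y \<in> Idl S <+>\<^bsub>R\<^esub> PIdl x"
      using y z genideal_self[OF assms(1)] cgenideal_self[OF assms(2)] unfolding set_add_iff by blast
  qed
  then show "Idl (insert x S) \<subseteq> Idl S <+>\<^bsub>R\<^esub> PIdl x"
    by (rule genideal_minimal[OF I])
  have c: "insert x S \<subseteq> carrier R" using assms by auto
  interpret J: ideal "Idl (insert x S)" R by (rule genideal_ideal[OF c])
  have "Idl S \<subseteq> Idl (insert x S)"
    by (rule genideal_minimal[OF J.is_ideal]) (use genideal_self[OF c] in blast)
  moreover have "PIdl x \<subseteq> Idl (insert x S)"
    by (rule cgenideal_minimal[OF J.is_ideal]) (use genideal_self[OF c] in blast)
  ultimately show "Idl S <+>\<^bsub>R\<^esub> PIdl x \<subseteq> Idl (insert x S)"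
    using J.a_closed unfolding subset_iff set_add_iff by blast
qed

section \<open>Hilbert functions along the Toeplitz steps\<close>

context graded_sequence
begin

lemma toeplitz_image_submod:
  assumes "submod S"
  shows "submod (toeplitz ` S)"
proof -
  note S = submodD[OF assms]
  interpret F: cring F by (rule F_cring)
  have minus: "toeplitz (\<ominus>\<^bsub>F\<^esub> p) = \<ominus>\<^bsub>F\<^esub> toeplitz p" if "p \<in> carrier F" for p
  proof -
    have "toeplitz (\<ominus>\<^bsub>F\<^esub> p) \<oplus>\<^bsub>F\<^esub> toeplitz p = \<zero>\<^bsub>F\<^esub>"
      using toeplitz_add[of "\<ominus>\<^bsub>F\<^esub> p" p] that by (simp add: F.l_neg toeplitz_zero)
    then show ?thesis using F.minus_equality that toeplitz_carrier by simp
  qed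
  show ?thesis
  proof (rule submodI)
    show "toeplitz ` S \<subseteq> carrier F" using S(1) toeplitz_carrier by blast
    show "\<zero>\<^bsub>F\<^esub> \<in> toeplitz ` S" using S(2) toeplitz_zero by (metis imageI)
    fix f assume "f \<in> toeplitz ` S"
    then obtain p where p: "p \<in> S" "p \<in> carrier F" "f = toeplitz p" using S(1) by blast
    show "\<ominus>\<^bsub>F\<^esub> f \<in> toeplitz ` S" using minus[OF p(2)] S(4)[OF p(1)] p(3) by (metis imageI)
    show "const_fun a \<otimes>\<^bsub>F\<^esub> f \<in> toeplitz ` S" if "a \<in> carrier A" for a
      using toeplitz_smult[OF p(2) that] S(5)[OF that p(1)] p(3) by (metis imageI)
    fix g assume "g \<in> toeplitz ` S"
    then obtain q where q: "q \<in> S" "q \<in> carrier F" "g = toeplitz q" using S(1) by blast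
    show "f \<oplus>\<^bsub>F\<^esub> g \<in> toeplitz ` S" using toeplitz_add[OF p(2) q(2)] S(3)[OF p(1) q(1)] p(3) q(3) by (metis imageI)
  qed
qed

text \<open>In degree \<open>i\<close> the target consists of m + n copies of the old module, n
  being the length of \<open>ys\<close>. By injectivity, the elements that the Toeplitz map sends
  into the power of \<open>I\<close> are those with entries in \<open>I\<close>; so by the rank
  formula its image takes away \<open>m * H (i - 1)\<close>.\<close>

lemma stage_next:
  fixes m :: nat
  assumes st: "stage (Suc d) V I H" and d: "Suc d \<le> length xs"
  shows "stage d (Glue V (m + length ys)) (Glue I (m + length ys) <+>\<^bsub>F\<^esub> toeplitz ` Glue V m)
    (\<lambda>i. of_nat (m + length ys) * H i - (if i = 0 then 0 else of_nat m * H (i - 1)))"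
proof -
  interpret F: cring F by (rule F_cring)
  have V: "submod V" and I: "submod I" and IV: "I \<subseteq> V"
    and pj: "\<And>i f. f \<in> V \<Longrightarrow> pj i f \<in> V" "\<And>i f. f \<in> I \<Longrightarrow> pj i f \<in> I"
    and reg: "\<And>v. v \<in> V \<Longrightarrow> const_fun (xs ! 0) \<otimes>\<^bsub>F\<^esub> v \<in> I \<Longrightarrow> v \<in> I"
    and dims: "\<And>i. \<exists>v u. F.dimension v KF (V \<inter> homog i) \<and> F.dimension u KF (I \<inter> homog i) \<and>
       H i = of_nat v - of_nat u"
    using st unfolding stage_def by (blast, blast, blast, blast, blast, force, blast)
  let ?n = "m + length ys"
  let ?J = "Glue I ?n <+>\<^bsub>F\<^esub> toeplitz ` Glue V m"
  have "0 < length xs" using d by linarith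
  then have x0: "xs ! 0 \<in> above 1" using xs_above nth_mem by blast
  have "submod (Glue V ?n)" by (rule Glue_submod[OF V])
  moreover have "submod ?J"
    by (rule submod_add[OF Glue_submod[OF I] toeplitz_image_submod[OF Glue_submod[OF V]]])
  moreover have "?J \<subseteq> Glue V ?n"
  proof
    fix f assume "f \<in> ?J"
    then obtain p g where "p \<in> Glue I ?n" "g \<in> Glue V m" "f = p \<oplus>\<^bsub>F\<^esub> toeplitz g"
      unfolding F.set_add_iff by blast
    then show "f \<in> Glue V ?n"
      using Glue_mono[OF IV, of ?n] toeplitz_Glue[OF V, of g m] submodD(3)[OF Glue_submod[OF V, of ?n]] by auto
  qed
  moreover have "\<forall>i. \<forall>f\<in>Glue V ?n. pj i f \<in> Glue V ?n"
    using pj_Glue[OF submodD(1)[OF V] pj(1)] by blast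
  moreover have "\<forall>i. \<forall>f\<in>?J. pj i f \<in> ?J"
    using homog_next(2)[OF V pj(1) I pj(2)] by blast
  moreover have "\<forall>i<d. \<forall>f\<in>Glue V ?n. const_fun (xs ! i) \<otimes>\<^bsub>F\<^esub> f \<in> extend ?J (Glue V ?n) i \<longrightarrow> f \<in> extend ?J (Glue V ?n) i"
  proof (intro allI ballI impI)
    fix i f assume i: "i < d" and f: "f \<in> Glue V ?n"
      and xf: "const_fun (xs ! i) \<otimes>\<^bsub>F\<^esub> f \<in> extend ?J (Glue V ?n) i"
    have "i \<le> length xs" using i d by simp
    note e = extend_next[OF V I this, of m]
    show "f \<in> extend ?J (Glue V ?n) i"
      using stage_regular_next[OF st d i f xf[unfolded e]] e by simp
  qed
  moreover have "\<exists>v u. F.dimension v KF (Glue V ?n \<inter> homog i) \<and> F.dimension u KF (?J \<inter> homog i) \<and>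
       of_nat ?n * H i - (if i = 0 then 0 else of_nat m * H (i - 1)) = (of_nat v - of_nat u :: rat)" for i
  proof -
    obtain v u where vu: "F.dimension v KF (V \<inter> homog i)" "F.dimension u KF (I \<inter> homog i)"
      "H i = of_nat v - of_nat u" using dims[of i] by blast
    have dV: "F.dimension (?n * v) KF (Glue V ?n \<inter> homog i)"
      using dimension_Glue[OF K_subfield vu(1), of ?n] by (simp add: Glue_homog)
    have dI: "F.dimension (?n * u) KF (Glue (I \<inter> homog i) ?n)"
      using dimension_Glue[OF K_subfield vu(2)] .
    show ?thesis
    proof (cases "i = 0")
      case True
      then have "?J \<inter> homog i = Glue (I \<inter> homog i) ?n"
        using homog_next(1)[OF V pj(1) I pj(2), of ?n m i] by simp
      then have "F.dimension (?n * u) KF (?J \<inter> homog i)" using dI by simp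
      moreover have "of_nat ?n * H i - (if i = 0 then 0 else of_nat m * H (i - 1)) =
          (of_nat (?n * v) - of_nat (?n * u) :: rat)"
        unfolding vu(3) using True by (simp add: algebra_simps)
      ultimately show ?thesis using dV by blast
    next
      case False
      obtain v' u' where vu': "F.dimension v' KF (V \<inter> homog (i - 1))" "F.dimension u' KF (I \<inter> homog (i - 1))"
        "H (i - 1) = of_nat v' - of_nat u'" using dims[of "i - 1"] by blast
      let ?W = "Glue (V \<inter> homog (i - 1)) m" and ?U = "Glue (I \<inter> homog i) ?n"
      have dW: "F.dimension (m * v') KF ?W" using dimension_Glue[OF K_subfield vu'(1)] .
      have Wc: "?W \<subseteq> carrier F" using F.subalgebraD(1)[OF F.dimension_subalgebra[OF KF_subfield dW]] .
      have "{g \<in> ?W. toeplitz g \<in> ?U} = Glue (I \<inter> homog (i - 1)) m"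
      proof (intro equalityI subsetI)
        fix g assume "g \<in> {g \<in> ?W. toeplitz g \<in> ?U}"
        then have g: "g \<in> Glue V m" "g \<in> homog (i - 1)" "toeplitz g \<in> Glue I ?n"
          by (auto simp: Glue_homog)
        have "g \<in> Glue I m"
          using toeplitz_injective_modulo[OF I V x0 reg g(1)] Glue_slice[OF submodD(2)[OF I] g(3)] by blast
        then show "g \<in> Glue (I \<inter> homog (i - 1)) m" using g(2) by (simp add: Glue_homog)
      next
        fix g assume "g \<in> Glue (I \<inter> homog (i - 1)) m"
        then have g: "g \<in> Glue I m" "g \<in> homog (i - 1)" by (auto simp: Glue_homog)
        then have gc: "g \<in> carrier F" using homog_carrier by blast
        have "pj i (toeplitz g) = toeplitz g" using pj_toeplitz[OF gc, of i] False pj_homog[OF g(2)] by simp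
        then have "toeplitz g \<in> homog i" using pj_in_homog[OF toeplitz_carrier[OF gc], of i] by simp
        then show "g \<in> {g \<in> ?W. toeplitz g \<in> ?U}"
          using toeplitz_Glue[OF I g(1)] g Glue_mono[OF IV, of m] by (auto simp: Glue_homog)
      qed
      then have W0: "F.dimension (m * u') KF {g \<in> ?W. toeplitz g \<in> ?U}"
        using dimension_Glue[OF K_subfield vu'(2)] by simp
      have smult: "toeplitz (k \<otimes>\<^bsub>F\<^esub> g) = k \<otimes>\<^bsub>F\<^esub> toeplitz g" if "k \<in> KF" "g \<in> ?W" for k g
        using that Wc K_carrier toeplitz_smult by blast
      note dim = F.dimension_add_image[OF KF_subfield dI dW W0 toeplitz_carrier[OF subsetD[OF Wc]]
          toeplitz_add[OF subsetD[OF Wc] subsetD[OF Wc]] smult]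
      have "F.dimension (?n * u + m * v' - m * u') KF (?J \<inter> homog i)"
        using dim(1) homog_next(1)[OF V pj(1) I pj(2), of ?n m i] False by simp
      moreover have "of_nat ?n * H i - (if i = 0 then 0 else of_nat m * H (i - 1)) =
          (of_nat (?n * v) - of_nat (?n * u + m * v' - m * u') :: rat)"
      proof -
        \<comment> \<open>The subtraction of natural numbers is exact, since the kernel has at most
          the dimension of the whole space.\<close>
        have "(of_nat (?n * u + m * v' - m * u') :: rat) = of_nat (?n * u + m * v') - of_nat (m * u')"
          using dim(2) by (intro of_nat_diff trans_le_add2)
        then show ?thesis unfolding vu(3) vu'(3) using False by (simp add: algebra_simps)
      qed
      ultimately show ?thesis using dV by blast
    qed
  qed
  ultimately show ?thesis unfolding stage_def by blast
qed

text \<open>The first module is A itself, embedded as the functions supported at the empty list.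
  With the zero submodule, \<open>extend\<close> runs through the ideals generated by the initial
  segments of \<open>xs\<close>, so regularity of the sequence is literally the condition in
  \<open>stage\<close>.\<close>

lemma stage_start:
  assumes reg: "regular_sequence A xs"
  shows "\<exists>V I. stage (length xs) V I (\<lambda>i. of_nat (dim K (gr i)))"
proof -
  interpret F: cring F by (rule F_cring)
  define \<delta> :: "'a \<Rightarrow> nat list \<Rightarrow> 'a" where "\<delta> a = (\<lambda>w. if w = [] then a else \<zero>)" for a
  define V where "V = \<delta> ` carrier A"
  have inj: "\<delta> a = \<delta> b \<longleftrightarrow> a = b" for a b
    by (metis \<delta>_def)
  have ops: "\<delta> (a \<oplus> b) = \<delta> a \<oplus>\<^bsub>F\<^esub> \<delta> b" "\<delta> (a \<otimes> b) = const_fun a \<otimes>\<^bsub>F\<^esub> \<delta> b" "\<delta> a \<in> carrier F"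
    "\<delta> \<zero> = \<zero>\<^bsub>F\<^esub>" "pj i (\<delta> a) = \<delta> (proj i a)"
    if "a \<in> carrier A" "b \<in> carrier A" for a b i
    using that by (auto simp: \<delta>_def fun_ring_simps const_fun_def pj_def proj_zero)
  have minus: "\<ominus>\<^bsub>F\<^esub> \<delta> a = \<delta> (\<ominus> a)" if "a \<in> carrier A" for a
    using fun_ring_minus[of "\<delta> a"] ops(3)[OF that that] that by (auto simp: \<delta>_def)
  have V: "submod V"
  proof (rule submodI)
    show "V \<subseteq> carrier F" using ops(3) by (auto simp: V_def)
    show "\<zero>\<^bsub>F\<^esub> \<in> V" using ops(4)[of \<zero> \<zero>] by (auto simp: V_def intro!: image_eqI[of _ _ \<zero>])
  qed (use ops(1,2)[symmetric] minus in \<open>auto simp: V_def\<close>)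
  have Z: "submod {\<zero>\<^bsub>F\<^esub>}" by (rule submodI) auto
  have xc: "set xs \<subseteq> carrier A" using reg by (simp add: regular_sequence_def)
  have ext: "extend {\<zero>\<^bsub>F\<^esub>} V i = \<delta> ` (Idl (set (take i xs)))" if "i \<le> length xs" for i
    using that
  proof (induction i)
    case 0
    have "Idl {} = {\<zero>}"
      using genideal_minimal[OF zeroideal, of "{}"] additive_subgroup.zero_closed[of "Idl {}" A]
        ideal.axioms(1)[OF genideal_ideal[of "{}"]] by auto
    then show ?case using ops(4)[of \<zero> \<zero>] by simp
  next
    case (Suc i)
    let ?S = "set (take i xs)" and ?x = "xs ! i"
    have x: "?x \<in> carrier A" using Suc.prems x_carrier by simp
    have S: "?S \<subseteq> carrier A" using xc set_take_subset[of i xs] by blast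
    have Sc: "Idl ?S \<subseteq> carrier A" using ideal.Icarr[OF genideal_ideal[OF S]] by blast
    have "set (take (Suc i) xs) = insert ?x ?S"
      using Suc.prems by (simp add: take_Suc_conv_app_nth)
    then have "Idl (set (take (Suc i) xs)) = Idl ?S <+>\<^bsub>A\<^esub> PIdl ?x"
      using Idl_insert[OF S x] by simp
    also have "\<delta> ` \<dots> = \<delta> ` (Idl ?S) <+>\<^bsub>F\<^esub> (\<lambda>f. const_fun ?x \<otimes>\<^bsub>F\<^esub> f) ` V"
    proof -
      have 1: "\<delta> (a \<oplus> r \<otimes> ?x) = \<delta> a \<oplus>\<^bsub>F\<^esub> const_fun ?x \<otimes>\<^bsub>F\<^esub> \<delta> r" if "a \<in> Idl ?S" "r \<in> carrier A" for a r
        using ops(1)[of a "r \<otimes> ?x"] ops(2)[of ?x r] that Sc x m_comm[of r ?x] by auto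
      show ?thesis
      proof (intro equalityI subsetI)
        fix z assume "z \<in> \<delta> ` (Idl ?S <+>\<^bsub>A\<^esub> PIdl ?x)"
        then obtain a r where "a \<in> Idl ?S" "r \<in> carrier A" "z = \<delta> (a \<oplus> r \<otimes> ?x)"
          unfolding image_iff set_add_iff Bex_def cgenideal_def by blast
        then show "z \<in> \<delta> ` (Idl ?S) <+>\<^bsub>F\<^esub> (\<lambda>f. const_fun ?x \<otimes>\<^bsub>F\<^esub> f) ` V"
          unfolding F.set_add_iff V_def using 1 by blast
      next
        fix z assume "z \<in> \<delta> ` (Idl ?S) <+>\<^bsub>F\<^esub> (\<lambda>f. const_fun ?x \<otimes>\<^bsub>F\<^esub> f) ` V"
        then obtain a r where ar: "a \<in> Idl ?S" "r \<in> carrier A" "z = \<delta> a \<oplus>\<^bsub>F\<^esub> const_fun ?x \<otimes>\<^bsub>F\<^esub> \<delta> r"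
          unfolding F.set_add_iff V_def by blast
        then have "z = \<delta> (a \<oplus> r \<otimes> ?x)" using 1[OF ar(1,2)] by simp
        moreover have "r \<otimes> ?x \<in> PIdl ?x" using ar(2) by (auto simp: cgenideal_def)
        then have "a \<oplus> r \<otimes> ?x \<in> Idl ?S <+>\<^bsub>A\<^esub> PIdl ?x"
          using ar(1) unfolding set_add_iff by blast
        ultimately show "z \<in> \<delta> ` (Idl ?S <+>\<^bsub>A\<^esub> PIdl ?x)" by blast
      qed
    qed
    finally show ?case using Suc by simp
  qed
  have "\<forall>i<length xs. \<forall>f\<in>V. const_fun (xs ! i) \<otimes>\<^bsub>F\<^esub> f \<in> extend {\<zero>\<^bsub>F\<^esub>} V i \<longrightarrow> f \<in> extend {\<zero>\<^bsub>F\<^esub>} V i"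
  proof (intro allI ballI impI)
    fix i f assume i: "i < length xs" and f: "f \<in> V" and xf: "const_fun (xs ! i) \<otimes>\<^bsub>F\<^esub> f \<in> extend {\<zero>\<^bsub>F\<^esub>} V i"
    obtain a where a: "a \<in> carrier A" "f = \<delta> a" using f by (auto simp: V_def)
    have x: "xs ! i \<in> carrier A" using i x_carrier by simp
    have "\<delta> (xs ! i \<otimes> a) \<in> \<delta> ` (Idl (set (take i xs)))"
      using xf ext[of i] i ops(2)[OF x a(1)] a(2) by simp
    then have "xs ! i \<otimes> a \<in> Idl (set (take i xs))" using inj by auto
    then have "a \<in> Idl (set (take i xs))" using reg a(1) i unfolding regular_sequence_def by blast
    then show "f \<in> extend {\<zero>\<^bsub>F\<^esub>} V i" using ext[of i] i a(2) by simp
  qed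
  moreover have "\<exists>v u. F.dimension v KF (V \<inter> homog i) \<and> F.dimension u KF ({\<zero>\<^bsub>F\<^esub>} \<inter> homog i) \<and>
      (of_nat (dim K (gr i)) :: rat) = of_nat v - of_nat u" for i
  proof -
    obtain n where n: "dimension n K (gr i)" using finite_dimension_gr by blast
    have "F.dimension n KF (\<delta> ` gr i)"
      by (rule dimension_inj_image[OF ring_axioms K_subfield F.ring_axioms KF_subfield n, where \<sigma> = const_fun])
         (use ops(1,2) ops(3)[OF _ zero_closed] gr_carrier inj K_carrier in \<open>auto simp: inj_on_def\<close>)
    moreover have "\<delta> ` gr i = V \<inter> homog i"
    proof
      show "\<delta> ` gr i \<subseteq> V \<inter> homog i"
        using gr_carrier gr_D(2) by (auto simp: V_def homog_def \<delta>_def)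
      show "V \<inter> homog i \<subseteq> \<delta> ` gr i"
      proof
        fix f assume "f \<in> V \<inter> homog i"
        then obtain a where "f = \<delta> a" "\<forall>w. \<delta> a w \<in> gr i" by (auto simp: V_def homog_def)
        moreover from this have "\<delta> a [] \<in> gr i" by blast
        ultimately show "f \<in> \<delta> ` gr i" by (simp add: \<delta>_def)
      qed
    qed
    moreover have "{\<zero>\<^bsub>F\<^esub>} \<inter> homog i = {\<zero>\<^bsub>F\<^esub>}" using gr_D(2) by (auto simp: homog_def fun_ring_simps)
    ultimately show ?thesis
      using dim_eq[OF K_subfield n] F.zero_dim[of KF] by (intro exI[of _ n] exI[of _ 0]) simp
  qed
  moreover have "\<forall>i. \<forall>f\<in>V. pj i f \<in> V" using ops(5) proj_carrier by (auto simp: V_def)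
  moreover have "\<forall>i. \<forall>f\<in>{\<zero>\<^bsub>F\<^esub>}. pj i f \<in> {\<zero>\<^bsub>F\<^esub>}" using pj_ops(4) F.zero_closed by blast
  ultimately have "stage (length xs) V {\<zero>\<^bsub>F\<^esub>} (\<lambda>i. of_nat (dim K (gr i)))"
    using V Z submodD(2)[OF V] unfolding stage_def by blast
  then show ?thesis by blast
qed

lemma stage_nonneg:
  assumes "stage d V I H"
  shows "H i \<ge> 0"
proof -
  interpret F: cring F by (rule F_cring)
  obtain v u where "F.dimension v KF (V \<inter> homog i)" "F.dimension u KF (I \<inter> homog i)"
    "H i = of_nat v - of_nat u" "I \<subseteq> V" using assms unfolding stage_def by blast
  moreover from this have "u \<le> v" using F.dimension_mono[OF KF_subfield, of u "I \<inter> homog i" v "V \<inter> homog i"] by blast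
  ultimately show ?thesis by simp
qed

text \<open>After \<open>j\<close> steps the Hilbert series has acquired \<open>j\<close> linear
  factors, and \<open>length xs - j\<close> elements of the sequence are left. Every value of a
  Hilbert function is a difference of dimensions of nested spaces.\<close>

lemma toeplitz_hilbert_nonneg:
  assumes "regular_sequence A xs"
  shows "(hilbert_series K A gr * (fps_const (of_nat (m + length ys)) - fps_const (of_nat m) * fps_X) ^ length xs) $ i \<ge> 0"
proof -
  let ?p = "fps_const (of_nat (m + length ys)) - fps_const (of_nat m) * fps_X :: rat fps"
  have "\<exists>V I. stage (length xs - j) V I (\<lambda>i. (hilbert_series K A gr * ?p ^ j) $ i)" if "j \<le> length xs" for j
    using that
  proof (induction j)
    case 0
    then show ?case using stage_start[OF assms] by (simp add: hilbert_series_def)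
  next
    case (Suc j)
    let ?h = "hilbert_series K A gr * ?p ^ j"
    obtain V I where "stage (length xs - j) V I (\<lambda>i. ?h $ i)" using Suc by auto
    moreover have "length xs - j = Suc (length xs - Suc j)" using Suc.prems by simp
    ultimately have "stage (Suc (length xs - Suc j)) V I (\<lambda>i. ?h $ i)" by simp
    moreover have "Suc (length xs - Suc j) \<le> length xs" using Suc.prems by simp
    ultimately obtain V' I' where
      "stage (length xs - Suc j) V' I' (\<lambda>i. of_nat (m + length ys) * ?h $ i - (if i = 0 then 0 else of_nat m * ?h $ (i - 1)))"
      using stage_next[of "length xs - Suc j" V I "\<lambda>i. ?h $ i" m] by blast
    moreover have "(\<lambda>i. of_nat (m + length ys) * ?h $ i - (if i = 0 then 0 else of_nat m * ?h $ (i - 1))) =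
      (\<lambda>i. (hilbert_series K A gr * ?p ^ Suc j) $ i)"
    proof
      fix i
      have "hilbert_series K A gr * ?p ^ Suc j = fps_const (of_nat (m + length ys)) * ?h - fps_const (of_nat m) * (?h * fps_X)"
        by (simp add: algebra_simps)
      then show "of_nat (m + length ys) * ?h $ i - (if i = 0 then 0 else of_nat m * ?h $ (i - 1)) =
          (hilbert_series K A gr * ?p ^ Suc j) $ i"
        by simp
    qed
    ultimately show ?case by auto
  qed
  from this[of "length xs"] show ?thesis using stage_nonneg by fastforce
qed

end

section \<open>Hilbert series\<close>

text \<open>The coefficients are rational, but the limit is taken in the reals. A further factor
  expresses coefficient \<open>i\<close> through the previous coefficients \<open>i\<close> and
  \<open>i - 1\<close>, so the induction keeps \<open>i\<close> arbitrary.\<close>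

lemma fps_linear_power_tendsto:
  fixes f :: "rat fps" and c :: "nat \<Rightarrow> rat"
  assumes "(\<lambda>m. real_of_rat (c m)) \<longlonglongrightarrow> 1"
  shows "(\<lambda>m. real_of_rat ((f * (fps_const (c m) - fps_X) ^ d) $ i)) \<longlonglongrightarrow> real_of_rat ((f * (1 - fps_X) ^ d) $ i)"
proof (induction d arbitrary: i)
  case (Suc d)
  have step: "(f * (fps_const a - fps_X) ^ Suc d) $ i =
      a * (f * (fps_const a - fps_X) ^ d) $ i - (if i = 0 then 0 else (f * (fps_const a - fps_X) ^ d) $ (i - 1))" for a
  proof -
    have "f * (fps_const a - fps_X) ^ Suc d =
        fps_const a * (f * (fps_const a - fps_X) ^ d) - (f * (fps_const a - fps_X) ^ d) * fps_X"
      by (simp add: algebra_simps)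
    then show ?thesis by simp
  qed
  have "(\<lambda>m. real_of_rat (c m) * real_of_rat ((f * (fps_const (c m) - fps_X) ^ d) $ i) -
      (if i = 0 then 0 else real_of_rat ((f * (fps_const (c m) - fps_X) ^ d) $ (i - 1)))) \<longlonglongrightarrow>
    1 * real_of_rat ((f * (1 - fps_X) ^ d) $ i) - (if i = 0 then 0 else real_of_rat ((f * (1 - fps_X) ^ d) $ (i - 1)))"
    by (intro tendsto_intros assms Suc) (auto intro: Suc)
  moreover have "real_of_rat ((f * (fps_const (c m) - fps_X) ^ Suc d) $ i) =
     real_of_rat (c m) * real_of_rat ((f * (fps_const (c m) - fps_X) ^ d) $ i) -
      (if i = 0 then 0 else real_of_rat ((f * (fps_const (c m) - fps_X) ^ d) $ (i - 1)))" for m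
    unfolding step by (auto simp: of_rat_diff of_rat_mult)
  moreover have "real_of_rat ((f * (1 - fps_X) ^ Suc d) $ i) =
     1 * real_of_rat ((f * (1 - fps_X) ^ d) $ i) - (if i = 0 then 0 else real_of_rat ((f * (1 - fps_X) ^ d) $ (i - 1)))"
    using step[of 1] by (auto simp: of_rat_diff)
  ultimately show ?case by presburger
qed simp

lemma fps_mult_one_minus_X_power_nonneg:
  fixes f :: "rat fps"
  assumes "\<And>m::nat. (f * (fps_const (of_nat (m + n)) - fps_const (of_nat m) * fps_X) ^ d) $ i \<ge> 0"
  shows "(f * (1 - fps_X) ^ d) $ i \<ge> 0"
proof -
  \<comment> \<open>Division of the linear factor by the coefficient \<open>Suc m\<close> leaves c_m
    - X; the successor avoids a division by zero.\<close>
  define c where "c m = (of_nat (Suc m + n) / of_nat (Suc m) :: rat)" for m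
  have "(\<lambda>m. real_of_rat (c m)) \<longlonglongrightarrow> 1"
  proof -
    have "(\<lambda>m. 1 + real n * inverse (real (Suc m))) \<longlonglongrightarrow> 1 + real n * 0"
      by (intro tendsto_intros LIMSEQ_inverse_real_of_nat)
    moreover have "real_of_rat (c m) = 1 + real n * inverse (real (Suc m))" for m
      unfolding c_def of_rat_divide of_rat_of_nat_eq by (simp add: field_simps)
    ultimately show ?thesis by simp
  qed
  note lim = fps_linear_power_tendsto[OF this, of f d i]
  have "0 \<le> (f * (fps_const (c m) - fps_X) ^ d) $ i" for m
  proof -
    have "fps_const (of_nat (Suc m + n)) - fps_const (of_nat (Suc m)) * fps_X =
        fps_const (of_nat (Suc m) :: rat) * (fps_const (c m) - fps_X)"
      unfolding c_def right_diff_distrib fps_const_mult by simp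
    then have "f * (fps_const (of_nat (Suc m + n)) - fps_const (of_nat (Suc m)) * fps_X) ^ d =
        fps_const (of_nat (Suc m) ^ d) * (f * (fps_const (c m) - fps_X) ^ d)"
      by (simp only: power_mult_distrib fps_const_power mult.left_commute)
    with assms[of "Suc m"] have "0 \<le> of_nat (Suc m) ^ d * (f * (fps_const (c m) - fps_X) ^ d) $ i"
      by (simp only: fps_mult_left_const_nth)
    moreover have "0 < (of_nat (Suc m) :: rat) ^ d" by (simp del: of_nat_Suc)
    ultimately show ?thesis unfolding zero_le_mult_iff by linarith
  qed
  then have "0 \<le> real_of_rat ((f * (1 - fps_X) ^ d) $ i)"
    by (intro LIMSEQ_le_const[OF lim]) simp
  then show ?thesis by simp
qed

section \<open>Nonnegativity and constant term of the numerator\<close>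

lemma standard_graded_generators:
  assumes "standard_graded_algebra K A gr"
  obtains ys where "graded_generators K A gr ys"
proof -
  interpret standard_graded_algebra K A gr by fact
  obtain S where S: "finite S" "S \<subseteq> gr 1" "generate_ring A (K \<union> S) = carrier A"
    using gr_1_generates by blast
  obtain ys where "set ys = S" using finite_list[OF S(1)] by blast
  then have "graded_generators K A gr ys"
    using S by unfold_locales auto
  then show ?thesis using that by blast
qed

lemma cohen_macaulay_numerator_nonneg:
  assumes A: "standard_graded_algebra K A gr" and dim: "krull_dim A = enat d"
    and h: "hilbert_series K A gr = fps_of_poly h / (1 - fps_X) ^ d" and CM: "cohen_macaulay A"
  shows "coeff h i \<ge> 0"
proof -
  obtain ys where "graded_generators K A gr ys" using standard_graded_generators[OF A] .
  then interpret graded_generators K A gr ys .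
  obtain xs where xs: "regular_sequence A xs" "set xs \<subseteq> above 1" "length xs = d"
    using cohen_macaulay_regular_sequence[OF CM dim] .
  interpret graded_sequence K A gr ys xs by unfold_locales (rule xs(2))
  have "(hilbert_series K A gr * (1 - fps_X) ^ d) $ i \<ge> 0"
    using toeplitz_hilbert_nonneg[OF xs(1)] unfolding xs(3) by (rule fps_mult_one_minus_X_power_nonneg)
  moreover have "is_unit ((1 - fps_X) ^ d :: rat fps)"
    by (simp add: fps_is_unit_iff fps_nth_power_0)
  ultimately show ?thesis unfolding h by (simp add: unit_imp_dvd)
qed

text \<open>The denominator has constant term 1, and the component of degree 0 is the ground field,
  of dimension 1 over itself.\<close>

lemma numerator_constant_term:
  assumes A: "standard_graded_algebra K A gr"
    and h: "hilbert_series K A gr = fps_of_poly h / (1 - fps_X) ^ d"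
  shows "coeff h 0 = 1"
proof -
  interpret standard_graded_algebra K A gr by fact
  have "is_unit ((1 - fps_X) ^ d :: rat fps)"
    by (simp add: fps_is_unit_iff fps_nth_power_0)
  then have "hilbert_series K A gr * (1 - fps_X) ^ d = fps_of_poly h"
    unfolding h by (simp add: unit_imp_dvd)
  then have "hilbert_series K A gr $ 0 = poly.coeff h 0"
    by (metis fps_mult_nth_0 fps_of_poly_nth fps_nth_power_0 fps_sub_nth fps_one_nth fps_X_nth diff_zero
        mult.right_neutral power_one zero_neq_one)
  moreover have "dim K (gr 0) = 1" using dim_eq[OF K_subfield dimension_one[OF K_subfield]] gr_0 by simp
  ultimately show ?thesis by (simp add: hilbert_series_def)
qed

section \<open>The Veronese algebra as a subring\<close>

context standard_graded_algebra
begin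

text \<open>Replacing finite sums by a condition on components makes closure under multiplication a
  matter of divisibility of degrees. For the harder inclusion, division by \<open>r\<close>
  reindexes the support of an element injectively.\<close>

lemma carrier_veronese:
  assumes "r \<ge> 1"
  shows "carrier (veronese r gr A) = {x \<in> carrier A. \<forall>i. \<not> r dvd i \<longrightarrow> proj i x = \<zero>}" (is "_ = ?D")
proof
  have D: "subalgebra K ?D A"
    by (rule subalgebraI)
       (use K_carrier in \<open>auto simp: proj_zero proj_add proj_minus proj_smult\<close>)
  have "finsum A f N \<in> ?D" if "finite N" "\<forall>n\<in>N. f n \<in> gr (n * r)" for f N
  proof (rule subalgebra_finsum[OF D that(1)])
    fix n assume "n \<in> N"
    then show "f n \<in> ?D" using that(2) gr_carrier proj_of_gr[of "f n" "n * r"] by auto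
  qed
  then show "carrier (veronese r gr A) \<subseteq> ?D"
    unfolding veronese_def veronese_grading_def by auto
  show "?D \<subseteq> carrier (veronese r gr A)"
  proof
    fix x assume x: "x \<in> ?D"
    let ?N = "{i. proj i x \<noteq> \<zero>}"
    have c: "x \<in> carrier A" using x by blast
    have r: "i div r * r = i" if "i \<in> ?N" for i
    proof -
      have "r dvd i" using that x by auto
      then show ?thesis by simp
    qed
    have "inj_on (\<lambda>i. i div r) ?N" using r by (metis (no_types, lifting) inj_onI)
    then have "(\<Oplus>n\<in>(\<lambda>i. i div r) ` ?N. proj (n * r) x) = (\<Oplus>i\<in>?N. proj (i div r * r) x)"
      using proj_carrier c by (intro finsum_reindex) auto
    also have "\<dots> = (\<Oplus>i\<in>?N. proj i x)"
      using proj_carrier c r by (intro add.finprod_cong') auto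
    also have "\<dots> = x" using sum_proj[OF c] .
    finally have "x = finsum A (\<lambda>n. proj (n * r) x) ((\<lambda>i. i div r) ` ?N)" by simp
    moreover have "finite ((\<lambda>i. i div r) ` ?N)" using finite_proj[OF c] by simp
    ultimately show "x \<in> carrier (veronese r gr A)"
      unfolding veronese_def veronese_grading_def using proj_gr[OF c] by auto
  qed
qed

lemma subring_veronese:
  assumes "r \<ge> 1"
  shows "subring (carrier (veronese r gr A)) A"
proof -
  let ?D = "{x \<in> carrier A. \<forall>i. \<not> r dvd i \<longrightarrow> proj i x = \<zero>}"
  have D: "subalgebra K ?D A"
    by (rule subalgebraI)
       (use K_carrier in \<open>auto simp: proj_zero proj_add proj_minus proj_smult\<close>)
  show ?thesis
    unfolding carrier_veronese[OF assms]
  proof (rule subringI)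
    have "\<one> \<in> gr 0" using subringE(3)[OF subfieldE(1)[OF K_subfield]] gr_0 by simp
    then show "\<one> \<in> ?D" using proj_of_gr[of \<one> 0] by auto
    fix x y assume x: "x \<in> ?D" and y: "y \<in> ?D"
    then have c: "x \<in> carrier A" "y \<in> carrier A" by auto
    let ?N = "{k. proj k x \<noteq> \<zero>}"
    have "x \<otimes> y = (\<Oplus>k\<in>?N. proj k x) \<otimes> y" using sum_proj c by simp
    also have "\<dots> = (\<Oplus>k\<in>?N. proj k x \<otimes> y)"
      using finite_proj c proj_carrier by (intro finsum_ldistr) auto
    also have "\<dots> \<in> ?D"
    proof (intro subalgebra_finsum[OF D] finite_proj c)
      fix k assume "k \<in> ?N"
      then have k: "r dvd k" using x by auto
      have "proj i (proj k x \<otimes> y) = \<zero>" if "\<not> r dvd i" for i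
      proof (cases "i < k")
        case False
        then have "\<not> r dvd i - k" using that k by (metis dvd_diffD not_less)
        then show ?thesis
          using proj_mult_gr[OF proj_gr[OF c(1)] c(2), of i k] y proj_carrier[OF c(1)] by auto
      qed (use proj_mult_gr[OF proj_gr[OF c(1)] c(2), of i k] in simp)
      then show "proj k x \<otimes> y \<in> ?D" using c proj_carrier by simp
    qed
    finally show "x \<otimes> y \<in> ?D" .
  qed (use subalgebraD(1,3,4)[OF D] in auto)
qed

text \<open>The two dimensions are computed in different rings. The operations agree, hence so do
  line extensions, and the vectors adjoined on the way lie in the space itself and thus in the
  smaller carrier.\<close>

lemma dim_veronese:
  assumes "r \<ge> 1"
  shows "ring.dim (veronese r gr A) K (gr (n * r)) = dim K (gr (n * r))"
proof -
  let ?C = "carrier (veronese r gr A)" and ?V = "veronese r gr A"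
  have C: "subring ?C A" using subring_veronese[OF assms] .
  have V: "?V = A \<lparr>carrier := ?C\<rparr>" by (simp add: veronese_def)
  interpret V: ring ?V using subring_is_ring[OF C] V by simp
  have Cc: "?C \<subseteq> carrier A" using C by (rule subringE(1))
  have ext: "V.line_extension = line_extension"
    using line_extension_consistent[OF C] V by simp
  have zero: "\<zero>\<^bsub>?V\<^esub> = \<zero>" by (simp add: veronese_def)
  have to_A: "dimension m K E" if "V.dimension m K E" for m E
    using that
  proof (induction m K E rule: V.dimension.induct)
    case (Suc_dim v E m K)
    then show ?case unfolding ext using Cc dimension.Suc_dim[of v E m K] by blast
  qed (simp add: zero zero_dim)
  have from_A: "V.dimension m K E" if "dimension m K E" "E \<subseteq> ?C" "\<zero> \<in> K" "\<one> \<in> K" "K \<subseteq> carrier A" "subfield K A" for m K E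
    using that
  proof (induction m K E rule: dimension.induct)
    case (zero_dim K)
    then show ?case using V.zero_dim[of K] by (simp add: zero)
  next
    case (Suc_dim v E m K)
    note E = subalgebraD[OF dimension_subalgebra[OF Suc_dim.prems(5) Suc_dim.hyps(3)]]
    have "v \<in> line_extension K v E"
      unfolding line_extension_mem_iff using Suc_dim.hyps(1) E(2) Suc_dim.prems(3)
      by (intro bexI[of _ \<one>] bexI[of _ \<zero>]) auto
    moreover have "E \<subseteq> line_extension K v E"
      unfolding line_extension_mem_iff subset_iff using Suc_dim.hyps(1) E(1) Suc_dim.prems(2)
      by (intro allI impI bexI[of _ \<zero>] bexI) auto
    ultimately show ?case
      using Suc_dim V.Suc_dim[of v E m K] unfolding ext by blast
  qed
  have sub: "gr (n * r) \<subseteq> ?C"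
    unfolding carrier_veronese[OF assms] using gr_carrier proj_of_gr by auto
  have K01: "\<zero> \<in> K" "\<one> \<in> K" using subringE(2,3)[OF subfieldE(1)[OF K_subfield]] by auto
  have "V.dimension m K (gr (n * r)) = dimension m K (gr (n * r))" for m
    using to_A from_A[OF _ sub K01 K_carrier K_subfield] by blast
  then show ?thesis unfolding V.dim_def dim_def by simp
qed

lemma hilbert_series_veronese:
  assumes "r \<ge> 1"
  shows "hilbert_series K (veronese r gr A) (veronese_grading r gr) =
    Abs_fps (\<lambda>n. hilbert_series K A gr $ (n * r))"
  using dim_veronese[OF assms] by (simp add: hilbert_series_def veronese_grading_def)

end

theorem corollary1p3:
  fixes K :: "'a set" and A :: "('a, 'b) ring_scheme" and gr :: "nat \<Rightarrow> 'a set"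
    and d s r :: nat and h :: "rat poly"
  assumes "standard_graded_algebra K A gr"
    and "krull_dim A = enat d"
    and "degree h \<le> s"
    and "hilbert_series K A gr = fps_of_poly h / (1 - fps_X) ^ d"
    and "(\<forall>i\<le>s. coeff h i \<ge> 0) \<or> cohen_macaulay A"
    and "r \<ge> 1"
  shows "\<exists>h_r :: rat poly.
    degree h_r \<le> max s d \<and>
    hilbert_series K (veronese r gr A) (veronese_grading r gr) =
      fps_of_poly h_r / (1 - fps_X) ^ d \<and>
    (\<forall>i\<le>d. coeff h_r i \<ge> coeff h i) \<and>
    (r \<ge> d \<longrightarrow> (\<forall>i\<in>{1..<d}. coeff h_r i > coeff h i))"
proof -
  interpret standard_graded_algebra K A gr by (rule assms(1))
  \<comment> \<open>Both alternatives of the hypothesis lead to nonnegativity in every degree;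
    beyond \<open>s\<close> the coefficients vanish.\<close>
  have "poly.coeff h i \<ge> 0" for i
    using assms(5)
  proof
    assume nonneg: "\<forall>i\<le>s. poly.coeff h i \<ge> 0"
    show ?thesis using nonneg coeff_eq_0[of h i] assms(3) by (cases "i \<le> s") auto
  next
    assume "cohen_macaulay A"
    then show ?thesis by (rule cohen_macaulay_numerator_nonneg[OF assms(1,2,4)])
  qed
  then obtain p where "degree p \<le> max s d"
    "Abs_fps (\<lambda>n. (fps_of_poly h / (1 - fps_X) ^ d) $ (n * r)) = fps_of_poly p / (1 - fps_X) ^ d"
    "\<forall>i\<le>d. poly.coeff p i \<ge> poly.coeff h i" "r \<ge> d \<longrightarrow> (\<forall>i\<in>{1..<d}. poly.coeff p i > poly.coeff h i)"
    using veronese_numerator[OF assms(3) _ numerator_constant_term[OF assms(1,4)] assms(6)] by blast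
  then show ?thesis
    unfolding hilbert_series_veronese[OF assms(6)] assms(4) by blast
qed

end
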